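(* Let $\mathscr{S}$ be a crossing-vertex connected hierarchical T-mesh, or the extension, associated with $\mathbf{S}(2,2,1,1,\cdot)$, of a crossing-vertex connected hierarchical T-mesh. Let $V^+$ be the number of crossing vertices of $\mathscr{S}$ and $E$ the number of interior l-edges of $\mathscr{S}$, and suppose $V^+>0$. Then $$\dim \overline{\mathbf{S}}(2,2,1,1,\mathscr{S})=V^+-E+1.$$
   Context: A T-mesh is a rectangular grid that allows T-junctions: a region is subdivided by finitely many horizontal and vertical segments into finitely many closed axis-parallel rectangles (the cells) with pairwise disjoint interiors. It is regular if the region $\Omega$ occupied by all its cells is a rectangle. Vertices are the grid points (corners of cells); a vertex on $\partial\Omega$ is a boundary vertex, and an interior vertex is a crossing vertex if four edges meet there and a T-vertex if exactly three edges meet there. A T-vertex is horizontal if exactly one of its three edges is horizontal, and vertical if exactly one of them is vertical. Edges are the segments joining adjacent vertices; an edge is interior if it does not lie on $\partial\Omega$. A horizontal (vertical) l-edge is a continuous line segment consisting of horizontal (vertical) interior edges whose two endpoints are boundary vertices or horizontal (vertical) T-vertices, i.e. a longest possible line segment in the mesh. The boundary consists of four boundary l-edges; all other l-edges are interior l-edges. Hierarchical T-mesh: start from a tensor-product mesh (full rectangular grid), the level-$0$ mesh, whose cells have level $0$. The level-$(k+1)$ mesh is obtained from the level-$k$ mesh by choosing some cells of level $k$ and subdividing each into four subcells (which are cells of level $k+1$) by joining the midpoints of opposite edges with two straight segments. A mesh obtained after finitely many levels is a hierarchical T-mesh. Crossing-vertex connected (for a regular T-mesh): between any two different crossing vertices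 there is a continuous poly-line consisting of edges of the mesh such that every joint between two neighboring horizontal and vertical edges on the poly-line is a crossing vertex of the mesh. $\mathbf{S}(2,2,1,1,\mathscr{T})$ is the space of functions in $C^{1,1}(\Omega)$ (continuous of order $1$ in the $x$ direction and of order $1$ in the $y$ direction) whose restriction to each cell of $\mathscr{T}$ is a biquadratic polynomial (degree at most $2$ in each of $x$ and $y$). Extension of $\mathscr{T}$ associated with $\mathbf{S}(2,2,1,1,\mathscr{T})$: take a tensor-product mesh $\mathscr{M}$ with $6$ vertical and $6$ horizontal lines whose central rectangle is the region occupied by $\mathscr{T}$; all edges of $\mathscr{T}$ with an endpoint on the boundary of $\mathscr{T}$ are extended (straight) to reach the boundary of $\mathscr{M}$. The extension is the resulting mesh, consisting of $\mathscr{M}$, $\mathscr{T}$ and these extended segments. For a regular T-mesh $\mathscr{S}$ occupying a rectangle $R$, $\overline{\mathbf{S}}(2,2,1,1,\mathscr{S})$ is the space of functions $f\in C^{1,1}(\mathbb{R}^2)$ whose restriction to each cell of $\mathscr{S}$ is a biquadratic polynomial and which vanish identically outside $R$.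
   Formalization: When S is itself a hierarchical T-mesh, every interior l-edge is also assumed to contain a crossing vertex; otherwise the formula fails, e.g. for cells [0,1]×[0,1], [1,2]×[0,1] with only the first subdivided it gives −1. Extensions need no such condition. *)

theory Defs
  imports "HOL-Analysis.Analysis" "HOL-Library.Function_Algebras"
begin

text \<open>Functions with values in a real vector space form a real vector space under the pointwise
  operations; \<^const>\<open>dim\<close> and \<^const>\<open>span\<close> then apply to spaces of functions on the plane.\<close>

instantiation "fun" :: (type, real_vector) real_vector
begin

definition scaleR_fun :: "real \<Rightarrow> ('a \<Rightarrow> 'b) \<Rightarrow> 'a \<Rightarrow> 'b"
  where "scaleR_fun r f = (\<lambda>x. r *\<^sub>R f x)"

instance
  by standard (simp_all add: scaleR_fun_def fun_eq_iff scaleR_add_right scaleR_add_left)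

end

text \<open>A mesh is given by its set of cells; a point \<open>(x, y)\<close> has horizontal coordinate \<open>x\<close>.\<close>

type_synonym point = "real \<times> real"
type_synonym mesh = "point set set"

abbreviation region :: "mesh \<Rightarrow> point set"
  where "region T \<equiv> \<Union>T"

definition t_mesh :: "mesh \<Rightarrow> bool"
  where "t_mesh T \<longleftrightarrow> T division_of region T \<and> (\<forall>c\<in>T. interior c \<noteq> {})"

definition regular_t_mesh :: "mesh \<Rightarrow> bool"
  where "regular_t_mesh T \<longleftrightarrow> t_mesh T \<and> T \<noteq> {} \<and> (\<exists>a b. region T = cbox a b)"

definition skeleton :: "mesh \<Rightarrow> point set"
  where "skeleton T = (\<Union>c\<in>T. frontier c)"

definition vertices :: "mesh \<Rightarrow> point set"
  where "vertices T = {v. \<exists>x1 x2 y1 y2. x1 < x2 \<and> y1 < y2 \<and> cbox (x1, y1) (x2, y2) \<in> T \<and>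
                          v \<in> {x1, x2} \<times> {y1, y2}}"

definition boundary_vertices :: "mesh \<Rightarrow> point set"
  where "boundary_vertices T = vertices T \<inter> frontier (region T)"

definition interior_vertices :: "mesh \<Rightarrow> point set"
  where "interior_vertices T = vertices T - frontier (region T)"

definition horizontal_edges :: "mesh \<Rightarrow> point set set"
  where "horizontal_edges T = {closed_segment p q | p q.
           p \<in> vertices T \<and> q \<in> vertices T \<and> p \<noteq> q \<and> snd p = snd q \<and>
           closed_segment p q \<subseteq> skeleton T \<and> open_segment p q \<inter> vertices T = {}}"

definition vertical_edges :: "mesh \<Rightarrow> point set set"
  where "vertical_edges T = {closed_segment p q | p q.
           p \<in> vertices T \<and> q \<in> vertices T \<and> p \<noteq> q \<and> fst p = fst q \<and>
           closed_segment p q \<subseteq> skeleton T \<and> open_segment p q \<inter> vertices T = {}}"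

definition edges :: "mesh \<Rightarrow> point set set"
  where "edges T = horizontal_edges T \<union> vertical_edges T"

definition interior_edges :: "mesh \<Rightarrow> point set set"
  where "interior_edges T = {e \<in> edges T. \<not> e \<subseteq> frontier (region T)}"

text \<open>No vertex lies in the relative interior of an edge, so the edges containing a vertex are
  exactly those that end there.\<close>

definition crossing_vertices :: "mesh \<Rightarrow> point set"
  where "crossing_vertices T = {v \<in> interior_vertices T. card {e \<in> edges T. v \<in> e} = 4}"

definition t_vertices :: "mesh \<Rightarrow> point set"
  where "t_vertices T = {v \<in> interior_vertices T. card {e \<in> edges T. v \<in> e} = 3}"

definition horizontal_t_vertices :: "mesh \<Rightarrow> point set"
  where "horizontal_t_vertices T = {v \<in> t_vertices T. card {e \<in> horizontal_edges T. v \<in> e} = 1}"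

definition vertical_t_vertices :: "mesh \<Rightarrow> point set"
  where "vertical_t_vertices T = {v \<in> t_vertices T. card {e \<in> vertical_edges T. v \<in> e} = 1}"

definition horizontal_l_edges :: "mesh \<Rightarrow> point set set"
  where "horizontal_l_edges T = {closed_segment p q | p q.
           p \<in> boundary_vertices T \<union> horizontal_t_vertices T \<and>
           q \<in> boundary_vertices T \<union> horizontal_t_vertices T \<and> p \<noteq> q \<and> snd p = snd q \<and>
           (\<exists>F \<subseteq> horizontal_edges T \<inter> interior_edges T. closed_segment p q = \<Union>F)}"

definition vertical_l_edges :: "mesh \<Rightarrow> point set set"
  where "vertical_l_edges T = {closed_segment p q | p q.
           p \<in> boundary_vertices T \<union> vertical_t_vertices T \<and>
           q \<in> boundary_vertices T \<union> vertical_t_vertices T \<and> p \<noteq> q \<and> fst p = fst q \<and>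
           (\<exists>F \<subseteq> vertical_edges T \<inter> interior_edges T. closed_segment p q = \<Union>F)}"

definition interior_l_edges :: "mesh \<Rightarrow> point set set"
  where "interior_l_edges T = horizontal_l_edges T \<union> vertical_l_edges T"

text \<open>A poly-line consisting of edges is given by the list of the vertices it visits.\<close>

definition polyline :: "mesh \<Rightarrow> point list \<Rightarrow> bool"
  where "polyline T ps \<longleftrightarrow> ps \<noteq> [] \<and>
           (\<forall>i. Suc i < length ps \<longrightarrow> ps ! i \<noteq> ps ! Suc i \<and> closed_segment (ps ! i) (ps ! Suc i) \<in> edges T)"

definition turns_at_crossings :: "mesh \<Rightarrow> point list \<Rightarrow> bool"
  where "turns_at_crossings T ps \<longleftrightarrow>
           (\<forall>i. Suc (Suc i) < length ps \<longrightarrow>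
              (let e = closed_segment (ps ! i) (ps ! Suc i);
                   e' = closed_segment (ps ! Suc i) (ps ! Suc (Suc i))
               in e \<in> horizontal_edges T \<and> e' \<in> vertical_edges T \<or>
                  e \<in> vertical_edges T \<and> e' \<in> horizontal_edges T \<longrightarrow>
                  ps ! Suc i \<in> crossing_vertices T))"

definition crossing_vertex_connected :: "mesh \<Rightarrow> bool"
  where "crossing_vertex_connected T \<longleftrightarrow> regular_t_mesh T \<and>
           (\<forall>u \<in> crossing_vertices T. \<forall>v \<in> crossing_vertices T. u \<noteq> v \<longrightarrow>
              (\<exists>ps. polyline T ps \<and> hd ps = u \<and> last ps = v \<and> turns_at_crossings T ps))"

text \<open>The grid with the \<open>m + 1\<close> vertical lines \<open>x 0 < \<dots> < x m\<close> and the \<open>n + 1\<close> horizontal lines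
  \<open>y 0 < \<dots> < y n\<close>.\<close>

definition tensor_cells :: "(nat \<Rightarrow> real) \<Rightarrow> nat \<Rightarrow> (nat \<Rightarrow> real) \<Rightarrow> nat \<Rightarrow> mesh"
  where "tensor_cells x m y n = {cbox (x i, y j) (x (Suc i), y (Suc j)) | i j. i < m \<and> j < n}"

definition tensor_product_mesh :: "mesh \<Rightarrow> bool"
  where "tensor_product_mesh T \<longleftrightarrow>
           (\<exists>x y m n. 0 < m \<and> 0 < n \<and> strict_mono_on {..m} x \<and> strict_mono_on {..n} y \<and>
                      T = tensor_cells x m y n)"

definition subcells :: "point set \<Rightarrow> mesh"
  where "subcells c = {s. \<exists>x1 x2 y1 y2. x1 < x2 \<and> y1 < y2 \<and> c = cbox (x1, y1) (x2, y2) \<and>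
           (let xm = (x1 + x2) / 2; ym = (y1 + y2) / 2
            in s \<in> {cbox (x1, y1) (xm, ym), cbox (xm, y1) (x2, ym),
                     cbox (x1, ym) (xm, y2), cbox (xm, ym) (x2, y2)})}"

text \<open>\<open>level_mesh k T A\<close>: \<open>T\<close> is a level-\<open>k\<close> mesh and \<open>A\<close> is the set of its cells of level \<open>k\<close>.\<close>

inductive level_mesh :: "nat \<Rightarrow> mesh \<Rightarrow> mesh \<Rightarrow> bool" where
  tensor: "tensor_product_mesh T \<Longrightarrow> level_mesh 0 T T"
| refine: "\<lbrakk>level_mesh k T A; C \<subseteq> A; A' = (\<Union>c\<in>C. subcells c)\<rbrakk>
             \<Longrightarrow> level_mesh (Suc k) ((T - C) \<union> A') A'"

definition hierarchical_t_mesh :: "mesh \<Rightarrow> bool"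
  where "hierarchical_t_mesh T \<longleftrightarrow> (\<exists>k A. level_mesh k T A)"

text \<open>The straight prolongations, up to the boundary of the rectangle \<open>R\<close>, of the edges of \<open>T\<close>
  beyond their endpoints \<open>q\<close> on the boundary of the region of \<open>T\<close>. For an edge that itself runs along
  the boundary, the prolongation lies on a line of the surrounding tensor-product mesh below.\<close>

definition prolongations :: "mesh \<Rightarrow> point set \<Rightarrow> point set"
  where "prolongations T R = {r \<in> R. \<exists>p q. p \<in> vertices T \<and> q \<in> vertices T \<and> p \<noteq> q \<and>
           closed_segment p q \<in> edges T \<and> q \<in> frontier (region T) \<and> q \<in> closed_segment p r}"

text \<open>The extension is determined by the rectangle it occupies and by its skeleton; the surrounding
  tensor-product mesh has six lines in each direction.\<close>

definition extension_of :: "mesh \<Rightarrow> mesh \<Rightarrow> bool"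
  where "extension_of S T \<longleftrightarrow>
           (\<exists>x y. strict_mono_on {..5} x \<and> strict_mono_on {..5} y \<and>
              region T = cbox (x 2, y 2) (x 3, y 3) \<and>
              t_mesh S \<and> region S = cbox (x 0, y 0) (x 5, y 5) \<and>
              skeleton S = skeleton (tensor_cells x 5 y 5) \<union> skeleton T \<union>
                           prolongations T (cbox (x 0, y 0) (x 5, y 5)))"

text \<open>Smoothness of order one in each direction. For piecewise polynomials over a T-mesh, matching
  of the function and of its first partial derivatives along the edges already forces the mixed
  second derivative to be continuous, so requiring the latter as well gives the same spline space.\<close>

definition C11 :: "(point \<Rightarrow> real) \<Rightarrow> bool"
  where "C11 f \<longleftrightarrow> continuous_on UNIV f \<and>
           (\<exists>fx fy. continuous_on UNIV fx \<and> continuous_on UNIV fy \<and>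
              (\<forall>x y. ((\<lambda>t. f (t, y)) has_real_derivative fx (x, y)) (at x) \<and>
                     ((\<lambda>t. f (x, t)) has_real_derivative fy (x, y)) (at y)))"

definition biquadratic_on :: "point set \<Rightarrow> (point \<Rightarrow> real) \<Rightarrow> bool"
  where "biquadratic_on c f \<longleftrightarrow>
           (\<exists>a :: nat \<Rightarrow> nat \<Rightarrow> real. \<forall>x y. (x, y) \<in> c \<longrightarrow>
              f (x, y) = (\<Sum>i\<le>2. \<Sum>j\<le>2. a i j * x ^ i * y ^ j))"

definition spline_space_bar :: "mesh \<Rightarrow> (point \<Rightarrow> real) set"
  where "spline_space_bar S =
           {f. C11 f \<and> (\<forall>c\<in>S. biquadratic_on c f) \<and> (\<forall>p. p \<notin> region S \<longrightarrow> f p = 0)}"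

text \<open>If the level-0 grid of a hierarchical mesh has a single row or a single column of cells, its
  interior lines can remain without any crossing vertex. Each such l-edge imposes no condition on
  the splines although it is counted, so it invalidates the dimension formula: for the cells
  \<open>[0,1] \<times> [0,1]\<close> and \<open>[1,2] \<times> [0,1]\<close>, with the first one subdivided, there are one crossing vertex
  and three interior l-edges. The following condition excludes exactly this degeneracy.\<close>

definition l_edges_crossed :: "mesh \<Rightarrow> bool"
  where "l_edges_crossed S \<longleftrightarrow> (\<forall>L \<in> interior_l_edges S. L \<inter> crossing_vertices S \<noteq> {})"

end

theory Submission
  imports Defs
begin

text \<open>Why the formula holds. The proof has three parts.

\<^emph>\<open>Splines as vertex coefficients.\<close> Call the maximal segments of the skeleton runs: these are the
\<open>E\<close> interior l-edges and the four sides of the rectangle. A spline that vanishes outside the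
rectangle can be written in exactly one way as a sum of terms
\<open>c\<^sub>v (x - x\<^sub>v)\<^sub>+\<^sup>2 (y - y\<^sub>v)\<^sub>+\<^sup>2\<close> over the vertices \<open>v\<close> of the mesh. Such a sum is a spline if and only
if along each run the moments of order \<open>0\<close>, \<open>1\<close> and \<open>2\<close> of the coefficients vanish: crossing the
line of a horizontal run at the abscissa \<open>x\<close> adds \<open>(y - y\<^sub>0)\<^sup>2\<close> times the sum of \<open>c\<^sub>v (x - x\<^sub>v)\<^sup>2\<close> over
its vertices to the left of \<open>x\<close>, and this has to vanish as soon as \<open>x\<close> is off the run
(\<open>spline_space_eq\<close>). A vertex that is neither a crossing nor a
corner of the rectangle is the end of exactly one interior l-edge, so there are \<open>V\<^sup>+ + 2 E + 4\<close>
coefficients (\<open>card_verts\<close>), subject to \<open>3 (E + 4)\<close> equations.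

\<^emph>\<open>The relations between the equations.\<close> The solution space has dimension
\<open>V\<^sup>+ + 2 E + 4 - 3 (E + 4) + R\<close>, where \<open>R\<close> is the dimension of the space of linear relations between the
equations (\<open>kernel_relation_index\<close>). A relation attaches a quadratic polynomial to each run such that at each
vertex the two polynomials cancel. Up to a sign on the vertical runs it is therefore a function on the
skeleton whose restriction to each segment is a quadratic polynomial. Restrictions of biquadratic
polynomials are such functions, and they form a space of dimension \<open>9\<close>. The mesh is called rigid if there
are no others; then \<open>R = 9\<close> and the formula follows (\<open>dimension\<close>).

\<^emph>\<open>Rigidity.\<close> A quadratic polynomial with three zeros vanishes. Three lines in each direction determine a
biquadratic polynomial, which can be subtracted, so that the function vanishes on the mesh of level
\<open>0\<close> (\<open>grid_biquadratic\<close>) or on the lines that surround an extension. From there one proceeds level by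
level. If two adjacent cells are subdivided, their common midline has three zeros on the skeleton of
the preceding level, so the function vanishes on it and then on all midlines of the two cells. A cell
without a subdivided neighbour would be isolated: a poly-line that turns only at crossings cannot
leave it, because at its sides it meets T-vertices only. As there is a crossing outside of the cell,
this contradicts the hypothesis that the mesh is crossing-vertex connected (\<open>path_confined\<close>,
\<open>refine_zero\<close>). A mesh of level \<open>0\<close> with a single row or column of cells needs separate care, since it
has no crossing of its own (\<open>rigid_hierarchical\<close>, \<open>zero_from_boundary\<close>).\<close>

section \<open>Rectangular partitions and the four directions at a point\<close>

type_synonym quad = "real \<times> real \<times> real \<times> real"

text \<open>Most facts below have four versions, one for each side of a rectangle. They are proved for the
east side only; the other versions are the same fact for the partition seen in the mirror
\<open>x \<mapsto> -x\<close> or after exchanging the axes. Both symmetries are involutions on quadruples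
\<open>(x1, x2, y1, y2)\<close>, and a partition is transported by taking the preimage.\<close>

fun swap_quad :: "quad \<Rightarrow> quad" where "swap_quad (x1, x2, y1, y2) = (y1, y2, x1, x2)"
fun reflect_quad :: "quad \<Rightarrow> quad" where "reflect_quad (x1, x2, y1, y2) = (-x2, -x1, y1, y2)"

text \<open>The skeleton of a partition as a predicate on the two coordinates, so that the symmetries act on
it by plain substitution.\<close>

definition frame :: "quad set \<Rightarrow> real \<Rightarrow> real \<Rightarrow> bool"
  where "frame Q x y \<longleftrightarrow> (\<exists>x1 x2 y1 y2. (x1, x2, y1, y2) \<in> Q \<and> x1 \<le> x \<and> x \<le> x2 \<and> y1 \<le> y \<and> y \<le> y2 \<and>
     \<not> (x1 < x \<and> x < x2 \<and> y1 < y \<and> y < y2))"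

definition corner :: "quad set \<Rightarrow> real \<Rightarrow> real \<Rightarrow> bool"
  where "corner Q x y \<longleftrightarrow> (\<exists>x1 x2 y1 y2. (x1, x2, y1, y2) \<in> Q \<and> (x = x1 \<or> x = x2) \<and> (y = y1 \<or> y = y2))"

definition xcoords :: "quad set \<Rightarrow> real set"
  where "xcoords Q = {x. \<exists>x1 x2 y1 y2. (x1, x2, y1, y2) \<in> Q \<and> (x = x1 \<or> x = x2)}"

definition no_line :: "quad set \<Rightarrow> real \<Rightarrow> real \<Rightarrow> bool"
  where "no_line Q x x' \<longleftrightarrow> (\<forall>s\<in>xcoords Q. s \<le> x \<or> x' \<le> s)"

text \<open>The compass directions in which the skeleton continues from a point.\<close>

definition east :: "(real \<Rightarrow> real \<Rightarrow> bool) \<Rightarrow> real \<Rightarrow> real \<Rightarrow> bool"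
  where "east K x y \<longleftrightarrow> (\<exists>e>0. \<forall>t. x \<le> t \<and> t \<le> x + e \<longrightarrow> K t y)"
definition west :: "(real \<Rightarrow> real \<Rightarrow> bool) \<Rightarrow> real \<Rightarrow> real \<Rightarrow> bool"
  where "west K x y \<longleftrightarrow> (\<exists>e>0. \<forall>t. x - e \<le> t \<and> t \<le> x \<longrightarrow> K t y)"
definition north :: "(real \<Rightarrow> real \<Rightarrow> bool) \<Rightarrow> real \<Rightarrow> real \<Rightarrow> bool"
  where "north K x y \<longleftrightarrow> (\<exists>e>0. \<forall>t. y \<le> t \<and> t \<le> y + e \<longrightarrow> K x t)"
definition south :: "(real \<Rightarrow> real \<Rightarrow> bool) \<Rightarrow> real \<Rightarrow> real \<Rightarrow> bool"
  where "south K x y \<longleftrightarrow> (\<exists>e>0. \<forall>t. y - e \<le> t \<and> t \<le> y \<longrightarrow> K x t)"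

lemma frame_sw: "frame (swap_quad -` Q) = (\<lambda>x y. frame Q y x)"
  unfolding frame_def by (intro ext) auto

lemma ex_rf: "(\<exists>x1 x2 y1 y2. P x1 x2 y1 y2) \<longleftrightarrow> (\<exists>x1 x2 y1 y2. P (- x2 :: real) (- x1 :: real) y1 y2)"
  by (metis minus_minus)

lemma frame_rf: "frame (reflect_quad -` Q) = (\<lambda>x y. frame Q (-x) y)"
  unfolding frame_def
  by (intro ext, subst ex_rf, rule ex_cong1, rule ex_cong1, rule ex_cong1, rule ex_cong1) auto

lemma corner_sw: "corner (swap_quad -` Q) = (\<lambda>x y. corner Q y x)"
  unfolding corner_def by (intro ext) auto

lemma corner_rf: "corner (reflect_quad -` Q) = (\<lambda>x y. corner Q (-x) y)"
  unfolding corner_def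
  by (intro ext, subst ex_rf, rule ex_cong1, rule ex_cong1, rule ex_cong1, rule ex_cong1) auto

lemma dir_sw [simp]:
  "east (\<lambda>x y. frame Q y x) x y = north (frame Q) y x" "west (\<lambda>x y. frame Q y x) x y = south (frame Q) y x"
  "north (\<lambda>x y. frame Q y x) x y = east (frame Q) y x" "south (\<lambda>x y. frame Q y x) x y = west (frame Q) y x"
  by (simp_all add: east_def west_def north_def south_def)

lemma all_minus: "(\<forall>t::real. P t) = (\<forall>t. P (- t))"
  by (metis minus_minus)

lemma dir_rf [simp]:
  "east (\<lambda>x y. frame Q (-x) y) x y = west (frame Q) (-x) y" "west (\<lambda>x y. frame Q (-x) y) x y = east (frame Q) (-x) y"
  "north (\<lambda>x y. frame Q (-x) y) x y = north (frame Q) (-x) y" "south (\<lambda>x y. frame Q (-x) y) x y = south (frame Q) (-x) y"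
  unfolding east_def west_def north_def south_def
  by (subst all_minus, simp add: minus_le_iff le_minus_iff algebra_simps conj_commute; fail | simp)+

text \<open>Two open cells meet exactly if their sides overlap in both coordinates; with disjointness in this
form all arguments about cells are linear arithmetic. The rectangle that is partitioned is
\<open>[a1, a2] \<times> [b1, b2]\<close>.\<close>

locale rect_partition =
  fixes Q :: "quad set" and a1 a2 b1 b2 :: real
  assumes fin: "finite Q"
    and cell: "(x1, x2, y1, y2) \<in> Q \<Longrightarrow> a1 \<le> x1 \<and> x1 < x2 \<and> x2 \<le> a2 \<and> b1 \<le> y1 \<and> y1 < y2 \<and> y2 \<le> b2"
    and cover: "\<lbrakk>a1 \<le> x; x \<le> a2; b1 \<le> y; y \<le> b2\<rbrakk> \<Longrightarrow>
      \<exists>x1 x2 y1 y2. (x1, x2, y1, y2) \<in> Q \<and> x1 \<le> x \<and> x \<le> x2 \<and> y1 \<le> y \<and> y \<le> y2"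
    and overlap: "\<lbrakk>(x1, x2, y1, y2) \<in> Q; (x1', x2', y1', y2') \<in> Q; x1 < x2'; x1' < x2; y1 < y2'; y1' < y2\<rbrakk>
      \<Longrightarrow> x1 = x1' \<and> x2 = x2' \<and> y1 = y1' \<and> y2 = y2'"
    and wide: "a1 < a2" and high: "b1 < b2"
begin

abbreviation K where "K \<equiv> frame Q"

lemma swapped: "rect_partition (swap_quad -` Q) b1 b2 a1 a2"
proof
  have "inj swap_quad" by (auto simp: inj_def)
  then show "finite (swap_quad -` Q)" using fin by (rule finite_vimageI[rotated])
next
  fix x y assume "b1 \<le> x" "x \<le> b2" "a1 \<le> y" "y \<le> a2"
  then show "\<exists>x1 x2 y1 y2. (x1, x2, y1, y2) \<in> swap_quad -` Q \<and> x1 \<le> x \<and> x \<le> x2 \<and> y1 \<le> y \<and> y \<le> y2"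
    using cover[of y x] by auto
next
  fix x1 x2 y1 y2 x1' x2' y1' y2'
  assume "(x1, x2, y1, y2) \<in> swap_quad -` Q" "(x1', x2', y1', y2') \<in> swap_quad -` Q" 
    "x1 < x2'" "x1' < x2" "y1 < y2'" "y1' < y2"
  then show "x1 = x1' \<and> x2 = x2' \<and> y1 = y1' \<and> y2 = y2'"
    using overlap[of y1 y2 x1 x2 y1' y2' x1' x2'] by auto
qed (use cell wide high in auto)

lemma reflected: "rect_partition (reflect_quad -` Q) (-a2) (-a1) b1 b2"
proof
  have "inj reflect_quad" by (auto simp: inj_def)
  then show "finite (reflect_quad -` Q)" using fin by (rule finite_vimageI[rotated])
next
  fix x y assume "-a2 \<le> x" "x \<le> -a1" "b1 \<le> y" "y \<le> b2"
  then obtain x1 x2 y1 y2 where *: "(x1, x2, y1, y2) \<in> Q" "x1 \<le> -x" "-x \<le> x2" "y1 \<le> y" "y \<le> y2"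
    using cover[of "-x" y] by auto
  show "\<exists>x1 x2 y1 y2. (x1, x2, y1, y2) \<in> reflect_quad -` Q \<and> x1 \<le> x \<and> x \<le> x2 \<and> y1 \<le> y \<and> y \<le> y2"
    by (rule exI[of _ "-x2"], rule exI[of _ "-x1"], rule exI[of _ y1], rule exI[of _ y2])
       (use * in auto)
next
  fix x1 x2 y1 y2 x1' x2' y1' y2'
  assume "(x1, x2, y1, y2) \<in> reflect_quad -` Q" "(x1', x2', y1', y2') \<in> reflect_quad -` Q" 
    "x1 < x2'" "x1' < x2" "y1 < y2'" "y1' < y2"
  then show "x1 = x1' \<and> x2 = x2' \<and> y1 = y1' \<and> y2 = y2'"
    using overlap[of "-x2" "-x1" y1 y2 "-x2'" "-x1'" y1' y2'] by auto
qed (use cell wide high in force)+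

lemma finite_xcoords: "finite (xcoords Q)"
proof -
  have "xcoords Q \<subseteq> fst ` Q \<union> (fst \<circ> snd) ` Q" unfolding xcoords_def by force
  then show ?thesis using fin by (meson finite_UnI finite_imageI finite_subset)
qed

lemma xcoordsI: "(x1, x2, y1, y2) \<in> Q \<Longrightarrow> x1 \<in> xcoords Q" "(x1, x2, y1, y2) \<in> Q \<Longrightarrow> x2 \<in> xcoords Q"
  unfolding xcoords_def by blast+

lemma no_lineD: "no_line Q x x' \<Longrightarrow> s \<in> xcoords Q \<Longrightarrow> s \<le> x \<or> x' \<le> s"
  unfolding no_line_def by blast

lemma a1_xcoords: "a1 \<in> xcoords Q" and a2_xcoords: "a2 \<in> xcoords Q"
proof -
  obtain x1 x2 y1 y2 where "(x1, x2, y1, y2) \<in> Q" "x1 \<le> a1" using cover[of a1 b1] wide high by auto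
  then show "a1 \<in> xcoords Q" using cell xcoordsI by (metis order_antisym)
  obtain x1 x2 y1 y2 where "(x1, x2, y1, y2) \<in> Q" "x2 \<ge> a2" using cover[of a2 b1] wide high by auto
  then show "a2 \<in> xcoords Q" using cell xcoordsI by (metis order_antisym)
qed

lemma xcoords_bounds: "x \<in> xcoords Q \<Longrightarrow> a1 \<le> x \<and> x \<le> a2"
  unfolding xcoords_def using cell by force

lemma K_region: "K x y \<Longrightarrow> a1 \<le> x \<and> x \<le> a2 \<and> b1 \<le> y \<and> y \<le> b2"
  unfolding frame_def by (clarify, drule cell) linarith

lemma inside_not_K:
  "\<lbrakk>(x1, x2, y1, y2) \<in> Q; x1 < x; x < x2; y1 < y; y < y2\<rbrakk> \<Longrightarrow> \<not> K x y"
proof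
  assume q: "(x1, x2, y1, y2) \<in> Q" "x1 < x" "x < x2" "y1 < y" "y < y2" and "K x y"
  then obtain u1 u2 v1 v2 where *: "(u1, u2, v1, v2) \<in> Q" "u1 \<le> x" "x \<le> u2" "v1 \<le> y" "y \<le> v2"
      "\<not> (u1 < x \<and> x < u2 \<and> v1 < y \<and> y < v2)" unfolding frame_def by blast
  then have "x1 = u1 \<and> x2 = u2 \<and> y1 = v1 \<and> y2 = v2" using q by (intro overlap) auto
  then show False using q * by auto
qed

lemma not_K_inside:
  "\<lbrakk>\<not> K x y; a1 \<le> x; x \<le> a2; b1 \<le> y; y \<le> b2\<rbrakk> \<Longrightarrow>
     \<exists>x1 x2 y1 y2. (x1, x2, y1, y2) \<in> Q \<and> x1 < x \<and> x < x2 \<and> y1 < y \<and> y < y2"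
  using cover[of x y] unfolding frame_def by blast

lemma edge_K:
  assumes "(x1, x2, y1, y2) \<in> Q"
  shows "y1 \<le> y \<Longrightarrow> y \<le> y2 \<Longrightarrow> K x1 y" "y1 \<le> y \<Longrightarrow> y \<le> y2 \<Longrightarrow> K x2 y"
    "x1 \<le> x \<Longrightarrow> x \<le> x2 \<Longrightarrow> K x y1" "x1 \<le> x \<Longrightarrow> x \<le> x2 \<Longrightarrow> K x y2"
  using assms cell[OF assms] unfolding frame_def
  by (metis less_irrefl less_imp_le order_refl)+

lemma boundary_K:
  "b1 \<le> y \<Longrightarrow> y \<le> b2 \<Longrightarrow> K a1 y" "b1 \<le> y \<Longrightarrow> y \<le> b2 \<Longrightarrow> K a2 y"
  "a1 \<le> x \<Longrightarrow> x \<le> a2 \<Longrightarrow> K x b1" "a1 \<le> x \<Longrightarrow> x \<le> a2 \<Longrightarrow> K x b2"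
  using cover[of a1 y] cover[of a2 y] cover[of x b1] cover[of x b2] wide high cell
  unfolding frame_def by (smt (verit))+

text \<open>Between two consecutive vertical grid lines a cell that is met in its interior at height \<open>y\<close>
extends over the whole gap. A horizontal segment across the gap therefore lies in the skeleton as
soon as one of its inner points does.\<close>

lemma gap:
  assumes "K t0 y" "x < t0" "t0 < x'" "no_line Q x x'" "x \<le> t" "t \<le> x'"
  shows "K t y"
proof (rule ccontr)
  assume "\<not> K t y"
  moreover have "a1 \<le> x" "x' \<le> a2" "b1 \<le> y" "y \<le> b2"
    using K_region[OF assms(1)] assms(2,3) no_lineD[OF assms(4) a1_xcoords] no_lineD[OF assms(4) a2_xcoords] by auto
  ultimately obtain x1 x2 y1 y2 where q: "(x1, x2, y1, y2) \<in> Q" "x1 < t" "t < x2" "y1 < y" "y < y2"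
    using not_K_inside[of t y] assms by auto
  then have "x1 \<le> x" "x' \<le> x2" using no_lineD[OF assms(4) xcoordsI(1)[OF q(1)]] no_lineD[OF assms(4) xcoordsI(2)[OF q(1)]] q assms(5,6) by auto
  then show False using inside_not_K[OF q(1), of t0 y] assms q by auto
qed

lemma east_gap: obtains e where "e > 0" "no_line Q x (x + e)"
proof -
  obtain d where d: "d > 0" "\<forall>s\<in>xcoords Q. s \<noteq> x \<longrightarrow> d \<le> dist x s"
    using finite_set_avoid[OF finite_xcoords] by blast
  have "no_line Q x (x + d)"
    using d(2) unfolding no_line_def by (force simp: dist_real_def)
  with d(1) show ?thesis by (rule that)
qed

lemma eastI: 
  assumes "K t y" "x < t" "t < x'" "no_line Q x x'"
  shows "east K x y"
  unfolding east_def by (rule exI[of _ "x' - x"]) (use gap[OF assms] assms(2,3) in auto)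

text \<open>Where the skeleton does not continue to the east, the cell just to the east reaches over the height
\<open>y\<close> on both sides.\<close>

lemma cell_east:
  assumes "\<not> east K x y" "a1 \<le> x" "x < a2" "b1 \<le> y" "y \<le> b2"
  shows "\<exists>x1 x2 y1 y2. (x1, x2, y1, y2) \<in> Q \<and> x1 \<le> x \<and> x < x2 \<and> y1 < y \<and> y < y2"
proof -
  obtain e where e: "e > 0" "no_line Q x (x + e)" using east_gap[of x] by blast
  have nK: "\<not> K (x + e/2) y" 
  proof
    assume "K (x + e/2) y"
    then have "east K x y" by (rule eastI[where x' = "x + e"]) (use e in auto)
    then show False using assms(1) by simp
  qed
  have "x + e \<le> a2" using no_lineD[OF e(2) a2_xcoords] assms by auto
  then obtain x1 x2 y1 y2 where q: "(x1, x2, y1, y2) \<in> Q" "x1 < x + e/2" "x + e/2 < x2" "y1 < y" "y < y2"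
    using not_K_inside[OF nK] assms e by auto
  have "x1 \<le> x" using no_lineD[OF e(2) xcoordsI(1)[OF q(1)]] q(2) e(1) by auto
  then show ?thesis using q e(1) by (intro exI[of _ x1] exI[of _ x2] exI[of _ y1] exI[of _ y2]) auto
qed

text \<open>The cell of the preceding lemma has the point on its left side, and this side is part of the
skeleton. So at an interior point of the skeleton the absence of one direction forces the two
perpendicular ones: there are no dead ends and no L-shaped bends.\<close>

lemma not_east_north_south:
  assumes "\<not> east K x y" "K x y" "a1 \<le> x" "x < a2" "b1 < y" "y < b2"
  shows "north K x y" "south K x y"
proof -
  obtain x1 x2 y1 y2 where q: "(x1, x2, y1, y2) \<in> Q" "x1 \<le> x" "x < x2" "y1 < y" "y < y2"
    using cell_east[OF assms(1,3,4)] assms by auto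
  have "x1 = x" using inside_not_K[OF q(1)] assms q by force
  have k: "K x t" if "y1 \<le> t" "t \<le> y2" for t using edge_K(1)[OF q(1) that] \<open>x1 = x\<close> by simp
  show "north K x y" unfolding north_def by (rule exI[of _ "y2 - y"]) (use k q in auto)
  show "south K x y" unfolding south_def by (rule exI[of _ "y - y1"]) (use k q in auto)
qed

text \<open>The cell just to the north-east of a point with skeleton to the east and to the north has the point
as its lower left corner, since otherwise the skeleton would enter the interior of that cell.\<close>

lemma east_north_corner:
  assumes "east K x y" "north K x y" shows "corner Q x y"
proof -
  interpret s: rect_partition "swap_quad -` Q" b1 b2 a1 a2 by (rule swapped)
  obtain e where e: "e > 0" "no_line Q x (x + e)" using east_gap[of x] by blast
  obtain e' where e': "e' > 0" "no_line (swap_quad -` Q) y (y + e')" using s.east_gap[of y] by blast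
  obtain d where d: "d > 0" "\<And>t. x \<le> t \<Longrightarrow> t \<le> x + d \<Longrightarrow> K t y" using assms(1) unfolding east_def by auto
  obtain d' where d': "d' > 0" "\<And>t. y \<le> t \<Longrightarrow> t \<le> y + d' \<Longrightarrow> K x t" using assms(2) unfolding north_def by auto
  define m where "m = min (min e e') (min d d') / 2"
  have m: "m > 0" "m < e" "m < e'" "m < d" "m < d'" unfolding m_def using e e' d d' by auto
  have "a1 \<le> x + m" "x + m \<le> a2" "b1 \<le> y + m" "y + m \<le> b2"
    using K_region[OF d(2)[of "x+m"]] K_region[OF d'(2)[of "y+m"]] m by auto
  then obtain x1 x2 y1 y2 where q: "(x1, x2, y1, y2) \<in> Q" "x1 \<le> x + m" "x + m \<le> x2" "y1 \<le> y + m" "y + m \<le> y2"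
    using cover by blast
  have q': "(y1, y2, x1, x2) \<in> swap_quad -` Q" using q by simp
  have "x1 \<le> x" "x + e \<le> x2" using no_lineD[OF e(2) xcoordsI(1)[OF q(1)]] no_lineD[OF e(2) xcoordsI(2)[OF q(1)]] q m by auto
  moreover have "y1 \<le> y" "y + e' \<le> y2" using s.no_lineD[OF e'(2) s.xcoordsI(1)[OF q']] s.no_lineD[OF e'(2) s.xcoordsI(2)[OF q']] q m by auto
  moreover have False if "x1 < x"
    using inside_not_K[OF q(1), of x "y + m"] d'(2)[of "y+m"] m calculation that by auto
  moreover have False if "y1 < y"
    using inside_not_K[OF q(1), of "x + m" y] d(2)[of "x+m"] m calculation that by auto
  ultimately have "x1 = x" "y1 = y" by force+
  then show ?thesis unfolding corner_def using q(1) by blast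
qed

lemma next_x:
  assumes "x < a2" obtains x' where "x < x'" "x' \<in> xcoords Q" "no_line Q x x'"
proof -
  let ?A = "{s \<in> xcoords Q. x < s}"
  have "finite ?A" "?A \<noteq> {}" using finite_xcoords assms a2_xcoords by auto
  then have "Min ?A \<in> ?A" "\<forall>s\<in>?A. Min ?A \<le> s" by (rule Min_in, simp)
  then show ?thesis by (intro that[of "Min ?A"]) (force simp: no_line_def)+
qed

lemma east_extend:
  assumes "east K x y" shows "\<exists>x'. x < x' \<and> x' \<in> xcoords Q \<and> (\<forall>t. x \<le> t \<and> t \<le> x' \<longrightarrow> K t y)"
proof -
  obtain d where d: "d > 0" "\<forall>t. x \<le> t \<and> t \<le> x + d \<longrightarrow> K t y" using assms unfolding east_def by auto
  then have "x + d \<le> a2" using K_region[of "x+d" y] by auto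
  then have "x < a2" using d(1) by linarith
  then obtain x' where x': "x < x'" "x' \<in> xcoords Q" "no_line Q x x'" using next_x by blast
  define t where "t = min (x + d) ((x + x')/2)"
  have "x < t" "t < x'" "K t y" unfolding t_def using d x'(1) by (auto simp: min_def field_simps)
  then show ?thesis using gap[OF \<open>K t y\<close> \<open>x < t\<close> \<open>t < x'\<close> x'(3)] x'(1,2) by blast
qed

text \<open>Following the skeleton to the east from one grid line to the next terminates because there are
finitely many of them.\<close>

lemma run_east:
  assumes "east K x y"
  shows "\<exists>t>x. (\<forall>s. x \<le> s \<and> s \<le> t \<longrightarrow> K s y) \<and> \<not> east K t y"
proof -
  let ?A = "{t \<in> xcoords Q. x < t \<and> (\<forall>s. x \<le> s \<and> s \<le> t \<longrightarrow> K s y)}"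
  have ne: "?A \<noteq> {}" using east_extend[OF assms] by blast
  have fn: "finite ?A" by (rule finite_subset[OF _ finite_xcoords]) blast
  have m: "Max ?A \<in> ?A" by (rule Max_in[OF fn ne])
  have m2: "s \<in> ?A \<Longrightarrow> s \<le> Max ?A" for s by (rule Max_ge[OF fn])
  have m1: "Max ?A \<in> xcoords Q" "x < Max ?A" "\<forall>s. x \<le> s \<and> s \<le> Max ?A \<longrightarrow> K s y"
    using m by blast+
  have "\<not> east K (Max ?A) y"
  proof
    assume "east K (Max ?A) y"
    then obtain x' where x': "Max ?A < x'" "x' \<in> xcoords Q" "\<forall>t. Max ?A \<le> t \<and> t \<le> x' \<longrightarrow> K t y"
      using east_extend by blast
    have "K s y" if "x \<le> s" "s \<le> x'" for s
      using m1(3) x'(3) that by (meson le_cases)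
    moreover have "x < x'" using m1(2) x'(1) by linarith
    ultimately have "x' \<in> ?A" using x'(2) by blast
    then show False using m2[of x'] x'(1) by linarith
  qed
  then show ?thesis using m1 by blast
qed


lemma not_north_east_west:
  "\<lbrakk>\<not> north K x y; K x y; b1 \<le> y; y < b2; a1 < x; x < a2\<rbrakk> \<Longrightarrow> east K x y \<and> west K x y"
  using rect_partition.not_east_north_south[OF swapped, of y x] by (simp add: frame_sw)

lemma not_west_north_south:
  "\<lbrakk>\<not> west K x y; K x y; a1 < x; x \<le> a2; b1 < y; y < b2\<rbrakk> \<Longrightarrow> north K x y \<and> south K x y"
  using rect_partition.not_east_north_south[OF reflected, of "-x" y] by (simp add: frame_rf)

lemma not_south_east_west:
  "\<lbrakk>\<not> south K x y; K x y; b1 < y; y \<le> b2; a1 < x; x < a2\<rbrakk> \<Longrightarrow> east K x y \<and> west K x y"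
  using rect_partition.not_west_north_south[OF swapped, of y x] by (simp add: frame_sw)

lemma west_north_corner: "west K x y \<Longrightarrow> north K x y \<Longrightarrow> corner Q x y"
  using rect_partition.east_north_corner[OF reflected, of "-x" y] by (simp add: frame_rf corner_rf)

lemma east_south_corner: "east K x y \<Longrightarrow> south K x y \<Longrightarrow> corner Q x y"
  using rect_partition.west_north_corner[OF swapped, of y x] by (simp add: frame_sw corner_sw)

lemma west_south_corner: "west K x y \<Longrightarrow> south K x y \<Longrightarrow> corner Q x y"
  using rect_partition.east_south_corner[OF reflected, of "-x" y] by (simp add: frame_rf corner_rf)

lemma perpendicular_corner: "east K x y \<or> west K x y \<Longrightarrow> north K x y \<or> south K x y \<Longrightarrow> corner Q x y"
  using east_north_corner west_north_corner east_south_corner west_south_corner by blast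


lemma run_west:
  assumes "west K x y"
  shows "\<exists>t<x. (\<forall>s. t \<le> s \<and> s \<le> x \<longrightarrow> K s y) \<and> \<not> west K t y"
proof -
  obtain t where t: "t > - x" "\<forall>s. - x \<le> s \<and> s \<le> t \<longrightarrow> K (-s) y" "\<not> west K (-t) y"
    using rect_partition.run_east[OF reflected, of "-x" y] assms by (auto simp: frame_rf)
  have "K s y" if "- t \<le> s" "s \<le> x" for s using t(2)[rule_format, of "-s"] that by simp
  then show ?thesis using t(1,3) by (intro exI[of _ "-t"]) auto
qed

lemma edge_dirs:
  "x < x' \<Longrightarrow> (\<forall>t. x \<le> t \<and> t \<le> x' \<longrightarrow> K t y) \<Longrightarrow> x \<le> t \<Longrightarrow> t < x' \<Longrightarrow> east K t y"
  "x < x' \<Longrightarrow> (\<forall>t. x \<le> t \<and> t \<le> x' \<longrightarrow> K t y) \<Longrightarrow> x < t \<Longrightarrow> t \<le> x' \<Longrightarrow> west K t y"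
  unfolding east_def west_def
  by (rule exI[of _ "x' - t"], auto, rule exI[of _ "t - x"], auto)

lemma corner_dirs: 
  assumes "corner Q x y" shows "east K x y \<or> west K x y" "north K x y \<or> south K x y"
proof -
  obtain x1 x2 y1 y2 where q: "(x1, x2, y1, y2) \<in> Q" and *: "x = x1 \<or> x = x2" "y = y1 \<or> y = y2"
    using assms unfolding corner_def by blast
  have lt: "x1 < x2" "y1 < y2" using cell[OF q] by auto
  have "\<forall>t. x1 \<le> t \<and> t \<le> x2 \<longrightarrow> K t y" "\<forall>t. y1 \<le> t \<and> t \<le> y2 \<longrightarrow> K x t"
    using edge_K[OF q] * by auto
  then show "east K x y \<or> west K x y" "north K x y \<or> south K x y"
    using edge_dirs[OF lt(1), of y x] rect_partition.edge_dirs[OF swapped lt(2), of x y] lt *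
    by (auto simp: frame_sw)
qed

lemma dir_region:
  "east K x y \<Longrightarrow> K x y \<and> x < a2" "west K x y \<Longrightarrow> K x y \<and> a1 < x"
  "north K x y \<Longrightarrow> K x y \<and> y < b2" "south K x y \<Longrightarrow> K x y \<and> b1 < y"
proof -
  assume "east K x y" 
  then obtain e where "e > 0" "\<forall>t. x \<le> t \<and> t \<le> x + e \<longrightarrow> K t y" unfolding east_def by auto
  then show "K x y \<and> x < a2" using K_region[of "x+e" y] by auto
next
  assume "west K x y" 
  then obtain e where "e > 0" "\<forall>t. x - e \<le> t \<and> t \<le> x \<longrightarrow> K t y" unfolding west_def by auto
  then show "K x y \<and> a1 < x" using K_region[of "x-e" y] by auto
next
  assume "north K x y" 
  then obtain e where "e > 0" "\<forall>t. y \<le> t \<and> t \<le> y + e \<longrightarrow> K x t" unfolding north_def by auto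
  then show "K x y \<and> y < b2" using K_region[of x "y+e"] by auto
next
  assume "south K x y" 
  then obtain e where "e > 0" "\<forall>t. y - e \<le> t \<and> t \<le> y \<longrightarrow> K x t" unfolding south_def by auto
  then show "K x y \<and> b1 < y" using K_region[of x "y-e"] by auto
qed

lemma boundary_dirs:
  "b1 \<le> y \<Longrightarrow> y < b2 \<Longrightarrow> north K a1 y \<and> north K a2 y" "b1 < y \<Longrightarrow> y \<le> b2 \<Longrightarrow> south K a1 y \<and> south K a2 y"
  "a1 \<le> x \<Longrightarrow> x < a2 \<Longrightarrow> east K x b1 \<and> east K x b2" "a1 < x \<Longrightarrow> x \<le> a2 \<Longrightarrow> west K x b1 \<and> west K x b2"
  using edge_dirs[OF wide, of b1 x] edge_dirs[OF wide, of b2 x]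
    rect_partition.edge_dirs[OF swapped high, of a1 y] rect_partition.edge_dirs[OF swapped high, of a2 y] boundary_K
  by (auto simp: frame_sw)


text \<open>In the interior of the rectangle this holds because a missing direction brings both perpendicular
ones; on the rim the perpendicular direction runs along the rim.\<close>

lemma run_end_corner:
  assumes "east K x y \<noteq> west K x y" shows "corner Q x y"
proof -
  have k: "K x y" using assms dir_region by blast
  have r: "a1 \<le> x" "x \<le> a2" "b1 \<le> y" "y \<le> b2" using K_region[OF k] by auto
  have "north K x y \<or> south K x y"
  proof (cases "x = a1 \<or> x = a2 \<or> y = b1 \<or> y = b2")
    case True
    then show ?thesis using r assms dir_region boundary_dirs high
      by (metis order_le_less)
  next
    case False
    then have "a1 < x" "x < a2" "b1 < y" "y < b2" using r by auto
    then show ?thesis using k assms not_east_north_south[of x y] not_west_north_south[of x y] by auto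
  qed
  then show ?thesis using assms perpendicular_corner by blast
qed

lemma three_dirs:
  assumes "corner Q x y" "a1 < x" "x < a2" "b1 < y" "y < b2"
  shows "\<not> east K x y \<Longrightarrow> west K x y \<and> north K x y \<and> south K x y"
    "\<not> west K x y \<Longrightarrow> east K x y \<and> north K x y \<and> south K x y"
    "\<not> north K x y \<Longrightarrow> south K x y \<and> east K x y \<and> west K x y"
    "\<not> south K x y \<Longrightarrow> north K x y \<and> east K x y \<and> west K x y"
  using corner_dirs[OF assms(1)] not_east_north_south[of x y] not_west_north_south[of x y]
    not_north_east_west[of x y] not_south_east_west[of x y] dir_region assms(2-) by (metis less_imp_le)+

end

section \<open>Maximal segments and the number of vertices\<close>

text \<open>The maximal horizontal segments of the skeleton, given by height, left end and right end. They are
the horizontal l-edges together with the two horizontal sides of the whole rectangle.\<close>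

definition hruns :: "quad set \<Rightarrow> (real \<times> real \<times> real) set"
  where "hruns Q = {(y, s, t). s < t \<and> (\<forall>x. s \<le> x \<and> x \<le> t \<longrightarrow> frame Q x y) \<and>
     \<not> west (frame Q) s y \<and> \<not> east (frame Q) t y}"

text \<open>The maximal vertical segments, given by abscissa, lower end and upper end.\<close>

definition vruns :: "quad set \<Rightarrow> (real \<times> real \<times> real) set"
  where "vruns Q = hruns (swap_quad -` Q)"

definition verts :: "quad set \<Rightarrow> (real \<times> real) set"
  where "verts Q = {(x, y). corner Q x y}"

text \<open>Points with all four directions are interior, because the skeleton does not leave the rectangle.\<close>

definition crosses :: "quad set \<Rightarrow> (real \<times> real) set"
  where "crosses Q = {(x, y). east (frame Q) x y \<and> west (frame Q) x y \<and> north (frame Q) x y \<and> south (frame Q) x y}"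

lemma sw_sw [simp]: "swap_quad -` swap_quad -` Q = Q" by (auto; metis swap_quad.simps)

lemma hruns_sw [simp]: "hruns (swap_quad -` Q) = vruns Q" and vruns_sw [simp]: "vruns (swap_quad -` Q) = hruns Q"
  by (simp_all add: vruns_def)

context rect_partition
begin

definition ihruns :: "(real \<times> real \<times> real) set"
  where "ihruns = {(y, s, t) \<in> hruns Q. y \<noteq> b1 \<and> y \<noteq> b2}"
definition ivruns :: "(real \<times> real \<times> real) set"
  where "ivruns = {(x, s, t) \<in> vruns Q. x \<noteq> a1 \<and> x \<noteq> a2}"

lemma run_through:
  assumes "east K x y \<or> west K x y"
  shows "\<exists>s t. (y, s, t) \<in> hruns Q \<and> s \<le> x \<and> x \<le> t"
proof -
  have k: "K x y" using assms dir_region by blast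
  have "\<exists>t. x \<le> t \<and> (\<forall>z. x \<le> z \<and> z \<le> t \<longrightarrow> K z y) \<and> \<not> east K t y \<and> (east K x y \<longrightarrow> x < t)"
  proof (cases "east K x y")
    case True 
    then obtain t where "t > x" "\<forall>z. x \<le> z \<and> z \<le> t \<longrightarrow> K z y" "\<not> east K t y" using run_east[OF True] by (elim exE conjE)
    then show ?thesis by (intro exI[of _ t]) simp
  next
    case False then show ?thesis using k by (intro exI[of _ x]) (metis antisym order_refl)
  qed
  then obtain t where t: "x \<le> t" "\<forall>z. x \<le> z \<and> z \<le> t \<longrightarrow> K z y" "\<not> east K t y" "east K x y \<longrightarrow> x < t" by blast
  have "\<exists>s. s \<le> x \<and> (\<forall>z. s \<le> z \<and> z \<le> x \<longrightarrow> K z y) \<and> \<not> west K s y \<and> (west K x y \<longrightarrow> s < x)"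
  proof (cases "west K x y")
    case True 
    then obtain s where "s < x" "\<forall>z. s \<le> z \<and> z \<le> x \<longrightarrow> K z y" "\<not> west K s y" using run_west[OF True] by (elim exE conjE)
    then show ?thesis by (intro exI[of _ s]) simp
  next
    case False then show ?thesis using k by (intro exI[of _ x]) (metis antisym order_refl)
  qed
  then obtain s where s: "s \<le> x" "\<forall>z. s \<le> z \<and> z \<le> x \<longrightarrow> K z y" "\<not> west K s y" "west K x y \<longrightarrow> s < x" by blast
  have "\<forall>z. s \<le> z \<and> z \<le> t \<longrightarrow> K z y" using s(2) t(2) by (meson le_cases)
  moreover have "s < t" using s t assms by linarith
  ultimately show ?thesis using s t unfolding hruns_def by blast
qed

lemma hrunsD:
  assumes "(y, s, t) \<in> hruns Q"
  shows "s < t" "\<And>x. s \<le> x \<Longrightarrow> x \<le> t \<Longrightarrow> K x y" "\<not> west K s y" "\<not> east K t y"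
    "\<And>x. s \<le> x \<Longrightarrow> x < t \<Longrightarrow> east K x y" "\<And>x. s < x \<Longrightarrow> x \<le> t \<Longrightarrow> west K x y"
  using assms edge_dirs[of s t y] unfolding hruns_def by auto

lemma run_unique:
  assumes "(y, s, t) \<in> hruns Q" "(y, s', t') \<in> hruns Q" "s \<le> x" "x \<le> t" "s' \<le> x" "x \<le> t'"
  shows "s = s' \<and> t = t'"
proof -
  have "\<not> s < s'" using hrunsD(6)[OF assms(1), of s'] hrunsD(3)[OF assms(2)] assms(3-6) by linarith
  moreover have "\<not> s' < s" using hrunsD(6)[OF assms(2), of s] hrunsD(3)[OF assms(1)] assms(3-6) by linarith
  moreover have "\<not> t < t'" using hrunsD(5)[OF assms(2), of t] hrunsD(4)[OF assms(1)] assms(3-6) by linarith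
  moreover have "\<not> t' < t" using hrunsD(5)[OF assms(1), of t'] hrunsD(4)[OF assms(2)] assms(3-6) by linarith
  ultimately show ?thesis by linarith
qed

lemma run_ends:
  assumes "(y, s, t) \<in> hruns Q" shows "corner Q s y" "corner Q t y"
  using run_end_corner[of s y] run_end_corner[of t y] hrunsD(1,3,4)[OF assms] hrunsD(5,6)[OF assms] by force+

lemma corner_x: "corner Q x y \<Longrightarrow> x \<in> xcoords Q" and corner_y: "corner Q x y \<Longrightarrow> y \<in> xcoords (swap_quad -` Q)"
  unfolding corner_def xcoords_def by fastforce+

lemma finite_verts: "finite (verts Q)"
proof (rule finite_subset)
  show "verts Q \<subseteq> xcoords Q \<times> xcoords (swap_quad -` Q)" unfolding verts_def using corner_x corner_y by auto
  show "finite (xcoords Q \<times> xcoords (swap_quad -` Q))" using finite_xcoords rect_partition.finite_xcoords[OF swapped] by simp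
qed

lemma finite_hruns: "finite (hruns Q)"
proof (rule finite_subset)
  show "hruns Q \<subseteq> xcoords (swap_quad -` Q) \<times> xcoords Q \<times> xcoords Q" using run_ends corner_x corner_y by (auto; blast)
  show "finite (xcoords (swap_quad -` Q) \<times> xcoords Q \<times> xcoords Q)" using finite_xcoords rect_partition.finite_xcoords[OF swapped] by simp
qed

lemma boundary_runs: "(b1, s, t) \<in> hruns Q \<longleftrightarrow> s = a1 \<and> t = a2" "(b2, s, t) \<in> hruns Q \<longleftrightarrow> s = a1 \<and> t = a2"
proof -
  have *: "(b, a1, a2) \<in> hruns Q" if "b = b1 \<or> b = b2" for b
    using that wide boundary_K dir_region(1)[of a2 b] dir_region(2)[of a1 b] unfolding hruns_def by auto
  have "s = a1 \<and> t = a2" if "b = b1 \<or> b = b2" "(b, s, t) \<in> hruns Q" for b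
    using run_unique[OF that(2) *[OF that(1)], of s] hrunsD(1,2)[OF that(2)] K_region[of s b] by force
  with * show "(b1, s, t) \<in> hruns Q \<longleftrightarrow> s = a1 \<and> t = a2" "(b2, s, t) \<in> hruns Q \<longleftrightarrow> s = a1 \<and> t = a2"
    by blast+
qed

lemma card_hruns: "card (hruns Q) = card ihruns + 2"
proof -
  have "hruns Q = ihruns \<union> {(b1, a1, a2), (b2, a1, a2)}"
    unfolding ihruns_def using boundary_runs by auto
  moreover have "ihruns \<inter> {(b1, a1, a2), (b2, a1, a2)} = {}" unfolding ihruns_def by auto
  moreover have "finite ihruns" unfolding ihruns_def by (rule finite_subset[OF _ finite_hruns]) auto
  ultimately show ?thesis using high by (simp add: card_Un_disjoint)
qed

lemma run_height: "(y, s, t) \<in> hruns Q \<Longrightarrow> b1 \<le> y \<and> y \<le> b2"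
  using hrunsD(1,2)[of y s t] K_region[of s y] by auto

text \<open>An interior horizontal run is determined by its left end, and the left ends are the points with
skeleton to the east but not to the west.\<close>

lemma west_ends:
  "card {(x, y). b1 < y \<and> y < b2 \<and> east K x y \<and> \<not> west K x y} = card ihruns"
  "finite {(x, y). b1 < y \<and> y < b2 \<and> east K x y \<and> \<not> west K x y}"
proof -
  let ?W = "{(x, y). b1 < y \<and> y < b2 \<and> east K x y \<and> \<not> west K x y}"
  have bij: "bij_betw (\<lambda>(y, s, t). (s, y)) ihruns ?W"
  proof (rule bij_betw_imageI)
    show "inj_on (\<lambda>(y, s, t). (s, y)) ihruns"
    proof (rule inj_onI)
      fix r r' assume *: "r \<in> ihruns" "r' \<in> ihruns" "(case r of (y, s, t) \<Rightarrow> (s, y)) = (case r' of (y, s, t) \<Rightarrow> (s, y))"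
      then obtain y s t t' where r: "r = (y, s, t)" "r' = (y, s, t')" by (cases r; cases r') auto
      then have h: "(y, s, t) \<in> hruns Q" "(y, s, t') \<in> hruns Q" using * unfolding ihruns_def by auto
      then show "r = r'" using run_unique[OF h, of s] hrunsD(1)[OF h(1)] hrunsD(1)[OF h(2)] r by simp
    qed
    show "(\<lambda>(y, s, t). (s, y)) ` ihruns = ?W"
    proof (intro equalityI subsetI)
      fix p assume "p \<in> (\<lambda>(y, s, t). (s, y)) ` ihruns"
      then obtain y s t where "p = (s, y)" "(y, s, t) \<in> hruns Q" "y \<noteq> b1" "y \<noteq> b2" unfolding ihruns_def by auto
      then show "p \<in> ?W" using hrunsD[of y s t] run_height[of y s t] by auto
    next
      fix p assume "p \<in> ?W"
      then obtain x y where p: "p = (x, y)" "b1 < y" "y < b2" "east K x y" "\<not> west K x y" by auto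
      then obtain s t where r: "(y, s, t) \<in> hruns Q" "s \<le> x" "x \<le> t" using run_through by blast
      then have "s = x" using hrunsD(6)[OF r(1), of x] p by force
      then show "p \<in> (\<lambda>(y, s, t). (s, y)) ` ihruns" using r p unfolding ihruns_def
        by (intro image_eqI[of _ _ "(y, s, t)"]) auto
    qed
  qed
  have "finite ihruns" unfolding ihruns_def by (rule finite_subset[OF _ finite_hruns]) auto
  then show "card ?W = card ihruns" "finite ?W"
    using bij_betw_same_card[OF bij] bij_betw_finite[OF bij] by simp_all
qed

lemma hruns_rf: "hruns (reflect_quad -` Q) = (\<lambda>(y, s, t). (y, -t, -s)) ` hruns Q"
proof -
  have *: "(y, s, t) \<in> hruns (reflect_quad -` Q) \<longleftrightarrow> (y, -t, -s) \<in> hruns Q" for y s t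
  proof -
    have "(\<forall>x. s \<le> x \<and> x \<le> t \<longrightarrow> K (-x) y) \<longleftrightarrow> (\<forall>x. -t \<le> x \<and> x \<le> -s \<longrightarrow> K x y)"
      by (metis minus_minus neg_le_iff_le)
    then show ?thesis unfolding hruns_def by (auto simp: frame_rf)
  qed
  show ?thesis
  proof (intro equalityI subsetI)
    fix r assume "r \<in> hruns (reflect_quad -` Q)"
    then show "r \<in> (\<lambda>(y, s, t). (y, -t, -s)) ` hruns Q"
      by (cases r) (auto simp: * intro!: image_eqI[of _ _ "(fst r, - snd (snd r), - fst (snd r))"])
  qed (auto simp: *)
qed

lemma east_ends:
  "card {(x, y). b1 < y \<and> y < b2 \<and> west K x y \<and> \<not> east K x y} = card ihruns"
  "finite {(x, y). b1 < y \<and> y < b2 \<and> west K x y \<and> \<not> east K x y}"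
proof -
  interpret r: rect_partition "reflect_quad -` Q" "-a2" "-a1" b1 b2 by (rule reflected)
  let ?f = "\<lambda>(x::real, y::real). (-x, y)"
  let ?W = "{(x, y). b1 < y \<and> y < b2 \<and> west K x y \<and> \<not> east K x y}"
  have eq: "{(x, y). b1 < y \<and> y < b2 \<and> east r.K x y \<and> \<not> west r.K x y} = ?f ` ?W" (is "?L = _")
  proof (intro equalityI subsetI)
    fix p assume "p \<in> ?L"
    then show "p \<in> ?f ` ?W" 
      by (cases p) (auto simp: frame_rf intro!: image_eqI[of _ _ "(- fst p, snd p)"])
  qed (auto simp: frame_rf)
  have inj: "inj_on ?f A" for A by (auto simp: inj_on_def)
  have "r.ihruns = (\<lambda>(y, s, t). (y, -t, -s)) ` ihruns"
    unfolding r.ihruns_def hruns_rf ihruns_def by (force simp: image_iff)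
  moreover have "inj_on (\<lambda>(y::real, s::real, t::real). (y, -t, -s)) ihruns" by (auto simp: inj_on_def)
  ultimately have "card r.ihruns = card ihruns" by (simp add: card_image)
  then show "card ?W = card ihruns" using r.west_ends(1) unfolding eq card_image[OF inj] by simp
  show "finite ?W" using r.west_ends(2) unfolding eq by (rule finite_imageD[OF _ inj])
qed

lemma vertical_ends:
  "card {(x, y). a1 < x \<and> x < a2 \<and> north K x y \<and> \<not> south K x y} = card ivruns"
  "card {(x, y). a1 < x \<and> x < a2 \<and> south K x y \<and> \<not> north K x y} = card ivruns"
  "finite {(x, y). a1 < x \<and> x < a2 \<and> north K x y \<and> \<not> south K x y}"
  "finite {(x, y). a1 < x \<and> x < a2 \<and> south K x y \<and> \<not> north K x y}"
proof -
  interpret r: rect_partition "swap_quad -` Q" b1 b2 a1 a2 by (rule swapped)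
  have iv: "r.ihruns = ivruns" unfolding r.ihruns_def ivruns_def by simp
  have eq: "{(x, y). a1 < y \<and> y < a2 \<and> east r.K x y \<and> \<not> west r.K x y} = 
      prod.swap ` {(x, y). a1 < x \<and> x < a2 \<and> north K x y \<and> \<not> south K x y}"
    "{(x, y). a1 < y \<and> y < a2 \<and> west r.K x y \<and> \<not> east r.K x y} = 
      prod.swap ` {(x, y). a1 < x \<and> x < a2 \<and> south K x y \<and> \<not> north K x y}"
    by (auto simp: frame_sw)
  have inj: "inj_on prod.swap A" for A :: "(real \<times> real) set" by (auto simp: inj_on_def)
  note * = r.west_ends r.east_ends
  show "card {(x, y). a1 < x \<and> x < a2 \<and> north K x y \<and> \<not> south K x y} = card ivruns"
    "card {(x, y). a1 < x \<and> x < a2 \<and> south K x y \<and> \<not> north K x y} = card ivruns"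
    using *(1,3) unfolding eq card_image[OF inj] iv by auto
  show "finite {(x, y). a1 < x \<and> x < a2 \<and> north K x y \<and> \<not> south K x y}"
    "finite {(x, y). a1 < x \<and> x < a2 \<and> south K x y \<and> \<not> north K x y}"
    using *(2,4) unfolding eq by (auto dest: finite_imageD[OF _ inj])
qed

lemma crosses_interior: "(x, y) \<in> crosses Q \<Longrightarrow> a1 < x \<and> x < a2 \<and> b1 < y \<and> y < b2"
  unfolding crosses_def using dir_region by blast

lemma crosses_verts: "crosses Q \<subseteq> verts Q"
  unfolding crosses_def verts_def using perpendicular_corner by blast

text \<open>Each vertex that is neither a crossing nor one of the four corners of the rectangle is the end of
exactly one interior run: of its four directions exactly one is missing, so the run in the missing
direction ends there and the perpendicular run, if it is interior, passes through. Counting the two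
ends of each interior run gives the formula.\<close>

lemma card_verts: "card (verts Q) = card (crosses Q) + 2 * card ihruns + 2 * card ivruns + 4"
proof -
  let ?W = "{(x, y). b1 < y \<and> y < b2 \<and> east K x y \<and> \<not> west K x y}"
  let ?E = "{(x, y). b1 < y \<and> y < b2 \<and> west K x y \<and> \<not> east K x y}"
  let ?S = "{(x, y). a1 < x \<and> x < a2 \<and> north K x y \<and> \<not> south K x y}"
  let ?N = "{(x, y). a1 < x \<and> x < a2 \<and> south K x y \<and> \<not> north K x y}"
  let ?C = "{(a1, b1), (a1, b2), (a2, b1), (a2, b2)}"
  have ends: "corner Q x y" if "north K x y \<noteq> south K x y" for x y
    using rect_partition.run_end_corner[OF swapped, of y x] that by (simp add: frame_sw corner_sw)
  have eq: "verts Q = crosses Q \<union> (?C \<union> (?W \<union> (?E \<union> (?S \<union> ?N))))"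
  proof (intro equalityI subsetI)
    fix p assume "p \<in> verts Q"
    then obtain x y where p: "p = (x, y)" and c: "corner Q x y" unfolding verts_def by auto
    note d = corner_dirs[OF c]
    have "K x y" using d(1) dir_region(1,2) by blast
    then have r: "a1 \<le> x" "x \<le> a2" "b1 \<le> y" "y \<le> b2" using K_region[of x y] by simp_all
    have rr: "(a1 < x \<and> x < a2) \<or> (x = a1 \<or> x = a2)" "(b1 < y \<and> y < b2) \<or> (y = b1 \<or> y = b2)"
      using r by linarith+
    have pc: "x = a1 \<or> x = a2 \<Longrightarrow> y = b1 \<or> y = b2 \<Longrightarrow> p \<in> ?C" using p by blast
    consider "a1 < x" "x < a2" "b1 < y" "y < b2" | "x = a1 \<or> x = a2" "b1 < y" "y < b2"
      | "y = b1 \<or> y = b2" "a1 < x" "x < a2" | "p \<in> ?C"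
      using rr pc by blast
    then show "p \<in> crosses Q \<union> (?C \<union> (?W \<union> (?E \<union> (?S \<union> ?N))))"
    proof cases
      case 1
      show ?thesis
      proof (cases "p \<in> crosses Q")
        case False
        then have "(east K x y \<and> \<not> west K x y) \<or> (west K x y \<and> \<not> east K x y) \<or>
          (north K x y \<and> \<not> south K x y) \<or> (south K x y \<and> \<not> north K x y)"
          using three_dirs[OF c 1] unfolding crosses_def p by blast
        then show ?thesis using 1 p by blast
      qed blast
    next
      case 2
      then have "\<not> west K x y \<or> \<not> east K x y" using dir_region(1,2)[of x y] by force
      then have "p \<in> ?W \<union> ?E" using d(1) 2 p by blast
      then show ?thesis by blast
    next
      case 3
      then have "\<not> south K x y \<or> \<not> north K x y" using dir_region(3,4)[of x y] by force
      then have "p \<in> ?S \<union> ?N" using d(2) 3 p by blast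
      then show ?thesis by blast
    qed blast
  next
    fix p assume "p \<in> crosses Q \<union> (?C \<union> (?W \<union> (?E \<union> (?S \<union> ?N))))"
    moreover have "corner Q a1 b1" "corner Q a1 b2" "corner Q a2 b1" "corner Q a2 b2"
      using run_ends boundary_runs by blast+
    moreover have "?W \<union> (?E \<union> (?S \<union> ?N)) \<subseteq> verts Q" using run_end_corner ends unfolding verts_def by blast
    ultimately show "p \<in> verts Q" using crosses_verts unfolding verts_def by blast
  qed
  have fn: "finite ?W" "finite ?E" "finite ?S" "finite ?N" "finite ?C" "finite (crosses Q)"
    using west_ends east_ends vertical_ends finite_subset[OF crosses_verts finite_verts] by auto
  have WE: "east K x y \<and> west K x y" if "a1 < x" "x < a2" "b1 < y" "y < b2" "\<not> south K x y \<or> \<not> north K x y"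
      "south K x y \<or> north K x y" for x y
    using that not_north_east_west[of x y] not_south_east_west[of x y] dir_region by (metis less_imp_le)
  have gen: "card (A \<union> (B \<union> (C \<union> (D \<union> (E \<union> F))))) = card A + card B + card C + card D + card E + card F"
    if "finite A" "finite B" "finite C" "finite D" "finite E" "finite F" "E \<inter> F = {}" "D \<inter> (E \<union> F) = {}"
      "C \<inter> (D \<union> (E \<union> F)) = {}" "B \<inter> (C \<union> (D \<union> (E \<union> F))) = {}"
      "A \<inter> (B \<union> (C \<union> (D \<union> (E \<union> F)))) = {}" for A B C D E F :: "(real \<times> real) set"
    using that by (simp add: card_Un_disjoint)
  have "?S \<inter> ?N = {}" by auto
  moreover have "?E \<inter> (?S \<union> ?N) = {}" using WE by blast
  moreover have "?W \<inter> (?E \<union> (?S \<union> ?N)) = {}" using WE by blast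
  moreover have "?C \<inter> (?W \<union> (?E \<union> (?S \<union> ?N))) = {}" by auto
  moreover have "crosses Q \<inter> (?C \<union> (?W \<union> (?E \<union> (?S \<union> ?N)))) = {}"
    using crosses_interior unfolding crosses_def by auto
  ultimately have "card (verts Q) = card (crosses Q) + card ?C + card ?W + card ?E + card ?S + card ?N"
    unfolding eq by (intro gen fn)
  moreover have "card ?C = 4" using wide high by simp
  ultimately show ?thesis
    using west_ends(1) east_ends(1) vertical_ends(1,2) by linarith
qed

end

section \<open>Dimension count for systems of linear equations\<close>

text \<open>A dimension statement that includes finite generation, which is needed because the ambient function
spaces are infinite-dimensional.\<close>

definition hasdim :: "'a::real_vector set \<Rightarrow> nat \<Rightarrow> bool"
  where "hasdim W d \<longleftrightarrow> (\<exists>B. finite B \<and> independent B \<and> card B = d \<and> span B = W)"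

lemma hasdim_dim: "hasdim W d \<Longrightarrow> dim W = d"
  unfolding hasdim_def using dim_span_eq_card_independent by blast

lemma hasdim_subspace: "hasdim W d \<Longrightarrow> subspace W"
  unfolding hasdim_def using subspace_span by blast

lemma hasdim_extend:
  assumes "hasdim W d" "subspace W'" "W \<subseteq> W'" "v \<in> W'" "v \<notin> W" "\<And>w. w \<in> W' \<Longrightarrow> \<exists>a. w - a *\<^sub>R v \<in> W"
  shows "hasdim W' (Suc d)"
proof -
  obtain B where B: "finite B" "independent B" "card B = d" "span B = W" using assms(1) unfolding hasdim_def by blast
  have "v \<notin> B" using B(4) assms(5) span_base by blast
  moreover have "independent (insert v B)" using B(2,4) assms(5) by (simp add: independent_insert)
  moreover have "span (insert v B) = W'"
  proof
    show "span (insert v B) \<subseteq> W'"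
      using assms(2-4) B(4) span_superset by (intro span_minimal) blast+
    show "W' \<subseteq> span (insert v B)" using assms(6) B(4) unfolding span_insert by blast
  qed
  ultimately show ?thesis unfolding hasdim_def using B by (intro exI[of _ "insert v B"]) simp
qed

lemma hasdim_sub:
  assumes "hasdim W' d" "subspace W" "W \<subseteq> W'" shows "\<exists>e. hasdim W e"
proof -
  obtain B where B: "finite B" "span B = W'" using assms(1) unfolding hasdim_def by blast
  obtain C where C: "C \<subseteq> W" "independent C" "W \<subseteq> span C" using maximal_independent_subset[of W] by blast
  have "finite C" using independent_span_bound[OF B(1) C(2)] C(1) assms(3) B(2) by blast
  moreover have "span C = W" using C assms(2) by (simp add: span_minimal subset_antisym)
  ultimately show ?thesis unfolding hasdim_def using C(2) by blast
qed

lemma hasdim_drop: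
  assumes "hasdim W' d" "subspace W" "W \<subseteq> W'" "v \<in> W'" "v \<notin> W" "\<And>w. w \<in> W' \<Longrightarrow> \<exists>a. w - a *\<^sub>R v \<in> W"
  shows "\<exists>e. d = Suc e \<and> hasdim W e"
proof -
  obtain e where e: "hasdim W e" using hasdim_sub[OF assms(1-3)] by blast
  have "hasdim W' (Suc e)" by (rule hasdim_extend[OF e hasdim_subspace[OF assms(1)] assms(3-6)])
  then show ?thesis using e hasdim_dim assms(1) by blast
qed

lemma hasdim_image:
  assumes "hasdim W d" "linear f" "inj_on f W" shows "hasdim (f ` W) d"
proof -
  obtain B where B: "finite B" "independent B" "card B = d" "span B = W" using assms(1) unfolding hasdim_def by blast
  have "independent (f ` B)" using linear_independent_injective_image[OF assms(2) B(2)] assms(3) B(4) by simp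
  moreover have "span (f ` B) = f ` W" using linear_span_image[OF assms(2)] B(4) by metis
  moreover have "card (f ` B) = d"
    using B(3,4) assms(3) by (metis card_image inj_on_subset span_superset)
  ultimately show ?thesis unfolding hasdim_def using B(1) by blast
qed

lemma hasdim_supported:
  assumes "finite I" shows "hasdim {c :: 'i \<Rightarrow> real. \<forall>v. v \<notin> I \<longrightarrow> c v = 0} (card I)"
  using assms
proof (induction I rule: finite_induct)
  case empty
  have "{c :: 'i \<Rightarrow> real. \<forall>v. v \<notin> {} \<longrightarrow> c v = 0} = {0}" by (auto simp: fun_eq_iff)
  then show ?case unfolding hasdim_def by (intro exI[of _ "{}"]) (simp add: independent_empty)
next
  case (insert i I)
  let ?e = "\<lambda>v. if v = i then 1 else 0 :: real"
  have "hasdim {c :: 'i \<Rightarrow> real. \<forall>v. v \<notin> insert i I \<longrightarrow> c v = 0} (Suc (card I))"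
  proof (rule hasdim_extend[OF insert(3), where v = ?e])
    show "subspace {c :: 'i \<Rightarrow> real. \<forall>v. v \<notin> insert i I \<longrightarrow> c v = 0}"
      by (auto simp: subspace_def scaleR_fun_def)
    fix w :: "'i \<Rightarrow> real" assume "w \<in> {c. \<forall>v. v \<notin> insert i I \<longrightarrow> c v = 0}"
    then show "\<exists>a. w - a *\<^sub>R ?e \<in> {c. \<forall>v. v \<notin> I \<longrightarrow> c v = 0}"
      by (intro exI[of _ "w i"]) (auto simp: scaleR_fun_def)
  qed (use insert in auto)
  then show ?case using insert by simp
qed

text \<open>The solutions, supported on \<open>I\<close>, of the homogeneous linear system with the rows \<open>A j\<close> for \<open>j \<in> J\<close>,
and the linear relations between these rows.\<close>

definition Ker :: "'i set \<Rightarrow> 'j set \<Rightarrow> ('j \<Rightarrow> 'i \<Rightarrow> real) \<Rightarrow> ('i \<Rightarrow> real) set"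
  where "Ker I J A = {c. (\<forall>v. v \<notin> I \<longrightarrow> c v = 0) \<and> (\<forall>j\<in>J. (\<Sum>v\<in>I. A j v * c v) = 0)}"

definition Rel :: "'i set \<Rightarrow> 'j set \<Rightarrow> ('j \<Rightarrow> 'i \<Rightarrow> real) \<Rightarrow> ('j \<Rightarrow> real) set"
  where "Rel I J A = {p. (\<forall>j. j \<notin> J \<longrightarrow> p j = 0) \<and> (\<forall>v\<in>I. (\<Sum>j\<in>J. p j * A j v) = 0)}"

lemma subspace_Ker: "subspace (Ker I J A)"
  unfolding Ker_def subspace_def
  by (auto simp: scaleR_fun_def distrib_left sum.distrib sum_distrib_left[symmetric] mult.left_commute[of _ "_ :: real"])

lemma subspace_Rel: "subspace (Rel I J A)"
  unfolding Rel_def subspace_def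
  by (auto simp: scaleR_fun_def distrib_right sum.distrib mult.assoc sum_distrib_left[symmetric])

lemma dot_diff_scale:
  fixes f c d :: "'i \<Rightarrow> real"
  shows "(\<Sum>v\<in>I. f v * (c - s *\<^sub>R d) v) = (\<Sum>v\<in>I. f v * c v) - s * (\<Sum>v\<in>I. f v * d v)"
  by (simp add: scaleR_fun_def right_diff_distrib sum_subtractf sum_distrib_left mult.left_commute)

lemma Ker_insert: "Ker I (insert j J) A = {c \<in> Ker I J A. (\<Sum>v\<in>I. A j v * c v) = 0}"
  unfolding Ker_def by auto

lemma Ker_shift:
  assumes "c \<in> Ker I J A" "c0 \<in> Ker I J A" "(\<Sum>v\<in>I. A j v * c0 v) = 1"
  shows "c - (\<Sum>v\<in>I. A j v * c v) *\<^sub>R c0 \<in> Ker I (insert j J) A"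
proof -
  have "c - (\<Sum>v\<in>I. A j v * c v) *\<^sub>R c0 \<in> Ker I J A"
    using assms subspace_Ker by (metis subspace_diff subspace_scale)
  moreover have "(\<Sum>v\<in>I. A j v * (c - (\<Sum>v\<in>I. A j v * c v) *\<^sub>R c0) v) = 0"
    unfolding dot_diff_scale using assms(3) by simp
  ultimately show ?thesis unfolding Ker_insert by blast
qed

lemma Ker_normalize:
  assumes "c \<in> Ker I J A" "(\<Sum>v\<in>I. A j v * c v) \<noteq> 0"
  shows "\<exists>c0 \<in> Ker I J A. (\<Sum>v\<in>I. A j v * c0 v) = 1"
proof
  let ?s = "\<Sum>v\<in>I. A j v * c v"
  show "(1 / ?s) *\<^sub>R c \<in> Ker I J A" using assms(1) subspace_Ker[of I J A] by (simp add: subspace_scale)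
  have "(\<Sum>v\<in>I. A j v * ((1 / ?s) *\<^sub>R c) v) = (1 / ?s) * ?s"
    by (simp only: scaleR_fun_def sum_distrib_left real_scaleR_def mult.left_commute)
  then show "(\<Sum>v\<in>I. A j v * ((1 / ?s) *\<^sub>R c) v) = 1" using assms(2) by simp
qed

text \<open>By induction on the number of rows. If the new row is not yet zero on the previous solution space,
it takes the value \<open>1\<close> at some solution \<open>c0\<close>, and subtracting a multiple of that row makes \<open>a\<close> vanish
at \<open>c0\<close> and hence on the whole previous solution space.\<close>

lemma annihilator_in_row_span:
  assumes "finite J" "finite I" "\<And>c. c \<in> Ker I J A \<Longrightarrow> (\<Sum>v\<in>I. a v * c v) = 0"
  shows "\<exists>q. \<forall>v\<in>I. a v = (\<Sum>j\<in>J. q j * A j v)"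
  using assms(1,3)
proof (induction J arbitrary: a rule: finite_induct)
  case empty
  have "a i = 0" if "i \<in> I" for i
  proof -
    have "(\<Sum>v\<in>I. a v * (if v = i then 1 else 0)) = 0" using that by (intro empty) (auto simp: Ker_def)
    moreover have "(\<Sum>v\<in>I. a v * (if v = i then 1 else 0)) = a i" using that assms(2) by (simp add: if_distrib cong: if_cong)
    ultimately show ?thesis by simp
  qed
  then show ?case by simp
next
  case (insert j J)
  show ?case
  proof (cases "\<exists>c \<in> Ker I J A. (\<Sum>v\<in>I. A j v * c v) \<noteq> 0")
    case True
    then obtain c1 where "c1 \<in> Ker I J A" "(\<Sum>v\<in>I. A j v * c1 v) \<noteq> 0" ..
    from Ker_normalize[where A = A, OF this] obtain c0 where c0: "c0 \<in> Ker I J A" "(\<Sum>v\<in>I. A j v * c0 v) = 1" ..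
    define k where "k = (\<Sum>v\<in>I. a v * c0 v)"
    have "(\<Sum>v\<in>I. (a v - k * A j v) * c v) = 0" if "c \<in> Ker I J A" for c
    proof -
      have "(\<Sum>v\<in>I. a v * (c - (\<Sum>v\<in>I. A j v * c v) *\<^sub>R c0) v) = 0"
        by (rule insert.prems[OF Ker_shift[OF that c0]])
      then have "(\<Sum>v\<in>I. a v * c v) - k * (\<Sum>v\<in>I. A j v * c v) = 0"
        unfolding dot_diff_scale k_def by (simp add: mult.commute)
      then show ?thesis
        by (simp add: left_diff_distrib sum_subtractf sum_distrib_left mult.assoc)
    qed
    then obtain q where q: "\<forall>v\<in>I. a v - k * A j v = (\<Sum>j\<in>J. q j * A j v)"
      using insert.IH[of "\<lambda>v. a v - k * A j v"] by blast
    have "a v = (\<Sum>i\<in>insert j J. (q(j := k)) i * A i v)" if "v \<in> I" for v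
    proof -
      have "(\<Sum>i\<in>J. (q(j := k)) i * A i v) = (\<Sum>i\<in>J. q i * A i v)" using insert(2) by (intro sum.cong) auto
      then show ?thesis using q that insert(1,2) by (simp add: algebra_simps)
    qed
    then show ?thesis by blast
  next
    case False
    then have "Ker I (insert j J) A = Ker I J A" unfolding Ker_insert by auto
    then obtain q where q: "\<forall>v\<in>I. a v = (\<Sum>j\<in>J. q j * A j v)"
      using insert.IH[of a] insert.prems by auto
    have "a v = (\<Sum>i\<in>insert j J. (q(j := 0)) i * A i v)" if "v \<in> I" for v
    proof -
      have "(\<Sum>i\<in>J. (q(j := 0)) i * A i v) = (\<Sum>i\<in>J. q i * A i v)" using insert(2) by (intro sum.cong) auto
      then show ?thesis using q that insert(1,2) by simp
    qed
    then show ?thesis by blast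
  qed
qed

lemma Rel_insert_extend:
  assumes "finite J" "j \<notin> J" "p \<in> Rel I J A" shows "p \<in> Rel I (insert j J) A"
  using assms unfolding Rel_def by auto

text \<open>Adding a row either lowers the dimension of the solution space by one or, if the row already
vanishes on the solution space, is a combination of the others and adds one relation. So the number
of unknowns minus the number of equations is the difference of the two dimensions.\<close>

theorem kernel_relation_index:
  assumes "finite J" "finite I"
  shows "\<exists>d e. hasdim (Ker I J A) d \<and> hasdim (Rel I J A) e \<and> d + card J = e + card I"
  using assms(1)
proof (induction J rule: finite_induct)
  case empty
  have R: "Rel I {} A = {c. \<forall>v. v \<notin> {} \<longrightarrow> c v = 0}" unfolding Rel_def by simp
  have K: "Ker I {} A = {c. \<forall>v. v \<notin> I \<longrightarrow> c v = 0}" unfolding Ker_def by simp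
  show ?case using hasdim_supported[OF assms(2)] hasdim_supported[OF finite.emptyI] unfolding R K
    by (intro exI[of _ "card I"] exI[of _ "card {}"]) simp
next
  case (insert j J)
  from insert.IH obtain d e where de: "hasdim (Ker I J A) d" "hasdim (Rel I J A) e" "d + card J = e + card I"
    by (elim exE conjE)
  have Rsub: "Rel I J A \<subseteq> Rel I (insert j J) A" using Rel_insert_extend[OF insert(1,2)] by (intro subsetI)
  show ?case
  proof (cases "\<exists>c \<in> Ker I J A. (\<Sum>v\<in>I. A j v * c v) \<noteq> 0")
    case True
    then obtain c1 where "c1 \<in> Ker I J A" "(\<Sum>v\<in>I. A j v * c1 v) \<noteq> 0" ..
    from Ker_normalize[where A = A, OF this] obtain c0 where c0: "c0 \<in> Ker I J A" "(\<Sum>v\<in>I. A j v * c0 v) = 1" ..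
    have "\<exists>f. d = Suc f \<and> hasdim (Ker I (insert j J) A) f"
    proof (rule hasdim_drop[OF de(1) subspace_Ker _ c0(1)])
      show "Ker I (insert j J) A \<subseteq> Ker I J A" unfolding Ker_insert by blast
      show "c0 \<notin> Ker I (insert j J) A" unfolding Ker_insert using c0 by simp
      show "\<exists>a. w - a *\<^sub>R c0 \<in> Ker I (insert j J) A" if "w \<in> Ker I J A" for w
        using Ker_shift[OF that c0] by blast
    qed
    then obtain f where f: "d = Suc f" "hasdim (Ker I (insert j J) A) f" by blast
    have "Rel I (insert j J) A = Rel I J A"
    proof (intro equalityI subsetI)
      fix p assume p: "p \<in> Rel I (insert j J) A"
      have "(\<Sum>v\<in>I. (\<Sum>i\<in>insert j J. p i * A i v) * c0 v) = 0" using p unfolding Rel_def by simp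
      also have "(\<Sum>v\<in>I. (\<Sum>i\<in>insert j J. p i * A i v) * c0 v) = (\<Sum>i\<in>insert j J. p i * (\<Sum>v\<in>I. A i v * c0 v))"
        by (simp only: sum_distrib_left sum_distrib_right mult.assoc) (rule sum.swap)
      also have "\<dots> = p j + (\<Sum>i\<in>J. p i * (\<Sum>v\<in>I. A i v * c0 v))" using insert(1,2) c0(2) by simp
      also have "(\<Sum>i\<in>J. p i * (\<Sum>v\<in>I. A i v * c0 v)) = 0" using c0(1) unfolding Ker_def by (simp)
      finally have "p j = 0" by simp
      then show "p \<in> Rel I J A" using p insert(1,2) unfolding Rel_def by auto
    qed (use Rsub in blast)
    then show ?thesis using f de insert(1,2) by (intro exI[of _ f] exI[of _ e]) simp
  next
    case False
    then have K: "Ker I (insert j J) A = Ker I J A" unfolding Ker_insert by auto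
    obtain q where q: "\<forall>v\<in>I. A j v = (\<Sum>i\<in>J. q i * A i v)"
      using annihilator_in_row_span[OF insert(1) assms(2), of A "A j"] False by blast
    \<comment> \<open>the relation that expresses the new row by the old ones\<close>
    define r where "r = (\<lambda>i. if i = j then -1 else if i \<in> J then q i else 0)"
    have rJ: "(\<Sum>i\<in>J. r i * A i v) = (\<Sum>i\<in>J. q i * A i v)" for v
      using insert(2) unfolding r_def by (intro sum.cong) auto
    have "hasdim (Rel I (insert j J) A) (Suc e)"
    proof (rule hasdim_extend[OF de(2) subspace_Rel Rsub, of r])
      show r: "r \<in> Rel I (insert j J) A"
        unfolding Rel_def using q rJ insert(1,2) by (auto simp: r_def)
      show "r \<notin> Rel I J A" unfolding Rel_def r_def using insert(2) by auto
      fix w assume w: "w \<in> Rel I (insert j J) A"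
      have "w + w j *\<^sub>R r \<in> Rel I (insert j J) A" using w r subspace_Rel by (metis subspace_add subspace_scale)
      moreover have "(w + w j *\<^sub>R r) j = 0" by (simp add: scaleR_fun_def r_def)
      ultimately have "w + w j *\<^sub>R r \<in> Rel I J A" using insert(1,2) unfolding Rel_def by auto
      then show "\<exists>a. w - a *\<^sub>R r \<in> Rel I J A" by (intro exI[of _ "- w j"]) simp
    qed
    then show ?thesis using K de insert(1,2) by (intro exI[of _ d] exI[of _ "Suc e"]) simp
  qed
qed


section \<open>Piecewise quadratic functions of one variable\<close>

definition quad_on :: "real set \<Rightarrow> (real \<Rightarrow> real) \<Rightarrow> bool"
  where "quad_on A g \<longleftrightarrow> (\<exists>p0 p1 p2. \<forall>t\<in>A. g t = p0 + p1 * t + p2 * t\<^sup>2)"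

text \<open>The truncated square, usually written \<open>t\<^sub>+\<^sup>2\<close>.\<close>

definition tsq :: "real \<Rightarrow> real" where "tsq t = (max 0 t)\<^sup>2"

lemma tsq_simps: "t \<le> 0 \<Longrightarrow> tsq t = 0" "0 \<le> t \<Longrightarrow> tsq t = t\<^sup>2"
  by (auto simp: tsq_def)

lemma tsq_deriv: "(tsq has_real_derivative 2 * max 0 t) (at t)"
proof -
  consider "t < 0" | "t = 0" | "t > 0" by linarith
  then show ?thesis
  proof cases
    case 1
    have "((\<lambda>_. 0) has_real_derivative 2 * max 0 t) (at t)" using 1 by (auto intro!: derivative_eq_intros)
    then show ?thesis
      by (rule has_field_derivative_transform_within_open[where S = "{..<0}"]) (use 1 in \<open>auto simp: tsq_simps\<close>)
  next
    case 2
    have "(tsq (0 + h) - tsq 0) / h = max 0 h" for h by (auto simp: tsq_def max_def power2_eq_square)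
    moreover have "((\<lambda>h::real. max 0 h) \<longlongrightarrow> max 0 0) (at 0)" by (intro tendsto_intros)
    ultimately show ?thesis using 2 by (simp add: DERIV_def)
  next
    case 3
    have "((\<lambda>t. t\<^sup>2) has_real_derivative 2 * max 0 t) (at t)" using 3 by (auto intro!: derivative_eq_intros)
    then show ?thesis
      by (rule has_field_derivative_transform_within_open[where S = "{0<..}"]) (use 3 in \<open>auto simp: tsq_simps\<close>)
  qed
qed

lemma tsq_shift_deriv: "((\<lambda>t. tsq (t - s)) has_real_derivative 2 * max 0 (t - s)) (at t)"
proof -
  have "((\<lambda>t. t - s) has_real_derivative 1) (at t)" by (auto intro!: derivative_eq_intros)
  from DERIV_chain2[OF tsq_deriv this] show ?thesis by simp
qed

lemma quad_coeffs_zero: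
  fixes p0 p1 p2 :: real
  assumes "\<And>t. t \<in> {a, b, c} \<Longrightarrow> p0 + p1 * t + p2 * t\<^sup>2 = 0" "a \<noteq> b" "a \<noteq> c" "b \<noteq> c"
  shows "p0 = 0 \<and> p1 = 0 \<and> p2 = 0"
proof -
  have e: "p0 + p1 * a + p2 * a\<^sup>2 = 0" "p0 + p1 * b + p2 * b\<^sup>2 = 0" "p0 + p1 * c + p2 * c\<^sup>2 = 0"
    using assms(1) by auto
  then have "(a - b) * (p1 + p2 * (a + b)) = 0" "(a - c) * (p1 + p2 * (a + c)) = 0" by (algebra, algebra)
  then have *: "p1 + p2 * (a + b) = 0" "p1 + p2 * (a + c) = 0" using assms(2,3) by auto
  then have "p2 * (b - c) = 0" by algebra
  then have "p2 = 0" using assms(4) by auto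
  then show ?thesis using * e by auto
qed

lemma quad_on_subset: "quad_on A g \<Longrightarrow> B \<subseteq> A \<Longrightarrow> quad_on B g"
  unfolding quad_on_def by blast

lemma quad_on_cong: "(\<And>t. t \<in> A \<Longrightarrow> g t = h t) \<Longrightarrow> quad_on A g \<longleftrightarrow> quad_on A h"
  unfolding quad_on_def by simp

lemma quad_on_diff: "quad_on A g \<Longrightarrow> quad_on A h \<Longrightarrow> quad_on A (\<lambda>t. g t - h t)"
  unfolding quad_on_def
proof (elim exE)
  fix p0 p1 p2 q0 q1 q2 assume "\<forall>t\<in>A. g t = p0 + p1 * t + p2 * t\<^sup>2" "\<forall>t\<in>A. h t = q0 + q1 * t + q2 * t\<^sup>2"
  then show "\<exists>p0 p1 p2. \<forall>t\<in>A. g t - h t = p0 + p1 * t + p2 * t\<^sup>2"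
    by (intro exI[of _ "p0 - q0"] exI[of _ "p1 - q1"] exI[of _ "p2 - q2"]) (simp add: algebra_simps)
qed

lemma quad_on_cmult: "quad_on A g \<Longrightarrow> quad_on A (\<lambda>t. k * g t)"
  unfolding quad_on_def
proof (elim exE)
  fix p0 p1 p2 assume "\<forall>t\<in>A. g t = p0 + p1 * t + p2 * t\<^sup>2"
  then show "\<exists>p0 p1 p2. \<forall>t\<in>A. k * g t = p0 + p1 * t + p2 * t\<^sup>2"
    by (intro exI[of _ "k * p0"] exI[of _ "k * p1"] exI[of _ "k * p2"]) (simp add: algebra_simps)
qed

lemma quad_on_zero: "quad_on A (\<lambda>t. 0)"
  unfolding quad_on_def by (intro exI[of _ 0]) simp

lemma quad_on_square: "quad_on A (\<lambda>t. (t - s)\<^sup>2)"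
  unfolding quad_on_def
  by (intro exI[of _ "s\<^sup>2"] exI[of _ "- 2 * s"] exI[of _ 1]) (simp add: power2_diff)

lemma quad_on_tsq:
  "(\<And>t. t \<in> A \<Longrightarrow> t \<le> s) \<Longrightarrow> quad_on A (\<lambda>t. tsq (t - s))" "(\<And>t. t \<in> A \<Longrightarrow> s \<le> t) \<Longrightarrow> quad_on A (\<lambda>t. tsq (t - s))"
  using quad_on_cong[of A "\<lambda>t. tsq (t - s)" "\<lambda>t. 0"] quad_on_cong[of A "\<lambda>t. tsq (t - s)" "\<lambda>t. (t - s)\<^sup>2"]
  by (auto simp: tsq_simps quad_on_zero quad_on_square)

lemma quad_on_three_zeros:
  assumes "quad_on A g" "{a, b, c} \<subseteq> A" "g a = 0" "g b = 0" "g c = 0" "a \<noteq> b" "a \<noteq> c" "b \<noteq> c" "t \<in> A"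
  shows "g t = 0"
proof -
  obtain p0 p1 p2 where p: "\<forall>t\<in>A. g t = p0 + p1 * t + p2 * t\<^sup>2" using assms(1) unfolding quad_on_def by blast
  have "p0 = 0 \<and> p1 = 0 \<and> p2 = 0"
    by (rule quad_coeffs_zero[of a b c]) (use p assms in auto)
  then show ?thesis using p assms(9) by simp
qed

text \<open>A function that vanishes on one side of a point and is differentiable there has derivative zero.
Applied to the difference of a function and a quadratic, it identifies one-sided derivatives.\<close>

lemma deriv_zero_side:
  fixes g :: "real \<Rightarrow> real"
  assumes "(g has_real_derivative D) (at M)" "a < b" "M = a \<or> M = b" "\<And>t. a \<le> t \<Longrightarrow> t \<le> b \<Longrightarrow> g t = 0"
  shows "D = 0"
proof (rule ccontr)
  assume "D \<noteq> 0"
  then consider "D > 0" | "D < 0" by linarith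
  then have "(\<exists>d>0. \<forall>h>0. h < d \<longrightarrow> g (M - h) \<noteq> g M)" "(\<exists>d>0. \<forall>h>0. h < d \<longrightarrow> g (M + h) \<noteq> g M)"
    using DERIV_pos_inc_left[OF assms(1)] DERIV_pos_inc_right[OF assms(1)]
      DERIV_neg_dec_left[OF assms(1)] DERIV_neg_dec_right[OF assms(1)] by (metis less_irrefl)+
  then obtain d d' where d: "d > 0" "\<forall>h>0. h < d \<longrightarrow> g (M - h) \<noteq> g M" "d' > 0" "\<forall>h>0. h < d' \<longrightarrow> g (M + h) \<noteq> g M"
    by blast
  define h where "h = min (min d d') (b - a) / 2"
  have h: "h > 0" "h < d" "h < d'" "h < b - a" using d assms(2) unfolding h_def by auto
  then show False using d(2,4) assms(2,3) assms(4)[of "M - h"] assms(4)[of "M + h"] assms(4)[of M] by auto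
qed

text \<open>Two quadratics that meet with the same value and derivative at \<open>M\<close> differ by a multiple of
\<open>(t - M)\<^sup>2\<close>.\<close>

lemma quad_on_glue:
  assumes "a < M" "M < b" "quad_on {a..M} g" "quad_on {M..b} g" "(g has_real_derivative D) (at M)"
  shows "\<exists>\<alpha>. quad_on {a..b} (\<lambda>t. g t - \<alpha> * tsq (t - M))"
proof -
  obtain p0 p1 p2 where p: "\<And>t. t \<in> {a..M} \<Longrightarrow> g t = p0 + p1 * t + p2 * t\<^sup>2" using assms(3) unfolding quad_on_def by blast
  obtain q0 q1 q2 where q: "\<And>t. t \<in> {M..b} \<Longrightarrow> g t = q0 + q1 * t + q2 * t\<^sup>2" using assms(4) unfolding quad_on_def by blast
  have "((\<lambda>t. g t - (p0 + p1 * t + p2 * t\<^sup>2)) has_real_derivative D - (p1 + 2 * p2 * M)) (at M)"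
    by (auto intro!: derivative_eq_intros assms(5))
  then have "D - (p1 + 2 * p2 * M) = 0" by (rule deriv_zero_side[OF _ assms(1)]) (use p in auto)
  moreover have "((\<lambda>t. g t - (q0 + q1 * t + q2 * t\<^sup>2)) has_real_derivative D - (q1 + 2 * q2 * M)) (at M)"
    by (auto intro!: derivative_eq_intros assms(5))
  then have "D - (q1 + 2 * q2 * M) = 0" by (rule deriv_zero_side[OF _ assms(2)]) (use q in auto)
  ultimately have d: "q1 - p1 = -2 * (q2 - p2) * M" by (simp add: algebra_simps)
  have "p0 + p1 * M + p2 * M\<^sup>2 = q0 + q1 * M + q2 * M\<^sup>2" using p[of M] q[of M] assms(1,2) by simp
  then have "q0 - p0 = - (q1 - p1) * M - (q2 - p2) * M\<^sup>2" by (simp add: algebra_simps)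
  then have c: "q0 - p0 = (q2 - p2) * M\<^sup>2" unfolding d by (simp add: power2_eq_square algebra_simps)
  have "g t - (q2 - p2) * tsq (t - M) = p0 + p1 * t + p2 * t\<^sup>2" if "t \<in> {a..b}" for t
  proof (cases "t \<le> M")
    case True then show ?thesis using p[of t] that by (simp add: tsq_simps)
  next
    case False
    have "g t = p0 + p1 * t + p2 * t\<^sup>2 + ((q0 - p0) + (q1 - p1) * t + (q2 - p2) * t\<^sup>2)"
      using q[of t] False that by (simp add: algebra_simps)
    also have "(q0 - p0) + (q1 - p1) * t + (q2 - p2) * t\<^sup>2 = (q2 - p2) * (t - M)\<^sup>2"
      unfolding c d by (simp add: power2_eq_square algebra_simps)
    finally show ?thesis using False by (simp add: tsq_simps)
  qed
  then show ?thesis unfolding quad_on_def by blast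
qed

lemma tsq_not_quad:
  assumes "a < M" "M < b" "quad_on {a..b} (\<lambda>t. k * tsq (t - M))" shows "k = 0"
proof -
  have "k * tsq (b - M) = 0"
    by (rule quad_on_three_zeros[OF assms(3), of a "(a + M) / 2" M]) (use assms(1,2) in \<open>auto simp: tsq_simps field_simps\<close>)
  then show ?thesis using assms(2) by (simp add: tsq_simps)
qed

text \<open>Differentiable functions that are piecewise quadratic with breakpoints in \<open>X\<close>.\<close>

definition pwq :: "real set \<Rightarrow> (real \<Rightarrow> real) \<Rightarrow> bool"
  where "pwq X g \<longleftrightarrow> (\<forall>t. \<exists>D. (g has_real_derivative D) (at t)) \<and>
     (\<forall>a b. a < b \<longrightarrow> X \<inter> {a<..<b} = {} \<longrightarrow> quad_on {a..b} g)"

text \<open>The breakpoints are removed from right to left: subtracting a multiple of the truncated square at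
the last breakpoint makes the function quadratic across it. What remains without breakpoints is
quadratic on the whole line and zero near minus infinity.\<close>

lemma pwq_expansion:
  assumes "finite X" "pwq X g" "\<exists>m. \<forall>t<m. g t = 0"
  shows "\<exists>a. \<forall>t. g t = (\<Sum>s\<in>X. a s * tsq (t - s))"
  using assms
proof (induction X arbitrary: g rule: finite_linorder_max_induct)
  case empty
  then obtain m where m: "\<And>t. t < m \<Longrightarrow> g t = 0" by blast
  have "g t = 0" for t
  proof -
    have "quad_on {min t (m - 3)..max t m} g" using empty(1) unfolding pwq_def by auto
    then show ?thesis
      by (rule quad_on_three_zeros[of _ _ "m - 1" "m - 2" "m - 3"]) (use m in auto)
  qed
  then show ?case by simp
next
  case (insert M X)
  \<comment> \<open>the last breakpoint before \<open>M\<close>, or any point to the left of \<open>M\<close> if there is none\<close>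
  define L where "L = Max (insert (M - 1) X)"
  have L: "L < M" "\<And>x. x \<in> X \<Longrightarrow> x \<le> L" unfolding L_def using insert(1,2) by auto
  have q: "a < b \<Longrightarrow> insert M X \<inter> {a<..<b} = {} \<Longrightarrow> quad_on {a..b} g" for a b
    using insert.prems(1) unfolding pwq_def by blast
  obtain D where D: "(g has_real_derivative D) (at M)" using insert.prems(1) unfolding pwq_def by blast
  have qL: "quad_on {L..M} g" using L insert(2) by (intro q) force+
  have qR: "quad_on {M..b} g" if "M < b" for b using insert(2) that by (intro q) force+
  obtain \<alpha> where \<alpha>: "quad_on {L..M+1} (\<lambda>t. g t - \<alpha> * tsq (t - M))"
    using quad_on_glue[OF L(1) _ qL qR D, of "M + 1"] by auto
  let ?g = "\<lambda>t. g t - \<alpha> * tsq (t - M)"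
  have "pwq X ?g"
    unfolding pwq_def
  proof (intro conjI allI impI)
    fix t
    obtain D where "(g has_real_derivative D) (at t)" using insert.prems(1) unfolding pwq_def by blast
    then show "\<exists>D. (?g has_real_derivative D) (at t)"
      by (intro exI) (rule derivative_eq_intros tsq_shift_deriv refl | assumption)+
  next
    fix a b :: real assume ab: "a < b" "X \<inter> {a<..<b} = {}"
    consider "M \<le> a" | "b \<le> M" | "a < M" "M < b" by linarith
    then show "quad_on {a..b} ?g"
    proof cases
      case 1 then show ?thesis using ab by (intro quad_on_diff quad_on_cmult quad_on_tsq(2) q) auto
    next
      case 2 then show ?thesis using ab by (intro quad_on_diff quad_on_cmult quad_on_tsq(1) q) auto
    next
      case 3
      have "quad_on {a..M} g" using ab 3 by (intro q) auto
      then obtain \<beta> where \<beta>: "quad_on {a..b} (\<lambda>t. g t - \<beta> * tsq (t - M))" using quad_on_glue[OF 3 _ qR[OF 3(2)] D] by blast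
      let ?I = "{max a L..min b (M + 1)}"
      \<comment> \<open>the coefficient found on this interval is the same as before: compare on the common part\<close>
      have "quad_on ?I (\<lambda>t. (g t - \<beta> * tsq (t - M)) - (g t - \<alpha> * tsq (t - M)))"
        by (intro quad_on_diff quad_on_subset[OF \<alpha>] quad_on_subset[OF \<beta>]) auto
      then have "quad_on ?I (\<lambda>t. (\<alpha> - \<beta>) * tsq (t - M))" by (simp add: algebra_simps)
      then have "\<alpha> - \<beta> = 0" by (rule tsq_not_quad[rotated 2]) (use 3 L in auto)
      then show ?thesis using \<beta> by simp
    qed
  qed
  moreover obtain m where m: "\<forall>t<m. g t = 0" using insert.prems(2) by blast
  have "\<forall>t<min m M. ?g t = 0" using m by (auto simp: tsq_simps)
  ultimately obtain a where a: "\<And>t. ?g t = (\<Sum>s\<in>X. a s * tsq (t - s))" using insert.IH by blast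
  have "g t = (\<Sum>s\<in>insert M X. (a(M := \<alpha>)) s * tsq (t - s))" for t
  proof -
    have "(\<Sum>s\<in>X. (a(M := \<alpha>)) s * tsq (t - s)) = (\<Sum>s\<in>X. a s * tsq (t - s))" using insert(2) by (intro sum.cong) auto
    then have "(\<Sum>s\<in>insert M X. (a(M := \<alpha>)) s * tsq (t - s)) = \<alpha> * tsq (t - M) + (\<Sum>s\<in>X. a s * tsq (t - s))"
      using insert(1,2) by (subst sum.insert) auto
    then show ?thesis using a[of t] by simp
  qed
  then show ?case by blast
qed

text \<open>A difference quotient for half the jump of the second derivative at \<open>s\<close>. It reads off the
coefficient of the truncated square at \<open>s\<close> from four samples. Being a fixed linear combination of
values, it passes the regularity of a function of two variables in the other variable on to the
coefficient.\<close>

definition jump :: "real \<Rightarrow> real \<Rightarrow> (real \<Rightarrow> real) \<Rightarrow> real"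
  where "jump h s g = (g (s + 2 * h) - 2 * g (s + h) + 2 * g (s - h) - g (s - 2 * h)) / (2 * h\<^sup>2)"

lemma jump_quad: "quad_on {s - 2 * h..s + 2 * h} g \<Longrightarrow> h > 0 \<Longrightarrow> jump h s g = 0"
proof -
  assume h: "h > 0" and "quad_on {s - 2 * h..s + 2 * h} g"
  then obtain p0 p1 p2 where p: "\<And>t. t \<in> {s - 2 * h..s + 2 * h} \<Longrightarrow> g t = p0 + p1 * t + p2 * t\<^sup>2" unfolding quad_on_def by blast
  show ?thesis unfolding jump_def using h
    by (simp add: p) (simp add: power2_eq_square algebra_simps)
qed

lemma jump_tsq: "h > 0 \<Longrightarrow> jump h s (\<lambda>t. tsq (t - s)) = 1"
  unfolding jump_def by (simp add: tsq_simps field_simps power2_eq_square)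

lemma jump_tsq_other: "h > 0 \<Longrightarrow> 2 * h \<le> \<bar>s - u\<bar> \<Longrightarrow> jump h s (\<lambda>t. tsq (t - u)) = 0"
  by (rule jump_quad, cases "u \<le> s") (auto intro: quad_on_tsq(2), auto intro!: quad_on_tsq(1))

lemma jump_sum: "jump h s (\<lambda>t. \<Sum>u\<in>X. a u * g u t) = (\<Sum>u\<in>X. a u * jump h s (g u))"
  unfolding jump_def
  by (simp add: sum_divide_distrib[symmetric] sum_distrib_left sum.distrib sum_subtractf right_diff_distrib distrib_left mult.left_commute)
 
lemma jump_expansion:
  assumes "finite X" "h > 0" "\<And>s u. s \<in> X \<Longrightarrow> u \<in> X \<Longrightarrow> s \<noteq> u \<Longrightarrow> 2 * h \<le> \<bar>s - u\<bar>" "s \<in> X"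
  shows "jump h s (\<lambda>t. \<Sum>u\<in>X. a u * tsq (t - u)) = a s"
proof -
  have "(\<Sum>u\<in>X. a u * jump h s (\<lambda>t. tsq (t - u))) = (\<Sum>u\<in>X. if u = s then a s else 0)"
    by (intro sum.cong refl) (use assms jump_tsq jump_tsq_other in auto)
  then show ?thesis unfolding jump_sum using assms(1,4) by simp
qed

section \<open>Edges and l-edges of a rectangular partition\<close>

definition hedge :: "quad set \<Rightarrow> real \<Rightarrow> real \<Rightarrow> real \<Rightarrow> bool"
  where "hedge Q s t y \<longleftrightarrow> s < t \<and> corner Q s y \<and> corner Q t y \<and> (\<forall>x. s \<le> x \<and> x \<le> t \<longrightarrow> frame Q x y) \<and>
     (\<forall>x. s < x \<and> x < t \<longrightarrow> \<not> corner Q x y)"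

definition hseg :: "real \<Rightarrow> real \<Rightarrow> real \<Rightarrow> (real \<times> real) set" where "hseg s t y = {s..t} \<times> {y}"

definition hedges :: "quad set \<Rightarrow> (real \<times> real) set set"
  where "hedges Q = {hseg s t y | s t y. hedge Q s t y}"

lemma hseg_eq_iff: "s \<le> t \<Longrightarrow> hseg s t y = hseg s' t' y' \<longleftrightarrow> s = s' \<and> t = t' \<and> y = y'"
  unfolding hseg_def by (auto simp: times_eq_iff)

lemma mem_hseg [simp]: "(x, z) \<in> hseg s t y \<longleftrightarrow> s \<le> x \<and> x \<le> t \<and> z = y"
  unfolding hseg_def by auto

context rect_partition
begin

lemma hedge_rf: "hedge (reflect_quad -` Q) s t y \<longleftrightarrow> hedge Q (-t) (-s) y"
proof -
  have "(\<forall>x. s \<le> x \<and> x \<le> t \<longrightarrow> K (-x) y) \<longleftrightarrow> (\<forall>x. -t \<le> x \<and> x \<le> -s \<longrightarrow> K x y)"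
    "(\<forall>x. s < x \<and> x < t \<longrightarrow> \<not> corner Q (-x) y) \<longleftrightarrow> (\<forall>x. -t < x \<and> x < -s \<longrightarrow> \<not> corner Q x y)"
    by (metis minus_minus neg_le_iff_le, metis minus_minus neg_less_iff_less)
  then show ?thesis unfolding hedge_def by (auto simp: frame_rf corner_rf)
qed

lemma hedge_dirs: "hedge Q s t y \<Longrightarrow> east K s y \<and> west K t y"
  using edge_dirs[of s t y] unfolding hedge_def by auto

lemma hedge_unique: "hedge Q s t y \<Longrightarrow> hedge Q s t' y \<Longrightarrow> t = t'"
  unfolding hedge_def by (meson linorder_neqE_linordered_idom)

lemma hedge_unique_west: "hedge Q s t y \<Longrightarrow> hedge Q s' t y \<Longrightarrow> s = s'"
  unfolding hedge_def by (meson linorder_neqE_linordered_idom)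

text \<open>The run to the east ends at a vertex, so there is a nearest vertex on it.\<close>

lemma hedge_east:
  assumes "corner Q x y" "east K x y" shows "\<exists>t. hedge Q x t y"
proof -
  obtain t where t: "t > x" "\<forall>s. x \<le> s \<and> s \<le> t \<longrightarrow> K s y" "\<not> east K t y" using run_east[OF assms(2)] by (elim exE conjE)
  have ct: "corner Q t y" using run_end_corner[of t y] t edge_dirs(2)[OF t(1,2) t(1)] by simp
  let ?A = "{z \<in> xcoords Q. x < z \<and> z \<le> t \<and> corner Q z y}"
  have ne: "?A \<noteq> {}" using t(1) ct corner_x by blast
  have fn: "finite ?A" by (rule finite_subset[OF _ finite_xcoords]) blast
  have m: "Min ?A \<in> ?A" by (rule Min_in[OF fn ne])
  have m2: "z \<in> ?A \<Longrightarrow> Min ?A \<le> z" for z by (rule Min_le[OF fn])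
  define u where "u = Min ?A"
  have u: "x < u" "u \<le> t" "corner Q u y" using m unfolding u_def by blast+
  have "\<not> corner Q z y" if "x < z" "z < u" for z
    using m2[of z] that u corner_x[of z y] unfolding u_def[symmetric] by auto
  moreover have "K z y" if "x \<le> z" "z \<le> u" for z using t(2) that u by simp
  ultimately show ?thesis unfolding hedge_def using u assms(1) by blast
qed

lemma hedge_west:
  assumes "corner Q x y" "west K x y" shows "\<exists>s. hedge Q s x y"
proof -
  obtain t where "hedge (reflect_quad -` Q) (-x) t y"
    using rect_partition.hedge_east[OF reflected, of "-x" y] assms by (auto simp: frame_rf corner_rf)
  then show ?thesis unfolding hedge_rf by auto
qed

lemma card_hedges_at:
  assumes "corner Q x y"
  shows "finite {e \<in> hedges Q. (x, y) \<in> e}"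
    "card {e \<in> hedges Q. (x, y) \<in> e} = of_bool (east K x y) + of_bool (west K x y)"
proof -
  have eq: "{e \<in> hedges Q. (x, y) \<in> e} = {hseg x t y | t. hedge Q x t y} \<union> {hseg s x y | s. hedge Q s x y}"
  proof (intro equalityI subsetI)
    fix e assume "e \<in> {e \<in> hedges Q. (x, y) \<in> e}"
    then obtain s t where e: "e = hseg s t y" "hedge Q s t y" "s \<le> x" "x \<le> t" unfolding hedges_def by auto
    then have "\<not> (s < x \<and> x < t)" using assms unfolding hedge_def by blast
    then have "x = s \<or> x = t" using e by linarith
    then show "e \<in> {hseg x t y | t. hedge Q x t y} \<union> {hseg s x y | s. hedge Q s x y}" using e by blast
  next
    fix e assume "e \<in> {hseg x t y | t. hedge Q x t y} \<union> {hseg s x y | s. hedge Q s x y}"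
    then show "e \<in> {e \<in> hedges Q. (x, y) \<in> e}" unfolding hedges_def hedge_def by auto
  qed
  have E: "\<exists>t. {hseg x t y | t. hedge Q x t y} = {hseg x t y} \<and> x < t" if e: "east K x y"
  proof -
    obtain t where t: "hedge Q x t y" using hedge_east[OF assms e] by blast
    then have "{hseg x t y | t. hedge Q x t y} = {hseg x t y}" using hedge_unique[OF t] by blast
    then show ?thesis using t unfolding hedge_def by blast
  qed
  have nE: "{hseg x t y | t. hedge Q x t y} = {}" if "\<not> east K x y" using hedge_dirs that by blast
  have W: "\<exists>s. {hseg s x y | s. hedge Q s x y} = {hseg s x y} \<and> s < x" if w: "west K x y"
  proof -
    obtain s where t: "hedge Q s x y" using hedge_west[OF assms w] by blast
    then have "{hseg s x y | s. hedge Q s x y} = {hseg s x y}" using hedge_unique_west[OF t] by blast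
    then show ?thesis using t unfolding hedge_def by blast
  qed
  have nW: "{hseg s x y | s. hedge Q s x y} = {}" if "\<not> west K x y" using hedge_dirs that by blast
  have ne: "hseg x t y \<noteq> hseg s x y" if "x < t" for s t using that by (simp add: hseg_eq_iff)
  have "finite {e \<in> hedges Q. (x, y) \<in> e} \<and>
    card {e \<in> hedges Q. (x, y) \<in> e} = of_bool (east K x y) + of_bool (west K x y)"
  proof (cases "east K x y")
    case True
    then obtain t where t: "{hseg x t y | t. hedge Q x t y} = {hseg x t y}" "x < t" using E by blast
    show ?thesis
    proof (cases "west K x y")
      case W': True
      then obtain s where s: "{hseg s x y | s. hedge Q s x y} = {hseg s x y}" using W by blast
      then show ?thesis unfolding eq t(1) s using True W' ne[OF t(2), of s] ne[OF t(2), of s, symmetric] by simp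
    next
      case False then show ?thesis unfolding eq t(1) nW[OF False] using True by simp
    qed
  next
    case False
    show ?thesis
    proof (cases "west K x y")
      case W': True
      then obtain s where s: "{hseg s x y | s. hedge Q s x y} = {hseg s x y}" using W by blast
      then show ?thesis unfolding eq nE[OF False] s using False W' by simp
    next
      case W': False then show ?thesis unfolding eq nE[OF False] nW[OF W'] using False by simp
    qed
  qed
  then show "finite {e \<in> hedges Q. (x, y) \<in> e}"
    "card {e \<in> hedges Q. (x, y) \<in> e} = of_bool (east K x y) + of_bool (west K x y)" by auto
qed

definition rim :: "(real \<times> real) set"
  where "rim = {(x, y). a1 \<le> x \<and> x \<le> a2 \<and> b1 \<le> y \<and> y \<le> b2 \<and> (x = a1 \<or> x = a2 \<or> y = b1 \<or> y = b2)}"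

text \<open>The admissible ends of horizontal l-edges: boundary vertices and T-vertices at which exactly one of
the two horizontal directions is missing.\<close>

definition hend :: "real \<Rightarrow> real \<Rightarrow> bool"
  where "hend x y \<longleftrightarrow> corner Q x y \<and> ((x, y) \<in> rim \<or> east K x y \<noteq> west K x y)"

text \<open>This is the definition of an l-edge, rephrased. An end on the rim or at a horizontal T-vertex has no
skeleton beyond it, so a union of interior edges between two such ends is a maximal segment.
Conversely a maximal segment is covered by the edges between its consecutive vertices.\<close>

lemma ihruns_iff:
  assumes "s < t"
  shows "hend s y \<and> hend t y \<and> (\<exists>F \<subseteq> {e \<in> hedges Q. \<not> e \<subseteq> rim}. hseg s t y = \<Union>F) \<longleftrightarrow> (y, s, t) \<in> ihruns"
proof
  assume L: "hend s y \<and> hend t y \<and> (\<exists>F \<subseteq> {e \<in> hedges Q. \<not> e \<subseteq> rim}. hseg s t y = \<Union>F)"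
  then obtain F where F: "F \<subseteq> {e \<in> hedges Q. \<not> e \<subseteq> rim}" "hseg s t y = \<Union>F" by blast
  have e: "\<exists>s' t'. hedge Q s' t' y \<and> s' \<le> x \<and> x \<le> t' \<and> \<not> hseg s' t' y \<subseteq> rim" if "s \<le> x" "x \<le> t" for x
  proof -
    have "(x, y) \<in> \<Union>F" using that unfolding F(2)[symmetric] by simp
    then show ?thesis using F(1) unfolding hedges_def by fastforce
  qed
  have k: "K x y" if "s \<le> x" "x \<le> t" for x using e[OF that] unfolding hedge_def by blast
  have "y \<noteq> b1 \<and> y \<noteq> b2"
  proof -
    obtain s' t' where *: "hedge Q s' t' y" "\<not> hseg s' t' y \<subseteq> rim" using e[of s] assms by auto
    have "a1 \<le> x \<and> x \<le> a2 \<and> b1 \<le> y \<and> y \<le> b2" if "s' \<le> x" "x \<le> t'" for x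
      using that *(1) K_region[of x y] unfolding hedge_def by simp
    then have "hseg s' t' y \<subseteq> rim" if "y = b1 \<or> y = b2" 
      unfolding rim_def using that by (auto simp: hseg_def)
    then show ?thesis using *(2) by blast
  qed
  moreover have d: "east K s y" "west K t y" using edge_dirs[OF assms, of y] k assms by auto
  have r: "s < a2" "a1 < t" using dir_region d by auto
  have "\<not> west K s y" using L d r calculation dir_region(2)[of s y] unfolding hend_def rim_def by auto
  moreover have "\<not> east K t y" using L d r calculation dir_region(1)[of t y] unfolding hend_def rim_def by auto
  ultimately show "(y, s, t) \<in> ihruns" unfolding ihruns_def hruns_def using assms k by auto
next
  assume "(y, s, t) \<in> ihruns"
  then have h: "(y, s, t) \<in> hruns Q" and y: "y \<noteq> b1" "y \<noteq> b2" unfolding ihruns_def by auto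
  note hd = hrunsD[OF h]
  have y': "b1 < y" "y < b2" using run_height[OF h] y by auto
  have ends: "hend s y" "hend t y" unfolding hend_def using run_ends[OF h] hd(3,4) hd(5)[of s] hd(6)[of t] hd(1) by auto
  let ?F = "{e \<in> hedges Q. \<not> e \<subseteq> rim \<and> e \<subseteq> hseg s t y}"
  have "(x, y) \<in> \<Union>?F" if x: "s \<le> x" "x \<le> t" for x
  proof -
    let ?A = "{z \<in> xcoords Q. corner Q z y \<and> s \<le> z \<and> z \<le> x \<and> z < t}"
    have fn: "finite ?A" by (rule finite_subset[OF _ finite_xcoords]) blast
    have ne: "?A \<noteq> {}" using run_ends(1)[OF h] corner_x x hd(1) by blast
    have m: "Max ?A \<in> ?A" by (rule Max_in[OF fn ne])
    have m2: "z \<in> ?A \<Longrightarrow> z \<le> Max ?A" for z by (rule Max_ge[OF fn])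
    define u where "u = Max ?A"
    have u: "corner Q u y" "s \<le> u" "u \<le> x" "u < t" using m unfolding u_def by blast+
    obtain v where v: "hedge Q u v y" using hedge_east[OF u(1) hd(5)[OF u(2,4)]] by blast
    have "v \<le> t" using v run_ends(2)[OF h] u(4) unfolding hedge_def by (meson not_le)
    have "x \<le> v"
    proof (rule ccontr)
      assume "\<not> x \<le> v"
      moreover have "u < v" "corner Q v y" using v unfolding hedge_def by auto
      ultimately have "v \<in> ?A" using x u corner_x[of v y] by auto
      then show False using m2[of v] \<open>u < v\<close> unfolding u_def by linarith
    qed
    have lt: "u < v" "K u y" "K v y" using v unfolding hedge_def by auto
    then have "((u + v) / 2, y) \<in> hseg u v y - rim" using y' K_region[of u y] K_region[of v y] 
      unfolding rim_def by auto
    then have "\<not> hseg u v y \<subseteq> rim" by blast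
    moreover have "hseg u v y \<subseteq> hseg s t y" using u \<open>v \<le> t\<close> by (auto simp: hseg_def)
    ultimately have "hseg u v y \<in> ?F" using v unfolding hedges_def by blast
    then show ?thesis using \<open>x \<le> v\<close> u(3) by (intro UnionI[of "hseg u v y"]) auto
  qed
  then have "hseg s t y = \<Union>?F" by (auto simp: hseg_def)
  then show "hend s y \<and> hend t y \<and> (\<exists>F \<subseteq> {e \<in> hedges Q. \<not> e \<subseteq> rim}. hseg s t y = \<Union>F)"
    using ends by (intro conjI exI[of _ ?F]) auto
qed

end

section \<open>Meshes as rectangular partitions\<close>

definition quads :: "mesh \<Rightarrow> quad set"
  where "quads T = {(x1, x2, y1, y2). x1 < x2 \<and> y1 < y2 \<and> cbox (x1, y1) (x2, y2) \<in> T}"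

lemma mem_box_pair: "(x, y) \<in> box (x1, y1) (x2, y2) \<longleftrightarrow> x1 < x \<and> x < x2 \<and> y1 < y \<and> y < y2"
  for x y :: real by (auto simp: box_prod)

lemma mem_frontier_pair: "(x, y) \<in> frontier (cbox (x1, y1) (x2, y2)) \<longleftrightarrow>
    x1 \<le> x \<and> x \<le> x2 \<and> y1 \<le> y \<and> y \<le> y2 \<and> \<not> (x1 < x \<and> x < x2 \<and> y1 < y \<and> y < y2)"
  for x y :: real by (auto simp: frontier_cbox mem_box_pair)

lemma seg_h: "closed_segment (x :: real, y :: real) (x', y) = closed_segment x x' \<times> {y}"
  using closed_segment_same_snd[of "(x, y)" "(x', y)"] by simp
lemma seg_v: "closed_segment (x :: real, y :: real) (x, y') = {x} \<times> closed_segment y y'"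
  using closed_segment_same_fst[of "(x, y)" "(x, y')"] by simp

lemma seg_hseg: "x \<le> x' \<Longrightarrow> closed_segment (x, y) (x', y) = hseg x x' y"
  by (simp add: seg_h hseg_def closed_segment_eq_real_ivl)
lemma seg_vseg: "y \<le> y' \<Longrightarrow> closed_segment (x, y) (x, y') = prod.swap ` hseg y y' x"
  by (auto simp: seg_v hseg_def closed_segment_eq_real_ivl image_iff)

lemma open_seg_h: "x < x' \<Longrightarrow> open_segment (x, y) (x', y) = {x<..<x'} \<times> {y :: real}"
  for x x' :: real
  unfolding open_segment_def seg_h by (auto simp: closed_segment_eq_real_ivl)
lemma open_seg_v: "y < y' \<Longrightarrow> open_segment (x, y) (x, y') = {x :: real} \<times> {y<..<y'}"
  for y y' :: real
  unfolding open_segment_def seg_v by (auto simp: closed_segment_eq_real_ivl)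

lemma swap_Union_iff:
  "(\<exists>F \<subseteq> (`) prod.swap ` X. prod.swap ` A = \<Union>F) \<longleftrightarrow> (\<exists>F \<subseteq> X. A = \<Union>F)" for A :: "(real \<times> real) set"
proof -
  have eq: "prod.swap ` A = \<Union>((`) prod.swap ` F) \<longleftrightarrow> A = \<Union>F" for F
    unfolding image_Union[symmetric] by (rule inj_image_eq_iff) simp
  show ?thesis
  proof
    assume "\<exists>F \<subseteq> (`) prod.swap ` X. prod.swap ` A = \<Union>F"
    then obtain F where F: "F \<subseteq> (`) prod.swap ` X" "prod.swap ` A = \<Union>F" by (elim exE conjE)
    from F(1) obtain G where "G \<subseteq> X" "F = (`) prod.swap ` G" by (rule subset_imageE)
    then show "\<exists>F \<subseteq> X. A = \<Union>F" using F(2) eq[of G] by (intro exI[of _ G]) simp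
  next
    assume "\<exists>F \<subseteq> X. A = \<Union>F"
    then obtain F where "F \<subseteq> X" "A = \<Union>F" by (elim exE conjE)
    then show "\<exists>F \<subseteq> (`) prod.swap ` X. prod.swap ` A = \<Union>F"
      using eq[of F] by (intro exI[of _ "(`) prod.swap ` F"] conjI image_mono) simp_all
  qed
qed

lemma cbox_inj: "x1 < x2 \<Longrightarrow> y1 < y2 \<Longrightarrow> cbox (x1, y1) (x2, y2) = cbox (x1', y1') (x2', y2') \<Longrightarrow> 
    x1 = x1' \<and> x2 = x2' \<and> y1 = y1' \<and> y2 = y2'" for x1 x2 y1 y2 :: real
  unfolding eq_cbox using cbox_Pair_eq_0[of x1 y1 x2 y2] by auto

text \<open>A mesh that occupies a rectangle. Its cells are boxes with non-empty interior, hence in bijection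
with their quadruples of coordinates.\<close>

locale rect_mesh =
  fixes S :: mesh and a1 a2 b1 b2 :: real
  assumes mesh: "t_mesh S" and region: "region S = cbox (a1, b1) (a2, b2)" and wide0: "a1 < a2" and high0: "b1 < b2"
begin

abbreviation Q where "Q \<equiv> quads S"

lemma div: "S division_of region S" and int_ne: "c \<in> S \<Longrightarrow> interior c \<noteq> {}"
  using mesh unfolding t_mesh_def by auto

lemma cellE: "c \<in> S \<Longrightarrow> \<exists>x1 x2 y1 y2. c = cbox (x1, y1) (x2, y2) \<and> (x1, x2, y1, y2) \<in> Q"
proof -
  assume c: "c \<in> S"
  obtain p q where pq: "c = cbox p q" using division_ofD(4)[OF div c] by blast
  obtain x1 y1 x2 y2 where [simp]: "p = (x1, y1)" "q = (x2, y2)" by (metis surj_pair)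
  have "box (x1, y1) (x2, y2) \<noteq> {}" using int_ne[OF c] pq by simp
  then obtain x y where "(x, y) \<in> box (x1, y1) (x2, y2)" by auto
  then have "x1 < x2" "y1 < y2" unfolding mem_box_pair by auto
  then show ?thesis using pq c unfolding quads_def by auto
qed

lemma quads_inj: "(x1, x2, y1, y2) \<in> Q \<Longrightarrow> cbox (x1, y1) (x2, y2) \<in> S \<and> x1 < x2 \<and> y1 < y2"
  unfolding quads_def by auto

sublocale rect_partition Q a1 a2 b1 b2
proof
  have "Q \<subseteq> (\<lambda>c. THE q. \<exists>x1 x2 y1 y2. q = (x1, x2, y1, y2) \<and> c = cbox (x1, y1) (x2, y2)) ` S"
  proof
    fix q assume "q \<in> Q"
    then obtain x1 x2 y1 y2 where q: "q = (x1, x2, y1, y2)" "cbox (x1, y1) (x2, y2) \<in> S" "x1 < x2" "y1 < y2"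
      unfolding quads_def by auto
    have "(THE q. \<exists>u1 u2 v1 v2. q = (u1, u2, v1, v2) \<and> cbox (x1, y1) (x2, y2) = cbox (u1, v1) (u2, v2)) = q"
      by (rule the_equality) (use q cbox_inj[OF q(3,4)] in blast)+
    then show "q \<in> (\<lambda>c. THE q. \<exists>x1 x2 y1 y2. q = (x1, x2, y1, y2) \<and> c = cbox (x1, y1) (x2, y2)) ` S"
      using q(2) by (intro image_eqI) auto
  qed
  then show "finite Q" using division_ofD(1)[OF div] by (meson finite_imageI finite_subset)
next
  fix x1 x2 y1 y2 assume q: "(x1, x2, y1, y2) \<in> Q"
  note q' = quads_inj[OF q]
  then have "cbox (x1, y1) (x2, y2) \<subseteq> cbox (a1, b1) (a2, b2)" using region by blast
  moreover have "(x1, y1) \<in> cbox (x1, y1) (x2, y2)" "(x2, y2) \<in> cbox (x1, y1) (x2, y2)" using q' by auto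
  ultimately have "(x1, y1) \<in> cbox (a1, b1) (a2, b2)" "(x2, y2) \<in> cbox (a1, b1) (a2, b2)" by blast+
  then show "a1 \<le> x1 \<and> x1 < x2 \<and> x2 \<le> a2 \<and> b1 \<le> y1 \<and> y1 < y2 \<and> y2 \<le> b2" using q' by auto
next
  fix x y assume "a1 \<le> x" "x \<le> a2" "b1 \<le> y" "y \<le> b2"
  then have "(x, y) \<in> region S" unfolding region by simp
  then obtain c where "c \<in> S" "(x, y) \<in> c" by blast
  moreover then obtain x1 x2 y1 y2 where "c = cbox (x1, y1) (x2, y2)" "(x1, x2, y1, y2) \<in> Q" using cellE by blast
  ultimately have "(x1, x2, y1, y2) \<in> Q \<and> x1 \<le> x \<and> x \<le> x2 \<and> y1 \<le> y \<and> y \<le> y2" by simp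
  then show "\<exists>x1 x2 y1 y2. (x1, x2, y1, y2) \<in> Q \<and> x1 \<le> x \<and> x \<le> x2 \<and> y1 \<le> y \<and> y \<le> y2" by blast
next
  fix x1 x2 y1 y2 x1' x2' y1' y2'
  assume q: "(x1, x2, y1, y2) \<in> Q" "(x1', x2', y1', y2') \<in> Q" and lt: "x1 < x2'" "x1' < x2" "y1 < y2'" "y1' < y2"
  note q' = quads_inj[OF q(1)] quads_inj[OF q(2)]
  let ?c = "cbox (x1, y1) (x2, y2)" and ?d = "cbox (x1', y1') (x2', y2')"
  have "((max x1 x1' + min x2 x2') / 2, (max y1 y1' + min y2 y2') / 2) \<in> interior ?c \<inter> interior ?d"
    using lt q' by (auto simp: mem_box_pair max_def min_def)
  then have "?c = ?d" using division_ofD(5)[OF div, of ?c ?d] q' by blast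
  then show "x1 = x1' \<and> x2 = x2' \<and> y1 = y1' \<and> y2 = y2'" using cbox_inj q' by blast
qed (use wide0 high0 in auto)

lemma skeleton_iff: "(x, y) \<in> skeleton S \<longleftrightarrow> K x y"
proof
  assume "(x, y) \<in> skeleton S"
  then obtain c where c: "c \<in> S" "(x, y) \<in> frontier c" unfolding skeleton_def by blast
  then obtain x1 x2 y1 y2 where q: "c = cbox (x1, y1) (x2, y2)" "(x1, x2, y1, y2) \<in> Q" using cellE by blast
  then show "K x y" using c(2) unfolding frame_def q mem_frontier_pair by blast
next
  assume "K x y"
  then obtain x1 x2 y1 y2 where q: "(x1, x2, y1, y2) \<in> Q" "(x, y) \<in> frontier (cbox (x1, y1) (x2, y2))"
    unfolding frame_def mem_frontier_pair by blast
  then show "(x, y) \<in> skeleton S" using quads_inj[OF q(1)] unfolding skeleton_def by blast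
qed

lemma vertices_iff: "(x, y) \<in> vertices S \<longleftrightarrow> corner Q x y"
  unfolding vertices_def corner_def quads_def by auto

lemma frontier_eq: "frontier (region S) = rim"
  unfolding region rim_def by (auto simp: mem_frontier_pair)

lemma horizontal_edges_eq: "horizontal_edges S = hedges Q"
proof -
  have *: "closed_segment p q \<subseteq> skeleton S \<and> open_segment p q \<inter> vertices S = {} \<and> p \<in> vertices S \<and> q \<in> vertices S \<longleftrightarrow>
      hedge Q x x' y" if "p = (x, y)" "q = (x', y)" "x < x'" for p q x x' y
    unfolding that(1,2) using that(3) 
    by (auto simp: open_seg_h seg_hseg hedge_def vertices_iff disjoint_iff skeleton_iff subset_iff)
  show ?thesis
  proof (intro equalityI subsetI)
    fix e assume "e \<in> horizontal_edges S"
    then obtain p q where e: "e = closed_segment p q" "p \<in> vertices S" "q \<in> vertices S" "p \<noteq> q" "snd p = snd q" 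
       "closed_segment p q \<subseteq> skeleton S" "open_segment p q \<inter> vertices S = {}" unfolding horizontal_edges_def by blast
    obtain x x' y where [simp]: "p = (x, y)" "q = (x', y)" using e(5) by (cases p; cases q) auto
    consider "x < x'" | "x' < x" using e(4) by fastforce
    then show "e \<in> hedges Q"
    proof cases
      case 1
      then have "hedge Q x x' y" using *[of p x y q x'] e by simp
      then show ?thesis using e(1) 1 unfolding hedges_def by (auto simp: seg_hseg intro: less_imp_le)
    next
      case 2
      have "hedge Q x' x y" using *[of q x' y p x] e 2 by (simp add: closed_segment_commute open_segment_commute)
      then show ?thesis using e(1) 2 unfolding hedges_def by (subst (asm) closed_segment_commute) (auto simp: seg_hseg intro: less_imp_le)
    qed
  next
    fix e assume "e \<in> hedges Q"
    then obtain s t y where e: "e = hseg s t y" "hedge Q s t y" unfolding hedges_def by blast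
    then have lt: "s < t" unfolding hedge_def by blast
    show "e \<in> horizontal_edges S" unfolding horizontal_edges_def
      using e lt *[of "(s, y)" s y "(t, y)" t]
      by (intro CollectI exI[of _ "(s, y)"] exI[of _ "(t, y)"]) (auto simp: seg_hseg)
  qed
qed

lemma vertical_edges_eq: "vertical_edges S = (`) prod.swap ` hedges (swap_quad -` Q)"
proof -
  have *: "closed_segment p q \<subseteq> skeleton S \<and> open_segment p q \<inter> vertices S = {} \<and> p \<in> vertices S \<and> q \<in> vertices S \<longleftrightarrow>
      hedge (swap_quad -` Q) y y' x" if "p = (x, y)" "q = (x, y')" "y < y'" for p q x y y'
    unfolding that(1,2) using that(3) 
    by (auto simp: open_seg_v seg_v closed_segment_eq_real_ivl hedge_def vertices_iff disjoint_iff skeleton_iff subset_iff frame_sw corner_sw)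
  show ?thesis
  proof (intro equalityI subsetI)
    fix e assume "e \<in> vertical_edges S"
    then obtain p q where e: "e = closed_segment p q" "p \<in> vertices S" "q \<in> vertices S" "p \<noteq> q" "fst p = fst q" 
       "closed_segment p q \<subseteq> skeleton S" "open_segment p q \<inter> vertices S = {}" unfolding vertical_edges_def by blast
    obtain x y y' where [simp]: "p = (x, y)" "q = (x, y')" using e(5) by (cases p; cases q) auto
    consider "y < y'" | "y' < y" using e(4) by fastforce
    then show "e \<in> (`) prod.swap ` hedges (swap_quad -` Q)"
    proof cases
      case 1
      then have "hedge (swap_quad -` Q) y y' x" using *[of p x y q y'] e by simp
      then show ?thesis using e(1) 1 unfolding hedges_def by (auto simp: seg_vseg intro: less_imp_le)
    next
      case 2
      have "hedge (swap_quad -` Q) y' y x" using *[of q x y' p y] e 2 by (simp add: closed_segment_commute open_segment_commute)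
      then show ?thesis using e(1) 2 unfolding hedges_def by (subst (asm) closed_segment_commute) (auto simp: seg_vseg intro: less_imp_le)
    qed
  next
    fix e assume "e \<in> (`) prod.swap ` hedges (swap_quad -` Q)"
    then obtain s t x where e: "e = prod.swap ` hseg s t x" "hedge (swap_quad -` Q) s t x" unfolding hedges_def by blast
    then have lt: "s < t" unfolding hedge_def by blast
    show "e \<in> vertical_edges S" unfolding vertical_edges_def
      using e lt *[of "(x, s)" x s "(x, t)" t]
      by (intro CollectI exI[of _ "(x, s)"] exI[of _ "(x, t)"]) (auto simp: seg_vseg)
  qed
qed

lemma card_hor: "corner Q x y \<Longrightarrow> card {e \<in> horizontal_edges S. (x, y) \<in> e} = of_bool (east K x y) + of_bool (west K x y)"
  "corner Q x y \<Longrightarrow> finite {e \<in> horizontal_edges S. (x, y) \<in> e}"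
  unfolding horizontal_edges_eq using card_hedges_at by auto

lemma card_ver: 
  assumes "corner Q x y" 
  shows "card {e \<in> vertical_edges S. (x, y) \<in> e} = of_bool (north K x y) + of_bool (south K x y)"
    "finite {e \<in> vertical_edges S. (x, y) \<in> e}"
proof -
  have eq: "{e \<in> vertical_edges S. (x, y) \<in> e} = (`) prod.swap ` {e \<in> hedges (swap_quad -` Q). (y, x) \<in> e}"
    unfolding vertical_edges_eq by (auto simp: image_iff) (metis swap_simp)+
  have inj: "inj_on ((`) prod.swap) A" for A :: "(real \<times> real) set set"
    by (rule inj_onI) (simp add: inj_image_eq_iff)
  have "corner (swap_quad -` Q) y x" using assms by (simp add: corner_sw)
  note * = rect_partition.card_hedges_at[OF swapped this]
  show "card {e \<in> vertical_edges S. (x, y) \<in> e} = of_bool (north K x y) + of_bool (south K x y)"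
    "finite {e \<in> vertical_edges S. (x, y) \<in> e}"
    unfolding eq card_image[OF inj] using * by (simp_all add: frame_sw)
qed

lemma edges_disjoint: "horizontal_edges S \<inter> vertical_edges S = {}"
proof -
  have "hseg s t y \<noteq> prod.swap ` hseg s' t' x" if "s < t" for s t y s' t' x
  proof
    assume "hseg s t y = prod.swap ` hseg s' t' x"
    moreover have "(s, y) \<in> hseg s t y" "(t, y) \<in> hseg s t y" using that by auto
    ultimately have "(s, y) \<in> prod.swap ` hseg s' t' x" "(t, y) \<in> prod.swap ` hseg s' t' x" by metis+
    then have "s = x" "t = x" by auto
    then show False using that by simp
  qed
  then show ?thesis unfolding horizontal_edges_eq vertical_edges_eq hedges_def hedge_def by blast
qed

lemma card_edges_at:
  assumes "corner Q x y"
  shows "card {e \<in> edges S. (x, y) \<in> e} =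
    of_bool (east K x y) + of_bool (west K x y) + of_bool (north K x y) + of_bool (south K x y)"
proof -
  have "{e \<in> edges S. (x, y) \<in> e} = {e \<in> horizontal_edges S. (x, y) \<in> e} \<union> {e \<in> vertical_edges S. (x, y) \<in> e}"
    unfolding edges_def by blast
  moreover have "{e \<in> horizontal_edges S. (x, y) \<in> e} \<inter> {e \<in> vertical_edges S. (x, y) \<in> e} = {}"
    using edges_disjoint by blast
  ultimately show ?thesis using card_hor[OF assms] card_ver[OF assms] by (simp add: card_Un_disjoint)
qed

lemma rim_corner_iff: "corner Q x y \<Longrightarrow> (x, y) \<notin> rim \<longleftrightarrow> a1 < x \<and> x < a2 \<and> b1 < y \<and> y < b2"
  unfolding rim_def using corner_dirs[of x y] dir_region K_region[of x y] by fastforce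

text \<open>The edges at a vertex correspond to the directions in which the skeleton continues.\<close>

lemma crossing_eq: "crossing_vertices S = crosses Q"
proof -
  have "(x, y) \<in> crossing_vertices S \<longleftrightarrow> (x, y) \<in> crosses Q" for x y
  proof (cases "corner Q x y")
    case True
    then have "(x, y) \<in> crossing_vertices S \<longleftrightarrow> (x, y) \<notin> rim \<and> card {e \<in> edges S. (x, y) \<in> e} = 4"
      unfolding crossing_vertices_def interior_vertices_def frontier_eq using vertices_iff by auto
    also have "\<dots> \<longleftrightarrow> (x, y) \<in> crosses Q"
      using card_edges_at[OF True] crosses_interior[of x y] rim_corner_iff[OF True] unfolding crosses_def by auto
    finally show ?thesis .
  next
    case False
    then show ?thesis using crosses_verts vertices_iff unfolding verts_def crossing_vertices_def interior_vertices_def by blast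
  qed
  then show ?thesis by auto
qed

lemma horizontal_l_edge_ends:
  "(x, y) \<in> boundary_vertices S \<union> horizontal_t_vertices S \<longleftrightarrow> hend x y"
proof (cases "corner Q x y")
  case True
  show ?thesis
  proof (cases "(x, y) \<in> rim")
    case r: True
    then show ?thesis using True vertices_iff unfolding hend_def boundary_vertices_def frontier_eq by auto
  next
    case r: False
    then have i: "a1 < x" "x < a2" "b1 < y" "y < b2" using rim_corner_iff[OF True] by auto
    have four: "(east K x y \<and> west K x y \<and> north K x y \<and> south K x y) \<or>
      (\<not> east K x y \<and> west K x y \<and> north K x y \<and> south K x y) \<or>
      (east K x y \<and> \<not> west K x y \<and> north K x y \<and> south K x y) \<or>
      (east K x y \<and> west K x y \<and> \<not> north K x y \<and> south K x y) \<or>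
      (east K x y \<and> west K x y \<and> north K x y \<and> \<not> south K x y)"
      using three_dirs[OF True i] by blast
    have "(x, y) \<in> boundary_vertices S \<union> horizontal_t_vertices S \<longleftrightarrow>
      card {e \<in> edges S. (x, y) \<in> e} = 3 \<and> card {e \<in> horizontal_edges S. (x, y) \<in> e} = 1"
      using r True vertices_iff[of x y]
      by (simp only: boundary_vertices_def frontier_eq horizontal_t_vertices_def t_vertices_def interior_vertices_def
        mem_Collect_eq Diff_iff Int_iff Un_iff simp_thms)
    also have "\<dots> \<longleftrightarrow> east K x y \<noteq> west K x y"
      unfolding card_edges_at[OF True] card_hor(1)[OF True] using four
      by (elim disjE) simp_all
    finally show ?thesis using r True unfolding hend_def by simp
  qed
next
  case False
  then show ?thesis using vertices_iff
    unfolding hend_def boundary_vertices_def horizontal_t_vertices_def t_vertices_def interior_vertices_def by auto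
qed

sublocale sw: rect_partition "swap_quad -` Q" b1 b2 a1 a2 by (rule swapped)

lemma sw_rim: "(y, x) \<in> sw.rim \<longleftrightarrow> (x, y) \<in> rim"
  unfolding rim_def sw.rim_def by auto

lemma sw_ihruns: "sw.ihruns = ivruns"
  unfolding sw.ihruns_def ivruns_def by simp

lemma vertical_l_edge_ends:
  "(x, y) \<in> boundary_vertices S \<union> vertical_t_vertices S \<longleftrightarrow> sw.hend y x"
proof (cases "corner Q x y")
  case True
  show ?thesis
  proof (cases "(x, y) \<in> rim")
    case r: True
    then show ?thesis using True vertices_iff
      unfolding sw.hend_def boundary_vertices_def frontier_eq by (auto simp: sw_rim corner_sw)
  next
    case r: False
    then have i: "a1 < x" "x < a2" "b1 < y" "y < b2" using rim_corner_iff[OF True] by auto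
    have four: "(east K x y \<and> west K x y \<and> north K x y \<and> south K x y) \<or>
      (\<not> east K x y \<and> west K x y \<and> north K x y \<and> south K x y) \<or>
      (east K x y \<and> \<not> west K x y \<and> north K x y \<and> south K x y) \<or>
      (east K x y \<and> west K x y \<and> \<not> north K x y \<and> south K x y) \<or>
      (east K x y \<and> west K x y \<and> north K x y \<and> \<not> south K x y)"
      using three_dirs[OF True i] by blast
    have "(x, y) \<in> boundary_vertices S \<union> vertical_t_vertices S \<longleftrightarrow>
      card {e \<in> edges S. (x, y) \<in> e} = 3 \<and> card {e \<in> vertical_edges S. (x, y) \<in> e} = 1"
      using r True vertices_iff[of x y]
      by (simp only: boundary_vertices_def frontier_eq vertical_t_vertices_def t_vertices_def interior_vertices_def
        mem_Collect_eq Diff_iff Int_iff Un_iff simp_thms)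
    also have "\<dots> \<longleftrightarrow> north K x y \<noteq> south K x y"
      unfolding card_edges_at[OF True] card_ver(1)[OF True] using four
      by (elim disjE) simp_all
    finally show ?thesis using r True unfolding sw.hend_def by (simp add: sw_rim corner_sw frame_sw)
  qed
next
  case False
  then show ?thesis using vertices_iff
    unfolding sw.hend_def boundary_vertices_def vertical_t_vertices_def t_vertices_def interior_vertices_def by (auto simp: corner_sw)
qed

lemma hor_interior_edges: "horizontal_edges S \<inter> interior_edges S = {e \<in> hedges Q. \<not> e \<subseteq> rim}"
  unfolding interior_edges_def edges_def frontier_eq horizontal_edges_eq by blast

lemma ver_interior_edges:
  "vertical_edges S \<inter> interior_edges S = (`) prod.swap ` {e \<in> hedges (swap_quad -` Q). \<not> e \<subseteq> sw.rim}"
proof -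
  have "prod.swap ` e \<subseteq> rim \<longleftrightarrow> e \<subseteq> sw.rim" for e
    using sw_rim by (auto simp: subset_iff)
  then show ?thesis unfolding interior_edges_def edges_def frontier_eq vertical_edges_eq by auto
qed

lemma horizontal_l_edges_eq: "horizontal_l_edges S = (\<lambda>(y, s, t). hseg s t y) ` ihruns"
proof (intro equalityI subsetI)
  fix L assume "L \<in> horizontal_l_edges S"
  then obtain p q where pq: "L = closed_segment p q" "p \<in> boundary_vertices S \<union> horizontal_t_vertices S"
    "q \<in> boundary_vertices S \<union> horizontal_t_vertices S" "p \<noteq> q" "snd p = snd q"
    "\<exists>F \<subseteq> horizontal_edges S \<inter> interior_edges S. closed_segment p q = \<Union>F" unfolding horizontal_l_edges_def by blast
  obtain x x' y where [simp]: "p = (x, y)" "q = (x', y)" using pq(5) by (cases p; cases q) auto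
  define s where "s = min x x'"
  define t where "t = max x x'"
  have st: "s < t" "closed_segment p q = hseg s t y"
    using pq(4) seg_hseg[of x x' y] seg_hseg[of x' x y] closed_segment_commute[of p q]
    by (cases "x \<le> x'"; simp add: s_def t_def)+
  have "hend s y" "hend t y" using pq(2,3) horizontal_l_edge_ends unfolding s_def t_def min_def max_def by auto
  then have "(y, s, t) \<in> ihruns" using ihruns_iff[OF st(1), of y] pq(6) unfolding hor_interior_edges st(2) by blast
  then show "L \<in> (\<lambda>(y, s, t). hseg s t y) ` ihruns" using pq(1) st(2) by (intro image_eqI[of _ _ "(y, s, t)"]) auto
next
  fix L assume "L \<in> (\<lambda>(y, s, t). hseg s t y) ` ihruns"
  then obtain y s t where L: "L = hseg s t y" "(y, s, t) \<in> ihruns" by auto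
  then have st: "s < t" unfolding ihruns_def hruns_def by auto
  have eq: "closed_segment (s, y) (t, y) = hseg s t y" using st by (simp add: seg_hseg)
  show "L \<in> horizontal_l_edges S"
    unfolding horizontal_l_edges_def hor_interior_edges
  proof (rule CollectI, rule exI[of _ "(s, y)"], rule exI[of _ "(t, y)"], intro conjI)
    have *: "hend s y \<and> hend t y \<and> (\<exists>F \<subseteq> {e \<in> hedges Q. \<not> e \<subseteq> rim}. hseg s t y = \<Union>F)"
      using ihruns_iff[OF st, of y] L(2) by blast
    show "(s, y) \<in> boundary_vertices S \<union> horizontal_t_vertices S" "(t, y) \<in> boundary_vertices S \<union> horizontal_t_vertices S"
      unfolding horizontal_l_edge_ends using * by blast+
    show "\<exists>F \<subseteq> {e \<in> hedges Q. \<not> e \<subseteq> rim}. closed_segment (s, y) (t, y) = \<Union>F" unfolding eq using * by blast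
  qed (use L(1) eq st in simp_all)
qed

lemma vertical_l_edges_eq: "vertical_l_edges S = (\<lambda>(x, s, t). prod.swap ` hseg s t x) ` ivruns"
proof -
  have U: "(\<exists>F \<subseteq> vertical_edges S \<inter> interior_edges S. prod.swap ` A = \<Union>F) \<longleftrightarrow>
    (\<exists>F \<subseteq> {e \<in> hedges (swap_quad -` Q). \<not> e \<subseteq> sw.rim}. A = \<Union>F)" for A :: "(real \<times> real) set"
    unfolding ver_interior_edges by (rule swap_Union_iff)
  show ?thesis
  proof (intro equalityI subsetI)
    fix L assume "L \<in> vertical_l_edges S"
    then obtain p q where pq: "L = closed_segment p q" "p \<in> boundary_vertices S \<union> vertical_t_vertices S"
      "q \<in> boundary_vertices S \<union> vertical_t_vertices S" "p \<noteq> q" "fst p = fst q"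
      "\<exists>F \<subseteq> vertical_edges S \<inter> interior_edges S. closed_segment p q = \<Union>F" unfolding vertical_l_edges_def by blast
    obtain x y y' where [simp]: "p = (x, y)" "q = (x, y')" using pq(5) by (cases p; cases q) auto
    define s where "s = min y y'"
    define t where "t = max y y'"
    have st: "s < t" "closed_segment p q = prod.swap ` hseg s t x"
      using pq(4) seg_vseg[of y y' x] seg_vseg[of y' y x] closed_segment_commute[of p q]
      by (cases "y \<le> y'"; simp add: s_def t_def)+
    have "sw.hend s x" "sw.hend t x" using pq(2,3) vertical_l_edge_ends unfolding s_def t_def min_def max_def by auto
    then have "(x, s, t) \<in> ivruns" using sw.ihruns_iff[OF st(1), of x] pq(6) unfolding st(2) U sw_ihruns by blast
    then show "L \<in> (\<lambda>(x, s, t). prod.swap ` hseg s t x) ` ivruns" using pq(1) st(2) by (intro image_eqI[of _ _ "(x, s, t)"]) auto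
  next
    fix L assume "L \<in> (\<lambda>(x, s, t). prod.swap ` hseg s t x) ` ivruns"
    then obtain x s t where L: "L = prod.swap ` hseg s t x" "(x, s, t) \<in> ivruns" by auto
    then have st: "s < t" using sw.hrunsD(1) unfolding ivruns_def by fastforce
    have eq: "closed_segment (x, s) (x, t) = prod.swap ` hseg s t x" using st by (simp add: seg_vseg)
    have "sw.hend s x \<and> sw.hend t x \<and> (\<exists>F \<subseteq> vertical_edges S \<inter> interior_edges S. closed_segment (x, s) (x, t) = \<Union>F)"
      using sw.ihruns_iff[OF st, of x] L(2) unfolding eq U sw_ihruns by blast
    then show "L \<in> vertical_l_edges S"
      unfolding vertical_l_edges_def vertical_l_edge_ends[symmetric] using L(1) st eq
      by (intro CollectI exI[of _ "(x, s)"] exI[of _ "(x, t)"] conjI) (simp_all only: fst_conv prod.inject less_irrefl not_False_eq_True simp_thms)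
  qed
qed

lemma card_interior_l_edges: "card (interior_l_edges S) = card ihruns + card ivruns"
proof -
  have fn: "finite ihruns" unfolding ihruns_def by (rule finite_subset[OF _ finite_hruns]) auto
  have fn': "finite ivruns" unfolding sw_ihruns[symmetric] sw.ihruns_def by (rule finite_subset[OF _ sw.finite_hruns]) auto
  have lt: "s < t" if "(y, s, t) \<in> ihruns \<or> (y, s, t) \<in> ivruns" for y s t
    using that hrunsD(1) sw.hrunsD(1) unfolding ihruns_def ivruns_def by fastforce
  have i: "inj_on (\<lambda>(y, s, t). hseg s t y) ihruns"
  proof (rule inj_onI)
    fix r r' assume *: "r \<in> ihruns" "(\<lambda>(y, s, t). hseg s t y) r = (\<lambda>(y, s, t). hseg s t y) r'"
    obtain y s t y' s' t' where r: "r = (y, s, t)" "r' = (y', s', t')" by (metis surj_pair)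
    then show "r = r'" using * lt[of y s t] hseg_eq_iff[of s t y s' t' y'] by simp
  qed
  have i': "inj_on (\<lambda>(x, s, t). prod.swap ` hseg s t x) ivruns"
  proof (rule inj_onI)
    fix r r' assume *: "r \<in> ivruns"
      "(\<lambda>(y, s, t). prod.swap ` hseg s t y) r = (\<lambda>(y, s, t). prod.swap ` hseg s t y) r'"
    obtain y s t y' s' t' where r: "r = (y, s, t)" "r' = (y', s', t')" by (metis surj_pair)
    then have "hseg s t y = hseg s' t' y'" using * by (simp add: inj_image_eq_iff)
    then show "r = r'" using * lt[of y s t] hseg_eq_iff[of s t y s' t' y'] r by simp
  qed
  have ne: "hseg s t y \<noteq> prod.swap ` hseg s' t' x" if "s < t" for s t y s' t' x
  proof
    assume "hseg s t y = prod.swap ` hseg s' t' x"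
    moreover have "(s, y) \<in> hseg s t y" "(t, y) \<in> hseg s t y" using that by auto
    ultimately have "(s, y) \<in> prod.swap ` hseg s' t' x" "(t, y) \<in> prod.swap ` hseg s' t' x" by metis+
    then have "s = x" "t = x" by auto
    then show False using that by simp
  qed
  have "((\<lambda>(y, s, t). hseg s t y) ` ihruns) \<inter> ((\<lambda>(x, s, t). prod.swap ` hseg s t x) ` ivruns) = {}"
  proof (rule equals0I)
    fix L assume "L \<in> ((\<lambda>(y, s, t). hseg s t y) ` ihruns) \<inter> ((\<lambda>(x, s, t). prod.swap ` hseg s t x) ` ivruns)"
    then obtain y s t x s' t' where L: "(y, s, t) \<in> ihruns" "L = hseg s t y" "L = prod.swap ` hseg s' t' x" by auto
    have "s < t" using lt L(1) by blast
    from ne[OF this, of y s' t' x] L(2,3) show False by simp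
  qed
  then show ?thesis unfolding interior_l_edges_def horizontal_l_edges_eq vertical_l_edges_eq
    using fn fn' by (simp add: card_Un_disjoint card_image[OF i] card_image[OF i'])
qed

end

lemma rect_meshI:
  assumes "t_mesh S" "S \<noteq> {}" "region S = cbox (a1, b1) (a2, b2)" shows "rect_mesh S a1 a2 b1 b2"
proof -
  obtain c where "c \<in> S" using assms(2) by blast
  then have "interior c \<noteq> {}" "c \<subseteq> cbox (a1, b1) (a2, b2)" using assms unfolding t_mesh_def by auto
  then have "box (a1, b1) (a2, b2) \<noteq> {}" using interior_mono[of c "cbox (a1, b1) (a2, b2)"] by auto
  then obtain x y where "(x, y) \<in> box (a1, b1) (a2, b2)" by auto
  then have "a1 < a2" "b1 < b2" unfolding mem_box_pair by auto
  then show ?thesis using assms by unfold_locales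
qed

section \<open>Splines from vertex coefficients\<close>


fun onrun :: "real \<times> real \<times> real \<Rightarrow> real \<Rightarrow> real \<Rightarrow> bool"
  where "onrun (z, s, t) x y \<longleftrightarrow> y = z \<and> s \<le> x \<and> x \<le> t"

definition hker :: "quad set \<Rightarrow> (real \<times> real \<Rightarrow> real) \<Rightarrow> bool"
  where "hker Q c \<longleftrightarrow> (\<forall>\<rho>\<in>hruns Q. \<forall>r\<le>2. (\<Sum>v\<in>verts Q. of_bool (onrun \<rho> (fst v) (snd v)) * fst v ^ r * c v) = 0)"

text \<open>For \<open>X = x\<close> and \<open>Y = y\<close> this is the value at \<open>(x, y)\<close> of the sum of truncated squares; for fixed
\<open>x\<close>, \<open>y\<close> it is a biquadratic polynomial in \<open>X\<close> and \<open>Y\<close>. Separating the two roles allows moving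
the point while keeping the polynomial.\<close>

definition trunc :: "quad set \<Rightarrow> (real \<times> real \<Rightarrow> real) \<Rightarrow> real \<Rightarrow> real \<Rightarrow> real \<Rightarrow> real \<Rightarrow> real"
  where "trunc Q c x y X Y = (\<Sum>v\<in>verts Q. of_bool (fst v < x \<and> snd v < y) * (c v * (X - fst v)\<^sup>2 * (Y - snd v)\<^sup>2))"

lemma verts_sw: "verts (swap_quad -` Q) = prod.swap ` verts Q"
  unfolding verts_def by (auto simp: corner_sw)

lemma sum_verts_sw: "(\<Sum>v\<in>verts (swap_quad -` Q). F v) = (\<Sum>v\<in>verts Q. F (prod.swap v))"
  unfolding verts_sw by (subst sum.reindex) (auto simp: inj_on_def)

lemma trunc_sw: "trunc (swap_quad -` Q) (c \<circ> prod.swap) x y X Y = trunc Q c y x Y X"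
  unfolding trunc_def sum_verts_sw by (rule sum.cong) (auto simp: mult_ac)

context rect_partition
begin

lemma unique_run:
  assumes "v \<in> verts Q" "\<rho> \<in> hruns Q" "onrun \<rho> (fst v) (snd v)" "\<rho>' \<in> hruns Q" 
  shows "onrun \<rho>' (fst v) (snd v) \<longleftrightarrow> \<rho>' = \<rho>"
proof -
  obtain y s t y' s' t' where r: "\<rho> = (y, s, t)" "\<rho>' = (y', s', t')" by (metis surj_pair)
  show ?thesis using assms run_unique[of y s t s' t' "fst v"] unfolding r by auto
qed

lemma vert_run: "v \<in> verts Q \<Longrightarrow> \<exists>\<rho>\<in>hruns Q. onrun \<rho> (fst v) (snd v)"
proof -
  assume "v \<in> verts Q"
  then have "corner Q (fst v) (snd v)" unfolding verts_def by auto
  then obtain s t where "(snd v, s, t) \<in> hruns Q" "s \<le> fst v" "fst v \<le> t" using run_through[of "fst v" "snd v"] corner_dirs(1) by blast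
  then show ?thesis by (intro bexI[of _ "(snd v, s, t)"]) auto
qed

lemma sum_over_runs:
  "(\<Sum>v\<in>verts Q. F v) = (\<Sum>\<rho>\<in>hruns Q. \<Sum>v\<in>verts Q. of_bool (onrun \<rho> (fst v) (snd v)) * (F v :: real))"
proof -
  have "(\<Sum>\<rho>\<in>hruns Q. of_bool (onrun \<rho> (fst v) (snd v)) * F v) = F v" if v: "v \<in> verts Q" for v
  proof -
    obtain \<rho> where \<rho>: "\<rho> \<in> hruns Q" "onrun \<rho> (fst v) (snd v)" using vert_run[OF v] by blast
    have "(\<Sum>\<rho>'\<in>hruns Q. of_bool (onrun \<rho>' (fst v) (snd v)) * F v) = (\<Sum>\<rho>'\<in>hruns Q. if \<rho>' = \<rho> then F v else 0)"
      by (rule sum.cong) (use unique_run[OF v \<rho>] in auto)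
    then show ?thesis using \<rho>(1) finite_hruns by simp
  qed
  then have "(\<Sum>v\<in>verts Q. F v) = (\<Sum>v\<in>verts Q. \<Sum>\<rho>\<in>hruns Q. of_bool (onrun \<rho> (fst v) (snd v)) * F v)" by simp
  also have "\<dots> = (\<Sum>\<rho>\<in>hruns Q. \<Sum>v\<in>verts Q. of_bool (onrun \<rho> (fst v) (snd v)) * F v)" by (rule sum.swap)
  finally show ?thesis .
qed

lemma moment_square:
  assumes "hker Q c" "\<rho> \<in> hruns Q"
  shows "(\<Sum>v\<in>verts Q. of_bool (onrun \<rho> (fst v) (snd v)) * (c v * (X - fst v)\<^sup>2)) = 0"
proof -
  let ?m = "\<lambda>r. \<Sum>v\<in>verts Q. of_bool (onrun \<rho> (fst v) (snd v)) * fst v ^ r * c v"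
  have "(\<Sum>v\<in>verts Q. of_bool (onrun \<rho> (fst v) (snd v)) * (c v * (X - fst v)\<^sup>2)) = X\<^sup>2 * ?m 0 - 2 * X * ?m 1 + ?m 2"
    unfolding sum_distrib_left sum_subtractf[symmetric] sum.distrib[symmetric]
    by (rule sum.cong) (simp_all add: power2_diff algebra_simps)
  moreover have "?m r = 0" if "r \<le> 2" for r using assms that unfolding hker_def by blast
  from this[of 0] this[of 1] this[of 2] have "?m 0 = 0" "?m 1 = 0" "?m 2 = 0" by simp_all
  ultimately show ?thesis by simp
qed

text \<open>Grouped by runs, the vertices to the left of \<open>x\<close> in a horizontal band contribute nothing. A run in
the band does not contain the abscissa \<open>x\<close>, since the vertical segment at \<open>x\<close> misses the skeleton.
So it lies to the right of \<open>x\<close> and is not counted, or to the left and is counted as a whole, and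
then its contribution is a combination of vanishing moments.\<close>

lemma band_sum:
  assumes "hker Q c" "\<And>z. l \<le> z \<Longrightarrow> z < u \<Longrightarrow> \<not> K x z"
  shows "(\<Sum>v\<in>verts Q. of_bool (fst v < x \<and> l \<le> snd v \<and> snd v < u) * (c v * (X - fst v)\<^sup>2 * (Y - snd v)\<^sup>2)) = 0"
proof -
  have "(\<Sum>v\<in>verts Q. of_bool (onrun \<rho> (fst v) (snd v)) *
      (of_bool (fst v < x \<and> l \<le> snd v \<and> snd v < u) * (c v * (X - fst v)\<^sup>2 * (Y - snd v)\<^sup>2))) = 0"
    if \<rho>': "\<rho> \<in> hruns Q" for \<rho>
  proof -
    obtain y s t where r: "\<rho> = (y, s, t)" by (metis surj_pair)
    note \<rho> = \<rho>'[unfolded r]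
    consider "\<not> (l \<le> y \<and> y < u)" | "l \<le> y" "y < u" "x < s" | "l \<le> y" "y < u" "t < x"
      using hrunsD(2)[OF \<rho>, of x] assms(2)[of y] by (meson not_le)
    then show ?thesis
    proof cases
      case 3
      have "(\<Sum>v\<in>verts Q. of_bool (onrun \<rho> (fst v) (snd v)) *
        (of_bool (fst v < x \<and> l \<le> snd v \<and> snd v < u) * (c v * (X - fst v)\<^sup>2 * (Y - snd v)\<^sup>2))) =
        (Y - y)\<^sup>2 * (\<Sum>v\<in>verts Q. of_bool (onrun \<rho> (fst v) (snd v)) * (c v * (X - fst v)\<^sup>2))"
        unfolding sum_distrib_left by (rule sum.cong) (use 3 in \<open>auto simp: r\<close>)
      then show ?thesis using moment_square[OF assms(1) \<rho>'] by simp
    qed (auto simp: r intro!: sum.neutral)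
  qed
  then show ?thesis by (subst sum_over_runs) (simp add: sum.neutral)
qed

lemma trunc_move_y_le:
  assumes "hker Q c" "y \<le> y'" "\<And>z. y \<le> z \<Longrightarrow> z < y' \<Longrightarrow> \<not> K x z"
  shows "trunc Q c x y X Y = trunc Q c x y' X Y"
proof -
  have "trunc Q c x y' X Y = trunc Q c x y X Y +
     (\<Sum>v\<in>verts Q. of_bool (fst v < x \<and> y \<le> snd v \<and> snd v < y') * (c v * (X - fst v)\<^sup>2 * (Y - snd v)\<^sup>2))"
    unfolding trunc_def sum.distrib[symmetric] by (rule sum.cong) (use assms(2) in \<open>auto simp: of_bool_def\<close>)
  then show ?thesis using band_sum[OF assms(1,3), where X = X and Y = Y] by simp
qed

lemma trunc_move_y:
  assumes "hker Q c" "\<And>z. min y y' \<le> z \<Longrightarrow> z < max y y' \<Longrightarrow> \<not> K x z"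
  shows "trunc Q c x y X Y = trunc Q c x y' X Y"
proof (cases "y \<le> y'")
  case True then show ?thesis using trunc_move_y_le[OF assms(1) True] assms(2) by auto
next
  case False then show ?thesis using trunc_move_y_le[OF assms(1), of y' y x X Y] assms(2) by auto
qed

lemma trunc_move_x:
  assumes "hker (swap_quad -` Q) (c \<circ> prod.swap)" "\<And>z. min x x' \<le> z \<Longrightarrow> z < max x x' \<Longrightarrow> \<not> K z y"
  shows "trunc Q c x y X Y = trunc Q c x' y X Y"
  using rect_partition.trunc_move_y[OF swapped assms(1), of x x' y Y X] assms(2)
  unfolding trunc_sw by (simp add: frame_sw)

text \<open>The property of splines from which the vertex coefficients are computed, in a form that is visibly
invariant under exchanging the axes.\<close>

definition spl :: "(real \<times> real \<Rightarrow> real) \<Rightarrow> bool"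
  where "spl f \<longleftrightarrow> (\<forall>x y. \<exists>D. ((\<lambda>t. f (t, y)) has_real_derivative D) (at x)) \<and>
    (\<forall>x y. \<exists>D. ((\<lambda>t. f (x, t)) has_real_derivative D) (at y)) \<and>
    (\<forall>x1 x2 y1 y2. (x1, x2, y1, y2) \<in> Q \<longrightarrow> biquadratic_on (cbox (x1, y1) (x2, y2)) f) \<and>
    (\<forall>x y. \<not> (a1 \<le> x \<and> x \<le> a2 \<and> b1 \<le> y \<and> y \<le> b2) \<longrightarrow> f (x, y) = 0)"

end

definition spline_of :: "quad set \<Rightarrow> (real \<times> real \<Rightarrow> real) \<Rightarrow> (real \<times> real \<Rightarrow> real)"
  where "spline_of Q c = (\<lambda>p. \<Sum>v\<in>verts Q. c v * (tsq (fst p - fst v) * tsq (snd p - snd v)))"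

lemma spline_of_trunc: "spline_of Q c (x, y) = trunc Q c x y x y"
  unfolding spline_of_def trunc_def by (rule sum.cong) (auto simp: tsq_def max_def of_bool_def)

lemma continuous_tsq: "continuous_on A tsq" unfolding tsq_def by (intro continuous_intros)

lemma continuous_tsq_comp [continuous_intros]: "continuous_on A g \<Longrightarrow> continuous_on A (\<lambda>x. tsq (g x))"
  using continuous_on_compose2[OF continuous_tsq[of UNIV], of A g] by simp

lemma C11_spline_of: "C11 (spline_of Q c)"
  unfolding C11_def
proof (intro conjI exI allI)
  show "continuous_on UNIV (spline_of Q c)" unfolding spline_of_def by (intro continuous_intros)
  let ?fx = "\<lambda>p. \<Sum>v\<in>verts Q. c v * (2 * max 0 (fst p - fst v) * tsq (snd p - snd v))"
  let ?fy = "\<lambda>p. \<Sum>v\<in>verts Q. c v * (tsq (fst p - fst v) * (2 * max 0 (snd p - snd v)))"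
  show "continuous_on UNIV ?fx" "continuous_on UNIV ?fy" by (intro continuous_intros)+
  fix x y
  show "((\<lambda>t. spline_of Q c (t, y)) has_real_derivative ?fx (x, y)) (at x)"
    unfolding spline_of_def fst_conv snd_conv
    by (intro DERIV_sum DERIV_cmult DERIV_cmult_right tsq_shift_deriv)
  show "((\<lambda>t. spline_of Q c (x, t)) has_real_derivative ?fy (x, y)) (at y)"
    unfolding spline_of_def fst_conv snd_conv
    by (intro DERIV_sum DERIV_cmult tsq_shift_deriv)
qed

lemma trunc_biquadratic: "\<exists>a. \<forall>X Y. trunc Q c x y X Y = (\<Sum>i\<le>2. \<Sum>j\<le>2. a i j * X ^ i * Y ^ j)"
proof -
  define \<alpha> :: "real \<Rightarrow> nat \<Rightarrow> real" where "\<alpha> s i = (if i = 0 then s\<^sup>2 else if i = 1 then - 2 * s else 1)" for s i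
  have sq: "(X - s)\<^sup>2 = (\<Sum>i\<le>2. \<alpha> s i * X ^ i)" for X s
    by (simp add: \<alpha>_def numeral_2_eq_2 algebra_simps)
  define k where "k v = of_bool (fst v < x \<and> snd v < y) * c v" for v
  have "trunc Q c x y X Y = (\<Sum>i\<le>2. \<Sum>j\<le>2. (\<Sum>v\<in>verts Q. k v * \<alpha> (fst v) i * \<alpha> (snd v) j) * X ^ i * Y ^ j)" for X Y
  proof -
    have "trunc Q c x y X Y = (\<Sum>v\<in>verts Q. k v * ((\<Sum>i\<le>2. \<alpha> (fst v) i * X ^ i) * (\<Sum>j\<le>2. \<alpha> (snd v) j * Y ^ j)))"
      unfolding trunc_def k_def sq by (simp add: mult.assoc)
    also have "\<dots> = (\<Sum>v\<in>verts Q. \<Sum>i\<le>2. \<Sum>j\<le>2. k v * \<alpha> (fst v) i * \<alpha> (snd v) j * X ^ i * Y ^ j)"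
      by (simp only: sum_product) (simp only: sum_distrib_left mult_ac)
    also have "\<dots> = (\<Sum>i\<le>2. \<Sum>v\<in>verts Q. \<Sum>j\<le>2. k v * \<alpha> (fst v) i * \<alpha> (snd v) j * X ^ i * Y ^ j)"
      by (rule sum.swap)
    also have "\<dots> = (\<Sum>i\<le>2. \<Sum>j\<le>2. \<Sum>v\<in>verts Q. k v * \<alpha> (fst v) i * \<alpha> (snd v) j * X ^ i * Y ^ j)"
      by (rule sum.cong[OF refl], rule sum.swap)
    finally show ?thesis by (simp add: sum_distrib_right)
  qed
  then show ?thesis by (intro exI[of _ "\<lambda>i j. \<Sum>v\<in>verts Q. k v * \<alpha> (fst v) i * \<alpha> (snd v) j"]) blast
qed

context rect_partition
begin

text \<open>Inside a cell the point can be moved first vertically and then horizontally without meeting the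
skeleton, and this does not change the polynomial.\<close>

lemma spline_of_biquadratic:
  assumes "hker Q c" "hker (swap_quad -` Q) (c \<circ> prod.swap)" and q: "(x1, x2, y1, y2) \<in> Q"
  shows "biquadratic_on (cbox (x1, y1) (x2, y2)) (spline_of Q c)"
proof -
  have lt: "x1 < x2" "y1 < y2" using cell[OF q] by auto
  define x0 where "x0 = (x1 + x2) / 2"
  define y0 where "y0 = (y1 + y2) / 2"
  have i: "x1 < x0" "x0 < x2" "y1 < y0" "y0 < y2" unfolding x0_def y0_def using lt by auto
  obtain a where a: "\<And>X Y. trunc Q c x0 y0 X Y = (\<Sum>i\<le>2. \<Sum>j\<le>2. a i j * X ^ i * Y ^ j)"
    using trunc_biquadratic[of Q c x0 y0] by (elim exE) simp
  let ?P = "\<lambda>p. \<Sum>i\<le>2. \<Sum>j\<le>2. a i j * fst p ^ i * snd p ^ j"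
  have eq: "spline_of Q c p = ?P p" if p': "p \<in> box (x1, y1) (x2, y2)" for p
  proof -
    obtain x y where p: "p = (x, y)" by (cases p)
    then have xy: "x1 < x" "x < x2" "y1 < y" "y < y2" using p' by (auto simp: mem_box_pair)
    have "trunc Q c x y x y = trunc Q c x y0 x y"
      by (rule trunc_move_y[OF assms(1)]) (rule inside_not_K[OF q], use xy i in auto)
    also have "\<dots> = trunc Q c x0 y0 x y"
      by (rule trunc_move_x[OF assms(2)]) (rule inside_not_K[OF q], use xy i in auto)
    finally show ?thesis unfolding p spline_of_trunc a by simp
  qed
  have cl: "closed {p. spline_of Q c p = ?P p}"
    by (intro closed_Collect_eq continuous_intros) (use C11_spline_of in \<open>simp add: C11_def\<close>)
  have "box (x1, y1) (x2, y2) \<noteq> {}" using i mem_box_pair[of x0 y0 x1 y1 x2 y2] by blast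
  then have "closure (box (x1, y1) (x2, y2)) = cbox (x1, y1) (x2, y2)" by (rule closure_box)
  then have "cbox (x1, y1) (x2, y2) \<subseteq> {p. spline_of Q c p = ?P p}"
    using closure_minimal[OF _ cl, of "box (x1, y1) (x2, y2)"] eq by blast
  then show ?thesis unfolding biquadratic_on_def by (intro exI[of _ a]) force
qed

lemma verts_region: "v \<in> verts Q \<Longrightarrow> a1 \<le> fst v \<and> fst v \<le> a2 \<and> b1 \<le> snd v \<and> snd v \<le> b2"
  unfolding verts_def using corner_dirs(1) dir_region K_region by (metis (mono_tags, lifting) case_prod_beta mem_Collect_eq)

lemma trunc_low: "x \<le> a1 \<or> y \<le> b1 \<Longrightarrow> trunc Q c x y X Y = 0"
  unfolding trunc_def by (rule sum.neutral) (use verts_region in fastforce)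

text \<open>To the right of the rectangle all vertical segments miss the skeleton, so the point can be moved
down below all vertices, where the sum is empty; similarly above the rectangle.\<close>

lemma spline_of_outside:
  assumes "hker Q c" "hker (swap_quad -` Q) (c \<circ> prod.swap)" "\<not> (a1 \<le> x \<and> x \<le> a2 \<and> b1 \<le> y \<and> y \<le> b2)"
  shows "spline_of Q c (x, y) = 0"
proof -
  consider "x \<le> a1 \<or> y \<le> b1" | "a2 < x" "b1 < y" | "b2 < y" "a1 < x" using assms(3) by linarith
  then show ?thesis
  proof cases
    case 1 then show ?thesis unfolding spline_of_trunc by (rule trunc_low)
  next
    case 2
    have "trunc Q c x y x y = trunc Q c x b1 x y"
      by (rule trunc_move_y[OF assms(1)]) (use 2 K_region in fastforce)
    then show ?thesis unfolding spline_of_trunc using trunc_low[of x b1] by simp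
  next
    case 3
    have "trunc Q c x y x y = trunc Q c a1 y x y"
      by (rule trunc_move_x[OF assms(2)]) (use 3 K_region in fastforce)
    then show ?thesis unfolding spline_of_trunc using trunc_low[of a1 y] by simp
  qed
qed

end

section \<open>Vertex coefficients of a given spline\<close>

lemma quad_on_lin: "quad_on A g \<Longrightarrow> quad_on A h \<Longrightarrow> quad_on A (\<lambda>t. k * g t + l * h t)"
  using quad_on_diff[OF quad_on_cmult[of A g k] quad_on_cmult[of A h "- l"]] by simp

lemma pwq_lin: 
  assumes "pwq X g" "pwq X h" shows "pwq X (\<lambda>t. k * g t + l * h t)"
  unfolding pwq_def
proof (intro conjI allI impI)
  fix t
  obtain D E where "(g has_real_derivative D) (at t)" "(h has_real_derivative E) (at t)" using assms unfolding pwq_def by blast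
  then have "((\<lambda>t. k * g t + l * h t) has_real_derivative k * D + l * E) (at t)" by (intro DERIV_add DERIV_cmult)
  then show "\<exists>D. ((\<lambda>t. k * g t + l * h t) has_real_derivative D) (at t)" ..
next
  fix a b :: real assume "a < b" "X \<inter> {a<..<b} = {}"
  then show "quad_on {a..b} (\<lambda>t. k * g t + l * h t)" using assms unfolding pwq_def by (intro quad_on_lin) blast+
qed

lemma pwq_jump:
  assumes "\<And>x. pwq X (\<lambda>y. f x y)" shows "pwq X (\<lambda>y. jump h s (\<lambda>x. f x y))"
proof -
  have "pwq X (\<lambda>y. (1 / (2 * h\<^sup>2)) * (1 * (1 * f (s + 2 * h) y + (-2) * f (s + h) y) + 1 * (2 * f (s - h) y + (-1) * f (s - 2 * h) y)) + 0 * f s y)"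
    by (intro pwq_lin assms)
  then show ?thesis unfolding jump_def by (simp add: algebra_simps add_divide_distrib diff_divide_distrib)
qed

lemma jump_commute: "jump h t (\<lambda>y. jump h s (\<lambda>x. f x y)) = jump h s (\<lambda>x. jump h t (\<lambda>y. f x y))"
  unfolding jump_def by (simp add: divide_simps algebra_simps)

lemma jump_zero:
  assumes "\<And>x. s < x \<Longrightarrow> x \<le> s + 2 * h \<Longrightarrow> g x = 0" "\<And>x. s - 2 * h \<le> x \<Longrightarrow> x < s \<Longrightarrow> g x = 0" "h > 0"
  shows "jump h s g = 0"
  unfolding jump_def using assms(3) assms(1)[of "s + 2 * h"] assms(1)[of "s + h"] assms(2)[of "s - h"] assms(2)[of "s - 2 * h"] by simp

lemma finite_separated:
  assumes "finite (X :: real set)" 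
  shows "\<exists>h>0. \<forall>s\<in>X. \<forall>u\<in>X. s \<noteq> u \<longrightarrow> 3 * h \<le> \<bar>s - u\<bar>"
proof -
  let ?D = "insert 1 ((\<lambda>(s, u). \<bar>s - u\<bar>) ` {(s, u) \<in> X \<times> X. s \<noteq> u})"
  have fin: "finite ?D" by (intro finite.insertI finite_imageI finite_subset[OF _ finite_cartesian_product[OF assms assms]]) auto
  have pos: "Min ?D > 0" using fin by (subst Min_gr_iff) auto
  show ?thesis
  proof (intro exI[of _ "Min ?D / 3"] conjI ballI impI)
    fix s u assume "s \<in> X" "u \<in> X" "s \<noteq> u"
    then have "\<bar>s - u\<bar> \<in> ?D" by force
    then show "3 * (Min ?D / 3) \<le> \<bar>s - u\<bar>" using Min_le[OF fin] by simp
  qed (use pos in simp)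
qed

text \<open>The sum is a quadratic in \<open>x\<close> whose coefficients are, up to constants, the three moments.\<close>

lemma moments_vanish:
  assumes "finite V" "l < u" "\<And>x. l < x \<Longrightarrow> x < u \<Longrightarrow> (\<Sum>v\<in>V. c v * (x - v)\<^sup>2) = (0 :: real)" "r \<le> 2"
  shows "(\<Sum>v\<in>V. v ^ r * c v) = 0"
proof -
  let ?m = "\<lambda>r. \<Sum>v\<in>V. v ^ r * c v"
  have e: "(\<Sum>v\<in>V. c v * (x - v)\<^sup>2) = ?m 2 + (- 2 * ?m 1) * x + ?m 0 * x\<^sup>2" for x
    unfolding sum_distrib_left sum_distrib_right sum.distrib[symmetric]
    by (rule sum.cong) (simp_all add: power2_diff algebra_simps)
  \<comment> \<open>three interior points of the interval\<close>
  define d where "d = (u - l) / 4"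
  have d: "d > 0" "u = l + 4 * d" unfolding d_def using assms(2) by (simp_all add: field_simps)
  have "?m 2 = 0 \<and> - 2 * ?m 1 = 0 \<and> ?m 0 = 0"
  proof (rule quad_coeffs_zero[of "l + d" "l + 2 * d" "l + 3 * d"])
    fix t assume "t \<in> {l + d, l + 2 * d, l + 3 * d}"
    then have "l < t" "t < u" using d by auto
    then show "?m 2 + - 2 * ?m 1 * t + ?m 0 * t\<^sup>2 = 0" using e[of t] assms(3)[of t] by simp
  qed (use d in auto)
  then have m: "?m 2 = 0" "?m 1 = 0" "?m 0 = 0" by simp_all
  have "r = 0 \<or> r = 1 \<or> r = 2" using assms(4) by auto
  then show ?thesis using m by (elim disjE) (simp_all only:)
qed

lemma zero_at_end:
  fixes g :: "real \<Rightarrow> real"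
  assumes "\<And>t. \<exists>D. (g has_real_derivative D) (at t)" "(\<forall>t<a. g t = 0) \<or> (\<forall>t>a. g t = 0)"
  shows "g a = 0"
proof -
  have "continuous_on UNIV g" using assms(1) by (meson DERIV_isCont continuous_at_imp_continuous_on)
  then have "closed {t. g t = 0}" by (intro closed_Collect_eq continuous_intros)
  then have "A \<subseteq> {t. g t = 0} \<Longrightarrow> closure A \<subseteq> {t. g t = 0}" for A by (rule closure_minimal[rotated])
  from this[of "{..<a}"] this[of "{a<..}"] show ?thesis using assms(2) by auto
qed

context rect_partition
begin

lemma spl_swap: "spl f \<Longrightarrow> rect_partition.spl (swap_quad -` Q) b1 b2 a1 a2 (f \<circ> prod.swap)"
proof -
  assume f: "spl f"
  have "biquadratic_on (cbox (x1, y1) (x2, y2)) (f \<circ> prod.swap)" if "(y1, y2, x1, x2) \<in> Q" for x1 x2 y1 y2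
  proof -
    have "biquadratic_on (cbox (y1, x1) (y2, x2)) f" using f that unfolding spl_def by blast
    then obtain a where a: "\<And>x y. (x, y) \<in> cbox (y1, x1) (y2, x2) \<Longrightarrow> f (x, y) = (\<Sum>i\<le>2. \<Sum>j\<le>2. a i j * x ^ i * y ^ j)"
      unfolding biquadratic_on_def by blast
    have "f (y, x) = (\<Sum>j\<le>2. \<Sum>i\<le>2. a i j * x ^ j * y ^ i)" if "(x, y) \<in> cbox (x1, y1) (x2, y2)" for x y
    proof -
      have "f (y, x) = (\<Sum>i\<le>2. \<Sum>j\<le>2. a i j * y ^ i * x ^ j)" using a[of y x] that by auto
      also have "\<dots> = (\<Sum>j\<le>2. \<Sum>i\<le>2. a i j * y ^ i * x ^ j)" by (rule sum.swap)
      finally show ?thesis by (simp add: mult.commute mult.left_commute)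
    qed
    then show ?thesis unfolding biquadratic_on_def by (intro exI[of _ "\<lambda>i j. a j i"]) auto
  qed
  then show ?thesis using f unfolding rect_partition.spl_def[OF swapped] spl_def by auto
qed

lemma spl_row_quad:
  assumes f: "spl f" and ab: "a < b" "no_line Q a b"
  shows "quad_on {a..b} (\<lambda>x. f (x, y))"
proof (cases "a1 \<le> a \<and> b \<le> a2 \<and> b1 \<le> y \<and> y \<le> b2")
  case True
  then obtain x1 x2 y1 y2 where q: "(x1, x2, y1, y2) \<in> Q" "x1 \<le> (a + b) / 2" "(a + b) / 2 \<le> x2" "y1 \<le> y" "y \<le> y2"
    using cover[of "(a + b) / 2" y] ab(1) by auto
  then have "x1 \<le> a" "b \<le> x2" using no_lineD[OF ab(2) xcoordsI(1)[OF q(1)]] no_lineD[OF ab(2) xcoordsI(2)[OF q(1)]] ab(1) by auto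
  moreover obtain p where p: "\<And>x y. (x, y) \<in> cbox (x1, y1) (x2, y2) \<Longrightarrow> f (x, y) = (\<Sum>i\<le>2. \<Sum>j\<le>2. p i j * x ^ i * y ^ j)"
    using f q(1) unfolding spl_def biquadratic_on_def by meson
  ultimately have "f (x, y) = (\<Sum>i\<le>2. (\<Sum>j\<le>2. p i j * y ^ j) * x ^ i)" if "x \<in> {a..b}" for x
    using p[of x y] q that by (simp add: sum_distrib_right sum_distrib_left mult_ac)
  then have "\<forall>x\<in>{a..b}. f (x, y) = (\<Sum>j\<le>2. p 0 j * y ^ j) + (\<Sum>j\<le>2. p 1 j * y ^ j) * x + (\<Sum>j\<le>2. p 2 j * y ^ j) * x\<^sup>2"
    by (simp add: numeral_2_eq_2)
  then show ?thesis unfolding quad_on_def by blast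
next
  case False
  have z: "f (x, y) = 0" if "\<not> (a1 \<le> x \<and> x \<le> a2 \<and> b1 \<le> y \<and> y \<le> b2)" for x
    using f that unfolding spl_def by blast
  have d: "\<exists>D. ((\<lambda>t. f (t, y)) has_real_derivative D) (at x)" for x using f unfolding spl_def by blast
  have "f (x, y) = 0" if x: "x \<in> {a..b}" for x
  proof (cases "b1 \<le> y \<and> y \<le> b2")
    case True
    then have "b \<le> a1 \<or> a2 \<le> a" using False no_lineD[OF ab(2) a1_xcoords] no_lineD[OF ab(2) a2_xcoords] by auto
    then consider "x < a1" | "a2 < x" | "x = a1" | "x = a2" using x by fastforce
    then show ?thesis
    proof cases
      case 3 show ?thesis unfolding 3 by (rule zero_at_end[OF d]) (use z in auto)
    next
      case 4 show ?thesis unfolding 4 by (rule zero_at_end[OF d]) (use z in auto)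
    qed (use z in auto)
  qed (use z in auto)
  then show ?thesis using quad_on_cong[of "{a..b}" "\<lambda>x. f (x, y)" "\<lambda>x. 0"] quad_on_zero by simp
qed

lemma spl_row_pwq: "spl f \<Longrightarrow> pwq (xcoords Q) (\<lambda>x. f (x, y))"
proof -
  assume f: "spl f"
  have "quad_on {a..b} (\<lambda>x. f (x, y))" if "a < b" "xcoords Q \<inter> {a<..<b} = {}" for a b
    by (rule spl_row_quad[OF f that(1)]) (use that(2) in \<open>force simp: no_line_def\<close>)
  then show ?thesis using f unfolding pwq_def spl_def by blast
qed

lemma spl_col_pwq: "spl f \<Longrightarrow> pwq (xcoords (swap_quad -` Q)) (\<lambda>y. f (x, y))"
  using rect_partition.spl_row_pwq[OF swapped spl_swap, of f x] by simp

text \<open>The coefficient of the tensor product of truncated squares at the grid point \<open>(s, t)\<close>.\<close>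

definition coef :: "real \<Rightarrow> (real \<times> real \<Rightarrow> real) \<Rightarrow> real \<Rightarrow> real \<Rightarrow> real"
  where "coef h f s t = jump h t (\<lambda>y. jump h s (\<lambda>x. f (x, y)))"

text \<open>A step that makes the samples of the difference quotient at one grid line stay away from all other
grid lines.\<close>

definition mesh_width :: "real \<Rightarrow> bool"
  where "mesh_width h \<longleftrightarrow> h > 0 \<and> (\<forall>s\<in>xcoords Q. \<forall>u\<in>xcoords Q. s \<noteq> u \<longrightarrow> 3 * h \<le> \<bar>s - u\<bar>) \<and>
    (\<forall>s\<in>xcoords (swap_quad -` Q). \<forall>u\<in>xcoords (swap_quad -` Q). s \<noteq> u \<longrightarrow> 3 * h \<le> \<bar>s - u\<bar>)"

lemma mesh_width_exists: "\<exists>h. mesh_width h"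
proof -
  obtain h where h: "h > 0" "\<forall>s\<in>xcoords Q. \<forall>u\<in>xcoords Q. s \<noteq> u \<longrightarrow> 3 * h \<le> \<bar>s - u\<bar>" using finite_separated[OF finite_xcoords] by blast
  obtain k where k: "k > 0" "\<forall>s\<in>xcoords (swap_quad -` Q). \<forall>u\<in>xcoords (swap_quad -` Q). s \<noteq> u \<longrightarrow> 3 * k \<le> \<bar>s - u\<bar>"
    using finite_separated[OF rect_partition.finite_xcoords[OF swapped]] by blast
  have m: "3 * min h k \<le> 3 * h" "3 * min h k \<le> 3 * k" by auto
  show ?thesis unfolding mesh_width_def
    by (rule exI[of _ "min h k"]) (use h k m in \<open>meson min_less_iff_conj order_trans\<close>)
qed

lemma mesh_width_swap: "mesh_width h \<Longrightarrow> rect_partition.mesh_width (swap_quad -` Q) h"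
  unfolding mesh_width_def rect_partition.mesh_width_def[OF swapped] by simp

lemma coef_swap: "coef h (f \<circ> prod.swap) t s = coef h f s t"
  unfolding coef_def by (subst jump_commute) simp

lemma mesh_widthD: assumes "mesh_width h"
  shows "h > 0" "s \<in> xcoords Q \<Longrightarrow> u \<in> xcoords Q \<Longrightarrow> s \<noteq> u \<Longrightarrow> 3 * h \<le> \<bar>s - u\<bar>"
    "s \<in> xcoords Q \<Longrightarrow> u \<in> xcoords Q \<Longrightarrow> s \<noteq> u \<Longrightarrow> 2 * h \<le> \<bar>s - u\<bar>"
    "s \<in> xcoords Q \<Longrightarrow> no_line Q s (s + 3 * h)" "s \<in> xcoords Q \<Longrightarrow> no_line Q (s - 3 * h) s"
proof -
  show h: "h > 0" using assms unfolding mesh_width_def by blast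
  show *: "s \<in> xcoords Q \<Longrightarrow> u \<in> xcoords Q \<Longrightarrow> s \<noteq> u \<Longrightarrow> 3 * h \<le> \<bar>s - u\<bar>" for s u
    using assms unfolding mesh_width_def by blast
  show "s \<in> xcoords Q \<Longrightarrow> u \<in> xcoords Q \<Longrightarrow> s \<noteq> u \<Longrightarrow> 2 * h \<le> \<bar>s - u\<bar>" using *[of s u] h by linarith
  show "s \<in> xcoords Q \<Longrightarrow> no_line Q s (s + 3 * h)" unfolding no_line_def using *[of s] h by fastforce
  show "s \<in> xcoords Q \<Longrightarrow> no_line Q (s - 3 * h) s" unfolding no_line_def using *[of s] h by fastforce
qed

text \<open>The univariate expansion is applied twice. For fixed \<open>y\<close> it expands \<open>f\<close> in \<open>x\<close>; the coefficients
are difference quotients of \<open>f\<close> in \<open>x\<close>, hence piecewise quadratic and differentiable in \<open>y\<close>.\<close>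

lemma spl_expansion:
  assumes f: "spl f" and h: "mesh_width h"
  shows "f (x, y) = (\<Sum>s\<in>xcoords Q. \<Sum>t\<in>xcoords (swap_quad -` Q). coef h f s t * (tsq (x - s) * tsq (y - t)))"
proof -
  interpret s: rect_partition "swap_quad -` Q" b1 b2 a1 a2 by (rule swapped)
  note h' = s.mesh_widthD[OF mesh_width_swap[OF h]]
  have row: "f (x, y) = (\<Sum>s\<in>xcoords Q. jump h s (\<lambda>x. f (x, y)) * tsq (x - s))" for x y
  proof -
    have "\<exists>m. \<forall>t<m. f (t, y) = 0" using f unfolding spl_def by (intro exI[of _ a1]) auto
    then obtain a where a: "\<And>x. f (x, y) = (\<Sum>s\<in>xcoords Q. a s * tsq (x - s))"
      using pwq_expansion[OF finite_xcoords spl_row_pwq[OF f]] by blast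
    have "jump h s (\<lambda>x. f (x, y)) = a s" if "s \<in> xcoords Q" for s
      unfolding a by (rule jump_expansion[OF finite_xcoords mesh_widthD(1,3)[OF h] that])
    then show ?thesis using a[of x] by simp
  qed
  have col: "jump h s (\<lambda>x. f (x, y)) = (\<Sum>t\<in>xcoords (swap_quad -` Q). coef h f s t * tsq (y - t))" for s y
  proof -
    let ?g = "\<lambda>y. jump h s (\<lambda>x. f (x, y))"
    have "pwq (xcoords (swap_quad -` Q)) ?g" by (rule pwq_jump) (rule spl_col_pwq[OF f])
    moreover have "\<exists>m. \<forall>t<m. ?g t = 0" using f unfolding spl_def jump_def by (intro exI[of _ b1]) auto
    ultimately obtain a where a: "\<And>y. ?g y = (\<Sum>t\<in>xcoords (swap_quad -` Q). a t * tsq (y - t))"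
      using pwq_expansion[OF s.finite_xcoords] by blast
    have "coef h f s t = a t" if "t \<in> xcoords (swap_quad -` Q)" for t
      unfolding coef_def a by (rule jump_expansion[OF s.finite_xcoords h'(1,3) that])
    then show ?thesis using a[of y] by simp
  qed
  show ?thesis by (subst row, subst col) (simp add: sum_distrib_left sum_distrib_right mult_ac)
qed

lemma spl_row_jump:
  assumes f: "spl f" and h: "mesh_width h" and t: "t \<in> xcoords (swap_quad -` Q)"
  shows "jump h t (\<lambda>y. f (x, y)) = (\<Sum>s\<in>xcoords Q. coef h f s t * tsq (x - s))"
proof -
  interpret s: rect_partition "swap_quad -` Q" b1 b2 a1 a2 by (rule swapped)
  note h' = s.mesh_widthD[OF mesh_width_swap[OF h]]
  have "f (x, y) = (\<Sum>t\<in>xcoords (swap_quad -` Q). (\<Sum>s\<in>xcoords Q. coef h f s t * tsq (x - s)) * tsq (y - t))" for y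
    unfolding spl_expansion[OF f h] by (subst sum.swap) (simp add: sum_distrib_left sum_distrib_right mult_ac)
  then show ?thesis using jump_expansion[OF s.finite_xcoords h'(1,3) t] by simp
qed

text \<open>At a point off the skeleton the function is a polynomial in \<open>y\<close> across the line at height \<open>t\<close>.\<close>

lemma jump_off_K:
  assumes f: "spl f" and h: "mesh_width h" and t: "t \<in> xcoords (swap_quad -` Q)" and "\<not> K x t"
  shows "jump h t (\<lambda>y. f (x, y)) = 0"
proof -
  interpret s: rect_partition "swap_quad -` Q" b1 b2 a1 a2 by (rule swapped)
  note h' = s.mesh_widthD[OF mesh_width_swap[OF h]]
  show ?thesis
  proof (cases "a1 \<le> x \<and> x \<le> a2")
    case True
    then obtain x1 x2 y1 y2 where q: "(x1, x2, y1, y2) \<in> Q" "x1 < x" "x < x2" "y1 < t" "t < y2"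
      using not_K_inside[OF assms(4)] s.xcoords_bounds[OF t] by auto
    have "(y1, y2, x1, x2) \<in> swap_quad -` Q" using q by simp
    then have "3 * h \<le> \<bar>t - y1\<bar>" "3 * h \<le> \<bar>t - y2\<bar>" using h'(2)[OF t] s.xcoordsI q by force+
    then have y: "y1 \<le> t - 2 * h" "t + 2 * h \<le> y2" using q h'(1) by auto
    obtain p where p: "\<And>x y. (x, y) \<in> cbox (x1, y1) (x2, y2) \<Longrightarrow> f (x, y) = (\<Sum>i\<le>2. \<Sum>j\<le>2. p i j * x ^ i * y ^ j)"
      using f q(1) unfolding spl_def biquadratic_on_def by meson
    have "f (x, y) = (\<Sum>j\<le>2. (\<Sum>i\<le>2. p i j * x ^ i) * y ^ j)" if "y \<in> {t - 2 * h..t + 2 * h}" for y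
    proof -
      have "f (x, y) = (\<Sum>i\<le>2. \<Sum>j\<le>2. p i j * x ^ i * y ^ j)" using p[of x y] q y that by simp
      also have "\<dots> = (\<Sum>j\<le>2. \<Sum>i\<le>2. p i j * x ^ i * y ^ j)" by (rule sum.swap)
      finally show ?thesis by (simp add: sum_distrib_right)
    qed
    then have "\<forall>y\<in>{t - 2 * h..t + 2 * h}. f (x, y) = (\<Sum>i\<le>2. p i 0 * x ^ i) + (\<Sum>i\<le>2. p i 1 * x ^ i) * y + (\<Sum>i\<le>2. p i 2 * x ^ i) * y\<^sup>2"
      by (simp add: numeral_2_eq_2)
    then show ?thesis by (intro jump_quad h'(1)) (use quad_on_def in blast)
  next
    case False
    then have "f (x, y) = 0" for y using f unfolding spl_def by blast
    then show ?thesis unfolding jump_def by simp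
  qed
qed

lemma off_east: "\<not> east K s y \<Longrightarrow> no_line Q s u \<Longrightarrow> s < x \<Longrightarrow> x < u \<Longrightarrow> \<not> K x y"
  using eastI by blast

lemma off_west: "\<not> west K s y \<Longrightarrow> no_line Q u s \<Longrightarrow> u < x \<Longrightarrow> x < s \<Longrightarrow> \<not> K x y"
proof
  assume *: "\<not> west K s y" "no_line Q u s" "u < x" "x < s" "K x y"
  have "west K s y" unfolding west_def by (rule exI[of _ "s - u"]) (use gap[OF *(5,3,4,2)] * in auto)
  then show False using * by blast
qed

lemma coef_support_row:
  assumes f: "spl f" and h: "mesh_width h" and st: "s \<in> xcoords Q" "t \<in> xcoords (swap_quad -` Q)" and "\<not> east K s t" "\<not> west K s t"
  shows "coef h f s t = 0"
proof -
  note m = mesh_widthD[OF h]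
  have "jump h s (\<lambda>x. jump h t (\<lambda>y. f (x, y))) = 0"
  proof (rule jump_zero[OF _ _ m(1)])
    fix x assume "s < x" "x \<le> s + 2 * h"
    then show "jump h t (\<lambda>y. f (x, y)) = 0" using m(1)
      by (intro jump_off_K[OF f h st(2)] off_east[OF assms(5) m(4)[OF st(1)]]) auto
  next
    fix x assume "s - 2 * h \<le> x" "x < s"
    then show "jump h t (\<lambda>y. f (x, y)) = 0" using m(1)
      by (intro jump_off_K[OF f h st(2)] off_west[OF assms(6) m(5)[OF st(1)]]) auto
  qed
  then show ?thesis unfolding coef_def by (subst jump_commute)
qed

text \<open>At a grid point that is not a vertex the skeleton misses both horizontal or both vertical
directions. In the first case the jump across the horizontal line vanishes on both sides of the
point, so it has no kink there.\<close>

lemma coef_support: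
  assumes f: "spl f" and h: "mesh_width h" and st: "s \<in> xcoords Q" "t \<in> xcoords (swap_quad -` Q)" and "\<not> corner Q s t"
  shows "coef h f s t = 0"
proof (cases "east K s t \<or> west K s t")
  case True
  then have "\<not> north K s t" "\<not> south K s t" using assms(5) perpendicular_corner by blast+
  then have "coef h (f \<circ> prod.swap) t s = 0"
    using rect_partition.coef_support_row[OF swapped spl_swap[OF f] mesh_width_swap[OF h], of t s] st
    by (simp add: frame_sw)
  then show ?thesis unfolding coef_swap .
next
  case False then show ?thesis using coef_support_row[OF assms(1-4)] by blast
qed

definition coefs :: "real \<Rightarrow> (real \<times> real \<Rightarrow> real) \<Rightarrow> real \<times> real \<Rightarrow> real"
  where "coefs h f v = (if v \<in> verts Q then coef h f (fst v) (snd v) else 0)"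

lemma verts_grid: "verts Q \<subseteq> xcoords Q \<times> xcoords (swap_quad -` Q)"
  unfolding verts_def using corner_x corner_y by auto

lemma spline_of_coefs:
  assumes f: "spl f" and h: "mesh_width h" shows "spline_of Q (coefs h f) = f"
proof
  fix p :: "real \<times> real"
  obtain x y where p: "p = (x, y)" by (cases p)
  have fin: "finite (xcoords Q \<times> xcoords (swap_quad -` Q))" using finite_xcoords rect_partition.finite_xcoords[OF swapped] by simp
  have "spline_of Q (coefs h f) p = (\<Sum>v\<in>verts Q. coef h f (fst v) (snd v) * (tsq (x - fst v) * tsq (y - snd v)))"
    unfolding spline_of_def coefs_def p by simp
  also have "\<dots> = (\<Sum>v\<in>xcoords Q \<times> xcoords (swap_quad -` Q). coef h f (fst v) (snd v) * (tsq (x - fst v) * tsq (y - snd v)))"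
    by (rule sum.mono_neutral_left[OF fin verts_grid]) (use coef_support[OF f h] in \<open>auto simp: verts_def\<close>)
  also have "\<dots> = f p" unfolding p spl_expansion[OF f h] by (simp add: sum.cartesian_product case_prod_beta)
  finally show "spline_of Q (coefs h f) p = f p" .
qed

text \<open>The jump across the line of the run vanishes just to the right and just to the left of the run.
There it equals a sum over the vertices up to the right end, or before the left end, and the
moments of both sums vanish; their difference is the sum over the run.\<close>

lemma run_moments:
  assumes f: "spl f" and h: "mesh_width h" and r: "(y, s, t) \<in> hruns Q" and "r \<le> 2"
  shows "(\<Sum>v\<in>{v \<in> xcoords Q. s \<le> v \<and> v \<le> t}. v ^ r * coef h f v y) = 0"
proof -
  note m = mesh_widthD[OF h]
  have y: "y \<in> xcoords (swap_quad -` Q)" and st: "s \<in> xcoords Q" "t \<in> xcoords Q" using run_ends[OF r] corner_x corner_y by blast+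
  note hd = hrunsD[OF r]
  have b: "(\<Sum>v\<in>xcoords Q. coef h f v y * tsq (x - v)) = 0" if "\<not> K x y" for x
    using jump_off_K[OF f h y that] spl_row_jump[OF f h y, of x] by simp
  have split: "(\<Sum>v\<in>xcoords Q. coef h f v y * tsq (x - v)) = (\<Sum>v\<in>{v \<in> xcoords Q. P v}. coef h f v y * (x - v)\<^sup>2)"
    if "\<And>v. v \<in> xcoords Q \<Longrightarrow> P v \<Longrightarrow> v \<le> x" "\<And>v. v \<in> xcoords Q \<Longrightarrow> \<not> P v \<Longrightarrow> x \<le> v" for P x
  proof -
    have "(\<Sum>v\<in>{v \<in> xcoords Q. P v}. coef h f v y * (x - v)\<^sup>2) = (\<Sum>v\<in>{v \<in> xcoords Q. P v}. coef h f v y * tsq (x - v))"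
      by (rule sum.cong) (use that(1) in \<open>auto simp: tsq_simps\<close>)
    also have "\<dots> = (\<Sum>v\<in>xcoords Q. coef h f v y * tsq (x - v))"
      by (rule sum.mono_neutral_left[OF finite_xcoords]) (use that(2) in \<open>auto simp: tsq_simps\<close>)
    finally show ?thesis by simp
  qed
  have "(\<Sum>v\<in>{v \<in> xcoords Q. v \<le> t}. v ^ r * coef h f v y) = 0"
  proof (rule moments_vanish[where l = t and u = "t + 3 * h", OF _ _ _ \<open>r \<le> 2\<close>])
    fix x assume x: "t < x" "x < t + 3 * h"
    have "(\<Sum>v\<in>xcoords Q. coef h f v y * tsq (x - v)) = 0" by (rule b) (rule off_east[OF hd(4) m(4)[OF st(2)] x])
    moreover have "v \<le> t \<or> t + 3 * h \<le> v" if "v \<in> xcoords Q" for v using no_lineD[OF m(4)[OF st(2)] that] .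
    ultimately show "(\<Sum>v\<in>{v \<in> xcoords Q. v \<le> t}. coef h f v y * (x - v)\<^sup>2) = 0"
      using split[of "\<lambda>v. v \<le> t" x] x by force
  qed (use finite_xcoords m(1) in auto)
  moreover have "(\<Sum>v\<in>{v \<in> xcoords Q. v < s}. v ^ r * coef h f v y) = 0"
  proof (rule moments_vanish[where l = "s - 3 * h" and u = s, OF _ _ _ \<open>r \<le> 2\<close>])
    fix x assume x: "s - 3 * h < x" "x < s"
    have "(\<Sum>v\<in>xcoords Q. coef h f v y * tsq (x - v)) = 0" by (rule b) (rule off_west[OF hd(3) m(5)[OF st(1)] x])
    moreover have "v \<le> s - 3 * h \<or> s \<le> v" if "v \<in> xcoords Q" for v using no_lineD[OF m(5)[OF st(1)] that] .
    ultimately show "(\<Sum>v\<in>{v \<in> xcoords Q. v < s}. coef h f v y * (x - v)\<^sup>2) = 0"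
      using split[of "\<lambda>v. v < s" x] x by force
  qed (use finite_xcoords m(1) in auto)
  moreover have "{v \<in> xcoords Q. v \<le> t} = {v \<in> xcoords Q. v < s} \<union> {v \<in> xcoords Q. s \<le> v \<and> v \<le> t}" using hd(1) by auto
  moreover have "{v \<in> xcoords Q. v < s} \<inter> {v \<in> xcoords Q. s \<le> v \<and> v \<le> t} = {}" by auto
  ultimately show ?thesis using finite_xcoords by (simp add: sum.union_disjoint)
qed

lemma coefs_hker:
  assumes f: "spl f" and h: "mesh_width h" shows "hker Q (coefs h f)"
  unfolding hker_def
proof (intro ballI allI impI)
  fix \<rho> and r :: nat assume \<rho>: "\<rho> \<in> hruns Q" "r \<le> 2"
  obtain y s t where r: "\<rho> = (y, s, t)" by (metis surj_pair)
  have run: "(y, s, t) \<in> hruns Q" using \<rho> r by simp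
  have y: "y \<in> xcoords (swap_quad -` Q)" using run_ends[OF run] corner_y by blast
  have fin: "finite (xcoords Q \<times> xcoords (swap_quad -` Q))" using finite_xcoords rect_partition.finite_xcoords[OF swapped] by simp
  let ?A = "{v \<in> xcoords Q. s \<le> v \<and> v \<le> t}"
  \<comment> \<open>only grid points on the run contribute\<close>
  have fA: "finite ?A" using finite_xcoords by simp
  have "(\<Sum>v\<in>verts Q. of_bool (onrun \<rho> (fst v) (snd v)) * fst v ^ r * coefs h f v) =
    (\<Sum>v\<in>xcoords Q \<times> xcoords (swap_quad -` Q). of_bool (onrun \<rho> (fst v) (snd v)) * fst v ^ r * coef h f (fst v) (snd v))"
    by (rule sum.mono_neutral_cong_left[OF fin verts_grid]) (use coef_support[OF f h] in \<open>auto simp: verts_def coefs_def\<close>)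
  also have "\<dots> = (\<Sum>v\<in>?A \<times> {y}. fst v ^ r * coef h f (fst v) (snd v))"
    by (rule sum.mono_neutral_cong_right[OF fin]) (use y in \<open>auto simp: r\<close>)
  also have "\<dots> = (\<Sum>v\<in>?A. v ^ r * coef h f v y)"
  proof -
    have "?A \<times> {y} = (\<lambda>v. (v, y)) ` ?A" by auto
    then show ?thesis by (simp add: sum.reindex inj_on_def)
  qed
  finally show "(\<Sum>v\<in>verts Q. of_bool (onrun \<rho> (fst v) (snd v)) * fst v ^ r * coefs h f v) = 0"
    using run_moments[OF f h run \<rho>(2)] by simp
qed

lemma coefs_swap: "rect_partition.coefs (swap_quad -` Q) h (f \<circ> prod.swap) = coefs h f \<circ> prod.swap"
  unfolding rect_partition.coefs_def[OF swapped] coefs_def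
  by (auto simp: fun_eq_iff coef_swap verts_def corner_sw)

lemma coefs_hker_sw: "spl f \<Longrightarrow> mesh_width h \<Longrightarrow> hker (swap_quad -` Q) (coefs h f \<circ> prod.swap)"
  using rect_partition.coefs_hker[OF swapped spl_swap mesh_width_swap, of f h] unfolding coefs_swap .

lemma coefs_spline_of:
  assumes h: "mesh_width h" and c: "\<And>v. v \<notin> verts Q \<Longrightarrow> c v = 0"
  shows "coefs h (spline_of Q c) = c"
proof
  fix v
  interpret s: rect_partition "swap_quad -` Q" b1 b2 a1 a2 by (rule swapped)
  note h' = s.mesh_widthD[OF mesh_width_swap[OF h]]
  have fin: "finite (xcoords Q \<times> xcoords (swap_quad -` Q))" using finite_xcoords s.finite_xcoords by simp
  have e: "spline_of Q c (x, y) = (\<Sum>t\<in>xcoords (swap_quad -` Q). (\<Sum>s\<in>xcoords Q. c (s, t) * tsq (x - s)) * tsq (y - t))" for x y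
  proof -
    have "spline_of Q c (x, y) = (\<Sum>v\<in>xcoords Q \<times> xcoords (swap_quad -` Q). c v * (tsq (x - fst v) * tsq (y - snd v)))"
      unfolding spline_of_def by (rule sum.mono_neutral_cong_left[OF fin verts_grid]) (use c in auto)
    also have "\<dots> = (\<Sum>s\<in>xcoords Q. \<Sum>t\<in>xcoords (swap_quad -` Q). c (s, t) * (tsq (x - s) * tsq (y - t)))"
      by (simp add: sum.cartesian_product case_prod_beta)
    also have "\<dots> = (\<Sum>t\<in>xcoords (swap_quad -` Q). \<Sum>s\<in>xcoords Q. c (s, t) * (tsq (x - s) * tsq (y - t)))" by (rule sum.swap)
    finally show ?thesis by (simp add: sum_distrib_left sum_distrib_right mult_ac)
  qed
  show "coefs h (spline_of Q c) v = c v"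
  proof (cases "v \<in> verts Q")
    case True
    then obtain s t where v: "v = (s, t)" "s \<in> xcoords Q" "t \<in> xcoords (swap_quad -` Q)" using verts_grid by blast
    have "coef h (spline_of Q c) s t = jump h s (\<lambda>x. jump h t (\<lambda>y. spline_of Q c (x, y)))"
      unfolding coef_def by (rule jump_commute)
    also have "\<dots> = jump h s (\<lambda>x. \<Sum>s\<in>xcoords Q. c (s, t) * tsq (x - s))"
      unfolding e using jump_expansion[OF s.finite_xcoords h'(1,3) v(3)] by simp
    also have "\<dots> = c (s, t)" by (rule jump_expansion[OF finite_xcoords mesh_widthD(1,3)[OF h] v(2)])
    finally show ?thesis using True v by (simp add: coefs_def)
  next
    case False then show ?thesis using c by (simp add: coefs_def)
  qed
qed

end

section \<open>Rigid meshes and the dimension formula\<close>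

definition biq :: "(nat \<times> nat \<Rightarrow> real) \<Rightarrow> real \<Rightarrow> real \<Rightarrow> real"
  where "biq a x y = (\<Sum>i\<le>2. \<Sum>j\<le>2. a (i, j) * x ^ i * y ^ j)"

text \<open>Functions that restrict to a quadratic on each segment of the skeleton. Biquadratic polynomials have
this property; rigidity says that on the skeleton there are no other such functions.\<close>

definition segmentwise :: "(real \<Rightarrow> real \<Rightarrow> bool) \<Rightarrow> (real \<Rightarrow> real \<Rightarrow> real) \<Rightarrow> bool"
  where "segmentwise K u \<longleftrightarrow> (\<forall>y s t. s < t \<longrightarrow> (\<forall>x. s \<le> x \<and> x \<le> t \<longrightarrow> K x y) \<longrightarrow> quad_on {s..t} (\<lambda>x. u x y)) \<and>
     (\<forall>x s t. s < t \<longrightarrow> (\<forall>y. s \<le> y \<and> y \<le> t \<longrightarrow> K x y) \<longrightarrow> quad_on {s..t} (\<lambda>y. u x y))"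

definition rigid :: "(real \<Rightarrow> real \<Rightarrow> bool) \<Rightarrow> bool"
  where "rigid K \<longleftrightarrow> (\<forall>u. segmentwise K u \<longrightarrow> (\<exists>a. \<forall>x y. K x y \<longrightarrow> u x y = biq a x y))"

type_synonym idx = "bool \<times> (real \<times> real \<times> real) \<times> nat"

text \<open>The conditions on the vertex coefficients: three moments for each horizontal run (first component
\<open>True\<close>) and each vertical run (\<open>False\<close>), the runs on the rim included.\<close>

definition conds :: "quad set \<Rightarrow> idx set"
  where "conds Q = {True} \<times> hruns Q \<times> {..2} \<union> {False} \<times> vruns Q \<times> {..2}"

fun incid :: "idx \<Rightarrow> real \<times> real \<Rightarrow> real"
  where "incid (True, \<rho>, r) v = of_bool (onrun \<rho> (fst v) (snd v)) * fst v ^ r"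
  | "incid (False, \<rho>, r) v = of_bool (onrun \<rho> (snd v) (fst v)) * snd v ^ r"

lemma sum3: "(\<Sum>i\<le>2. f i) = f 0 + f 1 + f (2::nat)" for f :: "nat \<Rightarrow> real"
  by (simp add: numeral_2_eq_2)

lemma quad_coeffs_eq:
  assumes "s < t" "\<And>x. s \<le> x \<Longrightarrow> x \<le> t \<Longrightarrow> (\<Sum>i\<le>2. p i * x ^ i) = (\<Sum>i\<le>2. q i * x ^ i)" "r \<le> 2"
  shows "p r = (q r :: real)"
proof -
  have "p 0 - q 0 = 0 \<and> p 1 - q 1 = 0 \<and> p 2 - q 2 = 0"
  proof (rule quad_coeffs_zero[of s "(s + t) / 2" t])
    fix x assume "x \<in> {s, (s + t) / 2, t}"
    then have "s \<le> x" "x \<le> t" using assms(1) by auto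
    from assms(2)[OF this] show "p 0 - q 0 + (p 1 - q 1) * x + (p 2 - q 2) * x\<^sup>2 = 0"
      by (simp add: sum3 algebra_simps)
  qed (use assms(1) in auto)
  moreover have "r = 0 \<or> r = 1 \<or> r = 2" using assms(3) by auto
  ultimately show ?thesis by auto
qed

lemma biq_row: "biq a x y = (\<Sum>i\<le>2. (\<Sum>j\<le>2. a (i, j) * y ^ j) * x ^ i)"
  unfolding biq_def by (simp add: sum3 algebra_simps)

lemma biq_col: "biq a x y = (\<Sum>j\<le>2. (\<Sum>i\<le>2. a (i, j) * x ^ i) * y ^ j)"
  unfolding biq_def by (simp add: sum3 algebra_simps)

lemma quad_on_poly: "quad_on A (\<lambda>x. \<Sum>i\<le>2. p i * x ^ i)"
  unfolding quad_on_def by (intro exI[of _ "p 0"] exI[of _ "p 1"] exI[of _ "p 2"]) (simp add: sum3)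

context rect_partition
begin

lemma Ker_iff: "c \<in> Ker (verts Q) (conds Q) incid \<longleftrightarrow>
    (\<forall>v. v \<notin> verts Q \<longrightarrow> c v = 0) \<and> hker Q c \<and> hker (swap_quad -` Q) (c \<circ> prod.swap)"
proof -
  have b: "(\<forall>j\<in>conds Q. F j) \<longleftrightarrow> (\<forall>\<rho>\<in>hruns Q. \<forall>r\<le>2. F (True, \<rho>, r)) \<and> (\<forall>\<tau>\<in>vruns Q. \<forall>r\<le>2. F (False, \<tau>, r))" for F
    unfolding conds_def by auto
  show ?thesis unfolding Ker_def mem_Collect_eq b hker_def sum_verts_sw by simp
qed

lemma finite_vruns: "finite (vruns Q)"
  using rect_partition.finite_hruns[OF swapped] by simp

lemma finite_conds: "finite (conds Q)"
  unfolding conds_def using finite_hruns finite_vruns by simp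

lemma card_conds: "card (conds Q) = 3 * (card ihruns + 2) + 3 * (card ivruns + 2)"
proof -
  have iv: "rect_partition.ihruns (swap_quad -` Q) a1 a2 = ivruns"
    unfolding rect_partition.ihruns_def[OF swapped] ivruns_def by simp
  have "card (conds Q) = card ({True} \<times> hruns Q \<times> {..2::nat}) + card ({False} \<times> vruns Q \<times> {..2::nat})"
    unfolding conds_def by (rule card_Un_disjoint) (use finite_hruns finite_vruns in auto)
  moreover have "card (hruns Q) = card ihruns + 2" "card (vruns Q) = card ivruns + 2"
    using card_hruns rect_partition.card_hruns[OF swapped] unfolding iv by simp_all
  ultimately show ?thesis by (simp add: card_cartesian_product)
qed

text \<open>A vertex lies on one horizontal and one vertical run, so only six of the conditions involve its
coefficient.\<close>

lemma rel_at:
  assumes v: "v \<in> verts Q" and \<rho>: "\<rho> \<in> hruns Q" "onrun \<rho> (fst v) (snd v)" and \<tau>: "\<tau> \<in> vruns Q" "onrun \<tau> (snd v) (fst v)"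
  shows "(\<Sum>j\<in>conds Q. p j * incid j v) = (\<Sum>r\<le>2. p (True, \<rho>, r) * fst v ^ r) + (\<Sum>r\<le>2. p (False, \<tau>, r) * snd v ^ r)"
proof -
  have v': "prod.swap v \<in> verts (swap_quad -` Q)" using v by (auto simp: verts_sw)
  have u: "onrun \<tau>' (snd v) (fst v) \<longleftrightarrow> \<tau>' = \<tau>" if "\<tau>' \<in> vruns Q" for \<tau>'
    using rect_partition.unique_run[OF swapped v', of \<tau> \<tau>'] \<tau> that by simp
  have "(\<Sum>j\<in>conds Q. p j * incid j v) = (\<Sum>j\<in>{True} \<times> hruns Q \<times> {..2}. p j * incid j v) + (\<Sum>j\<in>{False} \<times> vruns Q \<times> {..2}. p j * incid j v)"
    unfolding conds_def by (rule sum.union_disjoint) (use finite_hruns finite_vruns in auto)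
  also have "(\<Sum>j\<in>{True} \<times> hruns Q \<times> {..2}. p j * incid j v) = (\<Sum>j\<in>{True} \<times> {\<rho>} \<times> {..2}. p j * incid j v)"
    by (rule sum.mono_neutral_right) (use finite_hruns unique_run[OF v \<rho>] \<rho>(1) in auto)
  also have "{True} \<times> {\<rho>} \<times> {..2} = (\<lambda>r. (True, \<rho>, r)) ` {..2::nat}" by auto
  also have "(\<Sum>j\<in>\<dots>. p j * incid j v) = (\<Sum>r\<le>2. p (True, \<rho>, r) * fst v ^ r)"
    by (subst sum.reindex) (use \<rho>(2) in \<open>simp_all add: inj_on_def\<close>)
  also have "(\<Sum>j\<in>{False} \<times> vruns Q \<times> {..2}. p j * incid j v) = (\<Sum>j\<in>{False} \<times> {\<tau>} \<times> {..2}. p j * incid j v)"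
    by (rule sum.mono_neutral_right) (use finite_vruns u \<tau>(1) in auto)
  also have "{False} \<times> {\<tau>} \<times> {..2} = (\<lambda>r. (False, \<tau>, r)) ` {..2::nat}" by auto
  also have "(\<Sum>j\<in>\<dots>. p j * incid j v) = (\<Sum>r\<le>2. p (False, \<tau>, r) * snd v ^ r)"
    by (subst sum.reindex) (use \<tau>(2) in \<open>simp_all add: inj_on_def\<close>)
  finally show ?thesis .
qed

text \<open>The relation that belongs to a biquadratic polynomial \<open>P\<close>: on a horizontal run the coefficients of
the restriction of \<open>P\<close>, on a vertical run those of the restriction of \<open>-P\<close>. At a vertex the two
cancel.\<close>

definition biq_rel :: "(nat \<times> nat \<Rightarrow> real) \<Rightarrow> idx \<Rightarrow> real"
  where "biq_rel a = (\<lambda>(b, (z, s, t), r). if (b, (z, s, t), r) \<in> conds Q then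
     (if b then (\<Sum>j\<le>2. a (r, j) * z ^ j) else - (\<Sum>i\<le>2. a (i, r) * z ^ i)) else 0)"

lemma biq_rel_simps:
  "(y, s, t) \<in> hruns Q \<Longrightarrow> r \<le> 2 \<Longrightarrow> biq_rel a (True, (y, s, t), r) = (\<Sum>j\<le>2. a (r, j) * y ^ j)"
  "(x, s, t) \<in> vruns Q \<Longrightarrow> r \<le> 2 \<Longrightarrow> biq_rel a (False, (x, s, t), r) = - (\<Sum>i\<le>2. a (i, r) * x ^ i)"
  unfolding biq_rel_def conds_def by auto

lemma vert_vrun: "v \<in> verts Q \<Longrightarrow> \<exists>\<tau>\<in>vruns Q. onrun \<tau> (snd v) (fst v)"
  using rect_partition.vert_run[OF swapped, of "prod.swap v"] by (auto simp: verts_sw)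

lemma biq_rel_in: "biq_rel a \<in> Rel (verts Q) (conds Q) incid"
  unfolding Rel_def
proof (intro CollectI conjI ballI allI impI)
  fix j assume "j \<notin> conds Q" then show "biq_rel a j = 0" unfolding biq_rel_def by (auto split: prod.splits)
next
  fix v assume v: "v \<in> verts Q"
  obtain \<rho> where \<rho>: "\<rho> \<in> hruns Q" "onrun \<rho> (fst v) (snd v)" using vert_run[OF v] by blast
  obtain \<tau> where \<tau>: "\<tau> \<in> vruns Q" "onrun \<tau> (snd v) (fst v)" using vert_vrun[OF v] by blast
  obtain y s t x s' t' where e: "\<rho> = (y, s, t)" "\<tau> = (x, s', t')" by (metis surj_pair)
  have xy: "snd v = y" "fst v = x" using \<rho>(2) \<tau>(2) e by auto
  have "(\<Sum>r\<le>2. biq_rel a (True, \<rho>, r) * fst v ^ r) = biq a x y"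
    unfolding biq_row using \<rho>(1) biq_rel_simps(1)[of y s t _ a] by (simp add: e xy)
  moreover have "(\<Sum>r\<le>2. biq_rel a (False, \<tau>, r) * snd v ^ r) = - biq a x y"
    unfolding biq_col using \<tau>(1) biq_rel_simps(2)[of x s' t' _ a] by (simp add: e xy sum_negf)
  ultimately show "(\<Sum>j\<in>conds Q. biq_rel a j * incid j v) = 0" unfolding rel_at[OF v \<rho> \<tau>] by simp
qed

lemma linear_biq_rel: "linear biq_rel"
  by (rule linearI) (auto simp: biq_rel_def fun_eq_iff scaleR_fun_def sum3 algebra_simps)

text \<open>Conversely, a relation assigns a quadratic polynomial to each run. After a change of sign on the
vertical runs the polynomials of two runs agree at their common vertex, and horizontal and vertical
runs meet only in vertices. So they define a function on the skeleton that is quadratic along each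
segment, and rigidity provides the biquadratic polynomial.\<close>

lemma Rel_biq:
  assumes rig: "rigid K" and p: "p \<in> Rel (verts Q) (conds Q) incid"
  shows "\<exists>a. (\<forall>v. v \<notin> {..2} \<times> {..2} \<longrightarrow> a v = 0) \<and> biq_rel a = p"
proof -
  interpret s: rect_partition "swap_quad -` Q" b1 b2 a1 a2 by (rule swapped)
  define H where "H x y \<longleftrightarrow> (\<exists>\<rho>\<in>hruns Q. onrun \<rho> x y)" for x y
  define hr where "hr x y = (SOME \<rho>. \<rho> \<in> hruns Q \<and> onrun \<rho> x y)" for x y
  define vr where "vr x y = (SOME \<tau>. \<tau> \<in> vruns Q \<and> onrun \<tau> y x)" for x y
  define u where "u x y = (if H x y then \<Sum>r\<le>2. p (True, hr x y, r) * x ^ r else - (\<Sum>r\<le>2. p (False, vr x y, r) * y ^ r))" for x y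
  have hr: "hr x y = \<rho>" if \<rho>: "\<rho> \<in> hruns Q" "onrun \<rho> x y" for \<rho> x y
  proof -
    have "hr x y \<in> hruns Q \<and> onrun (hr x y) x y" unfolding hr_def by (rule someI_ex) (use \<rho> in blast)
    moreover obtain z s t z' s' t' where "\<rho> = (z, s, t)" "hr x y = (z', s', t')" by (metis surj_pair)
    ultimately show ?thesis using \<rho> run_unique[of z s t s' t' x] by auto
  qed
  have vr: "vr x y = \<tau>" if \<tau>: "\<tau> \<in> vruns Q" "onrun \<tau> y x" for \<tau> x y
  proof -
    have "vr x y \<in> vruns Q \<and> onrun (vr x y) y x" unfolding vr_def by (rule someI_ex) (use \<tau> in blast)
    moreover obtain z s t z' s' t' where "\<tau> = (z, s, t)" "vr x y = (z', s', t')" by (metis surj_pair)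
    ultimately show ?thesis using \<tau> s.run_unique[of z s t s' t' y] by auto
  qed
  have uh: "u x y = (\<Sum>r\<le>2. p (True, \<rho>, r) * x ^ r)" if "\<rho> \<in> hruns Q" "onrun \<rho> x y" for \<rho> x y
    using hr[OF that] that unfolding u_def H_def by auto
  have uv: "u x y = - (\<Sum>r\<le>2. p (False, \<tau>, r) * y ^ r)" if \<tau>: "\<tau> \<in> vruns Q" "onrun \<tau> y x" for \<tau> x y
  proof (cases "H x y")
    case False then show ?thesis using vr[OF that] unfolding u_def by simp
  next
    case True
    then obtain \<rho> where \<rho>: "\<rho> \<in> hruns Q" "onrun \<rho> x y" unfolding H_def by blast
    obtain s t s' t' where e: "\<rho> = (y, s, t)" "\<tau> = (x, s', t')" "s \<le> x" "x \<le> t" "s' \<le> y" "y \<le> t'"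
      using \<rho>(2) \<tau>(2) by (cases \<rho>; cases \<tau>) auto
    have "east K x y \<or> west K x y" using hrunsD[of y s t] \<rho>(1) e by (metis order_le_less)
    moreover have "north K x y \<or> south K x y"
      using s.hrunsD[of x s' t'] \<tau>(1) e by (simp add: frame_sw) (metis order_le_less)
    ultimately have v: "(x, y) \<in> verts Q" using perpendicular_corner unfolding verts_def by blast
    have "(\<Sum>r\<le>2. p (True, \<rho>, r) * x ^ r) + (\<Sum>r\<le>2. p (False, \<tau>, r) * y ^ r) = 0"
      using rel_at[OF v, of \<rho> \<tau> p] \<rho> \<tau> p v unfolding Rel_def by auto
    then show ?thesis using uh[OF \<rho>] by simp
  qed
  have "segmentwise K u"
    unfolding segmentwise_def
  proof (intro conjI allI impI)
    fix y s t :: real assume st: "s < t" "\<forall>x. s \<le> x \<and> x \<le> t \<longrightarrow> K x y"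
    obtain s' t' where r: "(y, s', t') \<in> hruns Q" "s' \<le> s" "s \<le> t'"
      using run_through[of s y] edge_dirs(1)[OF st, of s] st(1) by auto
    have "t \<le> t'" using edge_dirs(1)[OF st, of t'] hrunsD(4)[OF r(1)] r by force
    then have "u x y = (\<Sum>i\<le>2. p (True, (y, s', t'), i) * x ^ i)" if "x \<in> {s..t}" for x
      using uh[OF r(1), of x y] r that by simp
    then show "quad_on {s..t} (\<lambda>x. u x y)" using quad_on_cong[of "{s..t}" "\<lambda>x. u x y"] quad_on_poly by simp
  next
    fix x s t :: real assume st: "s < t" "\<forall>y. s \<le> y \<and> y \<le> t \<longrightarrow> K x y"
    then have st': "\<forall>y. s \<le> y \<and> y \<le> t \<longrightarrow> frame (swap_quad -` Q) y x" by (simp add: frame_sw)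
    obtain s' t' where r: "(x, s', t') \<in> vruns Q" "s' \<le> s" "s \<le> t'"
      using s.run_through[of s x] s.edge_dirs(1)[OF st(1) st', of s] st(1) by auto
    have r': "(x, s', t') \<in> hruns (swap_quad -` Q)" using r by simp
    have "t \<le> t'" using s.edge_dirs(1)[OF st(1) st', of t'] s.hrunsD(4)[OF r'] r by force
    then have "u x y = (\<Sum>i\<le>2. (- p (False, (x, s', t'), i)) * y ^ i)" if "y \<in> {s..t}" for y
      using uv[OF r(1), of y x] r that by (simp add: sum_negf)
    then show "quad_on {s..t} (\<lambda>y. u x y)" using quad_on_cong[of "{s..t}" "\<lambda>y. u x y"]
       quad_on_poly[of "{s..t}" "\<lambda>i. - p (False, (x, s', t'), i)"] by simp
  qed
  then obtain a0 where a0: "\<And>x y. K x y \<Longrightarrow> u x y = biq a0 x y" using rig unfolding rigid_def by blast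
  \<comment> \<open>keep only the nine coefficients that enter the polynomial\<close>
  define a where "a v = (if v \<in> {..2} \<times> {..2} then a0 v else 0)" for v
  have a: "K x y \<Longrightarrow> u x y = biq a x y" for x y
    using a0[of x y] unfolding biq_def a_def by (simp add: sum3)
  have "biq_rel a j = p j" for j
  proof (cases "j \<in> conds Q")
    case False
    then show ?thesis using p unfolding Rel_def biq_rel_def by (auto split: prod.splits)
  next
    case True
    then consider y s t r where "j = (True, (y, s, t), r)" "(y, s, t) \<in> hruns Q" "r \<le> 2"
      | x s t r where "j = (False, (x, s, t), r)" "(x, s, t) \<in> vruns Q" "r \<le> 2" unfolding conds_def by auto
    then show ?thesis
    proof cases
      case (1 y s t r)
      have "p (True, (y, s, t), r) = (\<Sum>j\<le>2. a (r, j) * y ^ j)"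
      proof (rule quad_coeffs_eq[OF hrunsD(1)[OF 1(2)] _ 1(3)])
        fix x assume x: "s \<le> x" "x \<le> t"
        then show "(\<Sum>i\<le>2. p (True, (y, s, t), i) * x ^ i) = (\<Sum>i\<le>2. (\<Sum>j\<le>2. a (i, j) * y ^ j) * x ^ i)"
          using a[OF hrunsD(2)[OF 1(2) x]] uh[OF 1(2), of x y] unfolding biq_row by simp
      qed
      then show ?thesis using biq_rel_simps(1)[OF 1(2,3)] 1(1) by simp
    next
      case (2 x s t r)
      have run: "(x, s, t) \<in> hruns (swap_quad -` Q)" using 2 by simp
      have "- p (False, (x, s, t), r) = (\<Sum>i\<le>2. a (i, r) * x ^ i)"
      proof (rule quad_coeffs_eq[OF s.hrunsD(1)[OF run] _ 2(3)])
        fix y assume y: "s \<le> y" "y \<le> t"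
        have "K x y" using s.hrunsD(2)[OF run y] by (simp add: frame_sw)
        then show "(\<Sum>i\<le>2. - p (False, (x, s, t), i) * y ^ i) = (\<Sum>j\<le>2. (\<Sum>i\<le>2. a (i, j) * x ^ i) * y ^ j)"
          using a uv[OF 2(2), of y x] y unfolding biq_col by (simp add: sum_negf)
      qed
      then show ?thesis using biq_rel_simps(2)[OF 2(2,3), of a] 2(1) by simp
    qed
  qed
  then show ?thesis by (intro exI[of _ a]) (auto simp: a_def)
qed

text \<open>Besides the two horizontal sides of the rectangle there is the run through the crossing. A
biquadratic polynomial that vanishes on three horizontal lines is zero. (The four sides alone would
not suffice, because of the polynomial \<open>(x - a1) (x - a2) (y - b1) (y - b2)\<close>.)\<close>

lemma biq_rel_inj:
  assumes "(x0, y0) \<in> crosses Q"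
  shows "inj_on biq_rel {a. \<forall>v. v \<notin> {..2} \<times> {..2} \<longrightarrow> a v = 0}"
proof (rule inj_onI)
  fix a a' assume aa: "a \<in> {a. \<forall>v. v \<notin> {..2} \<times> {..2} \<longrightarrow> a v = 0}" "a' \<in> {a. \<forall>v. v \<notin> {..2} \<times> {..2} \<longrightarrow> a v = 0}"
    and eq: "biq_rel a = biq_rel a'"
  have y0: "b1 < y0" "y0 < b2" using crosses_interior[OF assms] by auto
  obtain s t where "(y0, s, t) \<in> hruns Q" using run_through[of x0 y0] assms unfolding crosses_def by blast
  moreover have "(b1, a1, a2) \<in> hruns Q" "(b2, a1, a2) \<in> hruns Q" using boundary_runs by auto
  ultimately have z: "\<exists>s t. (z, s, t) \<in> hruns Q" if "z \<in> {b1, y0, b2}" for z using that by blast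
  have "a (r, k) = a' (r, k)" if r: "r \<le> 2" and k: "k \<le> 2" for r k
  proof -
    have "(\<Sum>j\<le>2. a (r, j) * z ^ j) = (\<Sum>j\<le>2. a' (r, j) * z ^ j)" if z': "z \<in> {b1, y0, b2}" for z
    proof -
      obtain s t where "(z, s, t) \<in> hruns Q" using z[OF z'] by blast
      from biq_rel_simps(1)[OF this r, of a] biq_rel_simps(1)[OF this r, of a'] show ?thesis by (simp add: eq)
    qed
    then have "a (r, 0) - a' (r, 0) + (a (r, 1) - a' (r, 1)) * z + (a (r, 2) - a' (r, 2)) * z\<^sup>2 = 0" if "z \<in> {b1, y0, b2}" for z
      using that by (simp add: sum3 algebra_simps)
    from quad_coeffs_zero[OF this] y0
    have "a (r, 0) - a' (r, 0) = 0 \<and> a (r, 1) - a' (r, 1) = 0 \<and> a (r, 2) - a' (r, 2) = 0" by auto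
    moreover have "k = 0 \<or> k = 1 \<or> k = 2" using k by auto
    ultimately show ?thesis by auto
  qed
  then have "a v = a' v" for v using aa by (cases v; cases "v \<in> {..2} \<times> {..2}") auto
  then show "a = a'" by blast
qed

lemma hasdim_Rel:
  assumes "rigid K" "crosses Q \<noteq> {}" shows "hasdim (Rel (verts Q) (conds Q) incid) 9"
proof -
  let ?C = "{a :: nat \<times> nat \<Rightarrow> real. \<forall>v. v \<notin> {..2} \<times> {..2} \<longrightarrow> a v = 0}"
  obtain x0 y0 where x: "(x0, y0) \<in> crosses Q" using assms(2) by auto
  have "hasdim ?C (card ({..2::nat} \<times> {..2::nat}))" by (rule hasdim_supported) simp
  from hasdim_image[OF this linear_biq_rel biq_rel_inj[OF x]]
  have "hasdim (biq_rel ` ?C) 9" by (simp add: card_cartesian_product)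
  moreover have "biq_rel ` ?C = Rel (verts Q) (conds Q) incid"
    using Rel_biq[OF assms(1)] biq_rel_in by auto
  ultimately show ?thesis by simp
qed

lemma linear_spline_of: "linear (spline_of Q)"
  by (rule linearI) (auto simp: spline_of_def fun_eq_iff scaleR_fun_def sum.distrib algebra_simps sum_distrib_left)

lemma inj_spline_of: "inj_on (spline_of Q) (Ker (verts Q) (conds Q) incid)"
proof -
  obtain h where "mesh_width h" using mesh_width_exists by blast
  then show ?thesis by (intro inj_on_inverseI[of _ "coefs h"] coefs_spline_of) (auto simp: Ker_iff)
qed

end

context rect_mesh
begin

lemma spline_space_eq: "spline_space_bar S = spline_of Q ` Ker (verts Q) (conds Q) incid"
proof (intro equalityI subsetI)
  fix f assume "f \<in> spline_space_bar S"
  then have f: "C11 f" "\<forall>c\<in>S. biquadratic_on c f" "\<forall>p. p \<notin> region S \<longrightarrow> f p = 0" unfolding spline_space_bar_def by auto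
  have "spl f" unfolding spl_def
  proof (intro conjI allI impI)
    fix x1 x2 y1 y2 assume "(x1, x2, y1, y2) \<in> Q"
    then show "biquadratic_on (cbox (x1, y1) (x2, y2)) f" using f(2) quads_inj by blast
  next
    fix x y assume "\<not> (a1 \<le> x \<and> x \<le> a2 \<and> b1 \<le> y \<and> y \<le> b2)"
    then show "f (x, y) = 0" using f(3) unfolding region by auto
  qed (use f(1) in \<open>unfold C11_def, blast\<close>)+
  moreover obtain h where "mesh_width h" using mesh_width_exists by blast
  ultimately have "spline_of Q (coefs h f) = f" "coefs h f \<in> Ker (verts Q) (conds Q) incid"
    using spline_of_coefs coefs_hker coefs_hker_sw unfolding Ker_iff by (auto simp: coefs_def)
  then show "f \<in> spline_of Q ` Ker (verts Q) (conds Q) incid" by (metis imageI)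
next
  fix f assume "f \<in> spline_of Q ` Ker (verts Q) (conds Q) incid"
  then obtain c where c: "f = spline_of Q c" "hker Q c" "hker (swap_quad -` Q) (c \<circ> prod.swap)" by (auto simp: Ker_iff)
  show "f \<in> spline_space_bar S" unfolding spline_space_bar_def
  proof (intro CollectI conjI ballI allI impI)
    show "C11 f" unfolding c(1) by (rule C11_spline_of)
    show "biquadratic_on d f" if "d \<in> S" for d
      using cellE[OF that] spline_of_biquadratic[OF c(2,3)] unfolding c(1) by blast
    fix p assume "p \<notin> region S"
    then show "f p = 0" unfolding c(1) region using spline_of_outside[OF c(2,3)] by (cases p) auto
  qed
qed

text \<open>With \<open>V\<close> crossings and \<open>E\<close> interior runs there are \<open>V + 2 E + 4\<close> vertex coefficients and
\<open>3 (E + 4)\<close> conditions with a space of relations of dimension \<open>9\<close>.\<close>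

theorem dimension:
  assumes "rigid K" "crosses Q \<noteq> {}"
  shows "(\<exists>B. finite B \<and> span B = spline_space_bar S) \<and>
         int (dim (spline_space_bar S)) =
           int (card (crossing_vertices S)) - int (card (interior_l_edges S)) + 1"
proof -
  obtain d e where de: "hasdim (Ker (verts Q) (conds Q) incid) d" "hasdim (Rel (verts Q) (conds Q) incid) e"
    "d + card (conds Q) = e + card (verts Q)" using kernel_relation_index[OF finite_conds finite_verts, of incid] by (elim exE conjE)
  have "e = 9" using hasdim_dim[OF de(2)] hasdim_dim[OF hasdim_Rel[OF assms]] by simp
  then have d: "d + 3 * (card ihruns + 2) + 3 * (card ivruns + 2) = 9 + (card (crosses Q) + 2 * card ihruns + 2 * card ivruns + 4)"
    using de(3) unfolding card_conds card_verts by simp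
  have h: "hasdim (spline_space_bar S) d"
    unfolding spline_space_eq by (rule hasdim_image[OF de(1) linear_spline_of inj_spline_of])
  then have "\<exists>B. finite B \<and> span B = spline_space_bar S" unfolding hasdim_def by blast
  moreover have "int (dim (spline_space_bar S)) = int (card (crossing_vertices S)) - int (card (interior_l_edges S)) + 1"
    using hasdim_dim[OF h] d unfolding crossing_eq card_interior_l_edges by simp
  ultimately show ?thesis ..
qed

end

section \<open>Refinement of families of cells\<close>

fun child :: "quad \<Rightarrow> quad \<Rightarrow> bool"
  where "child (x1, x2, y1, y2) (u1, u2, v1, v2) \<longleftrightarrow>
    (u1 = x1 \<and> u2 = (x1 + x2) / 2 \<or> u1 = (x1 + x2) / 2 \<and> u2 = x2) \<and>
    (v1 = y1 \<and> v2 = (y1 + y2) / 2 \<or> v1 = (y1 + y2) / 2 \<and> v2 = y2)"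

definition children :: "quad set \<Rightarrow> quad set"
  where "children C = {s. \<exists>c\<in>C. child c s}"

definition refine_by :: "quad set \<Rightarrow> quad set \<Rightarrow> quad set" where "refine_by T C = (T - C) \<union> children C"

text \<open>One level of refinement. The first component of a pair is the whole family of cells, the second one
consists of the cells of the current level, and only these may be subdivided.\<close>

definition refines :: "quad set \<times> quad set \<Rightarrow> quad set \<times> quad set \<Rightarrow> bool"
  where "refines P P' \<longleftrightarrow> (\<exists>C \<subseteq> snd P. P' = (refine_by (fst P) C, children C))"

lemma child_sw: "child c (swap_quad s) \<longleftrightarrow> child (swap_quad c) s"
  by (cases c; cases s) auto

lemma child_rf: "child c (reflect_quad s) \<longleftrightarrow> child (reflect_quad c) s"
  by (cases c; cases s) (auto simp: field_simps)

lemma sw_sw_id [simp]: "swap_quad (swap_quad c) = c" by (cases c) auto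
lemma rf_rf_id [simp]: "reflect_quad (reflect_quad c) = c" by (cases c) auto

lemma children_sw: "children (swap_quad -` C) = swap_quad -` children C"
proof -
  have "(\<exists>c\<in>swap_quad -` C. child c s) \<longleftrightarrow> (\<exists>c\<in>C. child c (swap_quad s))" for s
    unfolding child_sw by (metis sw_sw_id vimage_eq)
  then show ?thesis unfolding children_def by auto
qed

lemma children_rf: "children (reflect_quad -` C) = reflect_quad -` children C"
proof -
  have "(\<exists>c\<in>reflect_quad -` C. child c s) \<longleftrightarrow> (\<exists>c\<in>C. child c (reflect_quad s))" for s
    unfolding child_rf by (metis rf_rf_id vimage_eq)
  then show ?thesis unfolding children_def by auto
qed

lemma refine_by_sw: "refine_by (swap_quad -` T) (swap_quad -` C) = swap_quad -` refine_by T C"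
  and refine_by_rf: "refine_by (reflect_quad -` T) (reflect_quad -` C) = reflect_quad -` refine_by T C"
  unfolding refine_by_def children_sw children_rf by auto

definition disjoint_cells :: "quad set \<Rightarrow> quad set \<Rightarrow> bool"
  where "disjoint_cells T A \<longleftrightarrow> A \<subseteq> T \<and> (\<forall>x1 x2 y1 y2. (x1, x2, y1, y2) \<in> T \<longrightarrow> x1 < x2 \<and> y1 < y2) \<and>
    (\<forall>x1 x2 y1 y2 u1 u2 v1 v2. (x1, x2, y1, y2) \<in> T \<longrightarrow> (u1, u2, v1, v2) \<in> T \<longrightarrow>
       x1 < u2 \<longrightarrow> u1 < x2 \<longrightarrow> y1 < v2 \<longrightarrow> v1 < y2 \<longrightarrow> x1 = u1 \<and> x2 = u2 \<and> y1 = v1 \<and> y2 = v2)"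

lemma disjoint_cellsD:
  assumes "disjoint_cells T A"
  shows "A \<subseteq> T" "(x1, x2, y1, y2) \<in> T \<Longrightarrow> x1 < x2 \<and> y1 < y2"
    "\<lbrakk>(x1, x2, y1, y2) \<in> T; (u1, u2, v1, v2) \<in> T; x1 < u2; u1 < x2; y1 < v2; v1 < y2\<rbrakk> \<Longrightarrow>
      x1 = u1 \<and> x2 = u2 \<and> y1 = v1 \<and> y2 = v2"
  using assms unfolding disjoint_cells_def by blast+

lemma disjoint_cells_sw: "disjoint_cells T A \<Longrightarrow> disjoint_cells (swap_quad -` T) (swap_quad -` A)"
proof -
  assume w: "disjoint_cells T A"
  show ?thesis unfolding disjoint_cells_def
  proof (intro conjI allI impI)
    fix x1 x2 y1 y2 u1 u2 v1 v2
    assume "(x1, x2, y1, y2) \<in> swap_quad -` T" "(u1, u2, v1, v2) \<in> swap_quad -` T" "x1 < u2" "u1 < x2" "y1 < v2" "v1 < y2"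
    then have *: "y1 = v1 \<and> y2 = v2 \<and> x1 = u1 \<and> x2 = u2" by (intro disjoint_cellsD(3)[OF w]) auto
    then show "x1 = u1" "x2 = u2" "y1 = v1" "y2 = v2" by auto
  qed (use disjoint_cellsD(1,2)[OF w] in force)+
qed

lemma disjoint_cells_rf: "disjoint_cells T A \<Longrightarrow> disjoint_cells (reflect_quad -` T) (reflect_quad -` A)"
proof -
  assume w: "disjoint_cells T A"
  show ?thesis unfolding disjoint_cells_def
  proof (intro conjI allI impI)
    fix x1 x2 y1 y2 u1 u2 v1 v2
    assume "(x1, x2, y1, y2) \<in> reflect_quad -` T" "(u1, u2, v1, v2) \<in> reflect_quad -` T" "x1 < u2" "u1 < x2" "y1 < v2" "v1 < y2"
    then have *: "- x2 = - u2 \<and> - x1 = - u1 \<and> y1 = v1 \<and> y2 = v2" by (intro disjoint_cellsD(3)[OF w]) auto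
    then show "x1 = u1" "x2 = u2" "y1 = v1" "y2 = v2" by auto
  qed (use disjoint_cellsD(1,2)[OF w] in force)+
qed

lemma child_bounds:
  assumes "child (x1, x2, y1, y2) (u1, u2, v1, v2)" "x1 < x2" "y1 < y2"
  shows "x1 \<le> u1 \<and> u1 < u2 \<and> u2 \<le> x2 \<and> y1 \<le> v1 \<and> v1 < v2 \<and> v2 \<le> y2"
  using assms by auto

lemma kept_not_child:
  assumes w: "disjoint_cells T A" and C: "C \<subseteq> A" and q: "q \<in> T - C" shows "q \<notin> children C"
proof
  assume "q \<in> children C"
  then obtain c where c: "c \<in> C" "child c q" unfolding children_def by blast
  obtain x1 x2 y1 y2 u1 u2 v1 v2 where e: "c = (x1, x2, y1, y2)" "q = (u1, u2, v1, v2)" by (metis surj_pair)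
  have cT: "(x1, x2, y1, y2) \<in> T" "(u1, u2, v1, v2) \<in> T" using c(1) C disjoint_cellsD(1)[OF w] q e by auto
  have b: "x1 \<le> u1 \<and> u1 < u2 \<and> u2 \<le> x2 \<and> y1 \<le> v1 \<and> v1 < v2 \<and> v2 \<le> y2"
    using child_bounds c(2) disjoint_cellsD(2)[OF w cT(1)] e by blast
  have "x1 = u1 \<and> x2 = u2 \<and> y1 = v1 \<and> y2 = v2" using disjoint_cellsD(3)[OF w cT] b by auto
  then have "c = q" using e by simp
  then show False using c(1) q by blast
qed

lemma children_overlap:
  assumes "child (x1, x2, y1, y2) (u1, u2, v1, v2)" "child (x1, x2, y1, y2) (u1', u2', v1', v2')"
    "x1 < x2" "y1 < y2" "u1 < u2'" "u1' < u2" "v1 < v2'" "v1' < v2"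
  shows "u1 = u1' \<and> u2 = u2' \<and> v1 = v1' \<and> v2 = v2'"
  using assms by (auto simp: field_simps)

lemma disjoint_cells_step:
  assumes w: "disjoint_cells T A" and C: "C \<subseteq> A" shows "disjoint_cells (refine_by T C) (children C)"
proof -
  have parent: "\<exists>x1 x2 y1 y2. (x1, x2, y1, y2) \<in> C \<and> (x1, x2, y1, y2) \<in> T \<and> child (x1, x2, y1, y2) (u1, u2, v1, v2) \<and>
      x1 < x2 \<and> y1 < y2 \<and> x1 \<le> u1 \<and> u1 < u2 \<and> u2 \<le> x2 \<and> y1 \<le> v1 \<and> v1 < v2 \<and> v2 \<le> y2"
    if s: "(u1, u2, v1, v2) \<in> children C" for u1 u2 v1 v2
  proof -
    obtain c where c: "c \<in> C" "child c (u1, u2, v1, v2)" using s unfolding children_def by blast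
    obtain x1 x2 y1 y2 where e: "c = (x1, x2, y1, y2)" by (metis surj_pair)
    have cT: "(x1, x2, y1, y2) \<in> T" using c(1) C disjoint_cellsD(1)[OF w] e by auto
    have lt: "x1 < x2" "y1 < y2" using disjoint_cellsD(2)[OF w cT] by auto
    then show ?thesis using child_bounds[OF _ lt, of u1 u2 v1 v2] c e cT by blast
  qed
  \<comment> \<open>a kept cell that overlapped a quarter would overlap its parent, hence be the parent\<close>
  have mixed: "(u1, u2, v1, v2) = (w1, w2, z1, z2)"
    if a: "(u1, u2, v1, v2) \<in> T - C" "(w1, w2, z1, z2) \<in> children C" "u1 < w2" "w1 < u2" "v1 < z2" "z1 < v2" for u1 u2 v1 v2 w1 w2 z1 z2
  proof -
    obtain x1 x2 y1 y2 where p: "(x1, x2, y1, y2) \<in> C" "(x1, x2, y1, y2) \<in> T" 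
      "x1 \<le> w1 \<and> w1 < w2 \<and> w2 \<le> x2 \<and> y1 \<le> z1 \<and> z1 < z2 \<and> z2 \<le> y2"
      using parent[OF a(2)] by blast
    have "u1 = x1 \<and> u2 = x2 \<and> v1 = y1 \<and> v2 = y2" using a p by (intro disjoint_cellsD(3)[OF w]) auto
    then show ?thesis using p(1) a(1) by simp
  qed
  show ?thesis unfolding disjoint_cells_def
  proof (intro conjI allI impI)
    show "children C \<subseteq> refine_by T C" unfolding refine_by_def by blast
    fix x1 x2 y1 y2 assume "(x1, x2, y1, y2) \<in> refine_by T C"
    then show "x1 < x2" "y1 < y2" unfolding refine_by_def using disjoint_cellsD(2)[OF w, of x1 x2 y1 y2] parent[of x1 x2 y1 y2] by blast+
  next
    fix u1 u2 v1 v2 w1 w2 z1 z2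
    assume a: "(u1, u2, v1, v2) \<in> refine_by T C" "(w1, w2, z1, z2) \<in> refine_by T C" "u1 < w2" "w1 < u2" "v1 < z2" "z1 < v2"
    have "(u1, u2, v1, v2) = (w1, w2, z1, z2)"
    proof (cases "(u1, u2, v1, v2) \<in> children C")
      case True
      show ?thesis
      proof (cases "(w1, w2, z1, z2) \<in> children C")
        case T2: True
        obtain x1 x2 y1 y2 where p: "(x1, x2, y1, y2) \<in> C" "(x1, x2, y1, y2) \<in> T" "child (x1, x2, y1, y2) (u1, u2, v1, v2)" "x1 < x2" "y1 < y2"
          "x1 \<le> u1 \<and> u1 < u2 \<and> u2 \<le> x2 \<and> y1 \<le> v1 \<and> v1 < v2 \<and> v2 \<le> y2"
          using parent[OF True] by blast
        obtain x1' x2' y1' y2' where p': "(x1', x2', y1', y2') \<in> C" "(x1', x2', y1', y2') \<in> T" "child (x1', x2', y1', y2') (w1, w2, z1, z2)"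
          "x1' \<le> w1 \<and> w1 < w2 \<and> w2 \<le> x2' \<and> y1' \<le> z1 \<and> z1 < z2 \<and> z2 \<le> y2'"
          using parent[OF T2] by blast
        have "x1 = x1' \<and> x2 = x2' \<and> y1 = y1' \<and> y2 = y2'" using a p p' by (intro disjoint_cellsD(3)[OF w]) auto
        then show ?thesis using children_overlap[of x1 x2 y1 y2 u1 u2 v1 v2 w1 w2 z1 z2] p p' a by auto
      next
        case False
        then have "(w1, w2, z1, z2) \<in> T - C" using a(2) unfolding refine_by_def by blast
        from mixed[OF this True] a show ?thesis by simp
      qed
    next
      case False
      then have f: "(u1, u2, v1, v2) \<in> T - C" using a(1) unfolding refine_by_def by blast
      show ?thesis
      proof (cases "(w1, w2, z1, z2) \<in> children C")
        case True
        from mixed[OF f True] a show ?thesis by simp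
      next
        case F2: False
        then have "(w1, w2, z1, z2) \<in> T" using a(2) unfolding refine_by_def by blast
        then show ?thesis using disjoint_cellsD(3)[OF w, of u1 u2 v1 v2 w1 w2 z1 z2] f a by auto
      qed
    qed
    then show "u1 = w1" "u2 = w2" "v1 = z1" "v2 = z2" by auto
  qed
qed

text \<open>The invariant of the refinement for the east sides of the active cells; \<open>e\<close> is the abscissa of the
east side of the rectangle. The cell beyond such a side is either of the same level and of the same
height, or it covers the side and, being inactive, will never be subdivided again. In particular
there is never a hanging vertex on a side of an active cell.\<close>

definition adj :: "quad set \<Rightarrow> quad set \<Rightarrow> real \<Rightarrow> bool"
  where "adj T A e \<longleftrightarrow> (\<forall>x1 x2 y1 y2. (x1, x2, y1, y2) \<in> A \<longrightarrow> x2 = e \<or> (\<exists>x3. (x2, x3, y1, y2) \<in> A) \<or>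
     (\<exists>x3 v1 v2. (x2, x3, v1, v2) \<in> T - A \<and> v1 \<le> y1 \<and> y2 \<le> v2))"

text \<open>A western quarter borders on its sibling. An eastern quarter inherits the neighbour of its parent: if
that neighbour is subdivided as well, one of its quarters, and otherwise the neighbour itself, which
is then kept for ever.\<close>

lemma adj_step:
  assumes w: "disjoint_cells T A" and a: "adj T A e" and C: "C \<subseteq> A" shows "adj (refine_by T C) (children C) e"
  unfolding adj_def
proof (intro allI impI)
  fix u1 u2 v1 v2 assume "(u1, u2, v1, v2) \<in> children C"
  then obtain c where c: "c \<in> C" "child c (u1, u2, v1, v2)" unfolding children_def by blast
  obtain x1 x2 y1 y2 where e: "c = (x1, x2, y1, y2)" by (metis surj_pair)
  note ch = c(2)[unfolded e]
  have cA: "(x1, x2, y1, y2) \<in> A" "(x1, x2, y1, y2) \<in> T" using c(1) C disjoint_cellsD(1)[OF w] e by auto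
  have lt: "x1 < x2" "y1 < y2" using disjoint_cellsD(2)[OF w cA(2)] by auto
  have b: "y1 \<le> v1" "v2 \<le> y2" using child_bounds[OF ch lt] by auto
  have kept: "q \<in> refine_by T C - children C" if "q \<in> T - C" for q
    using kept_not_child[OF w C that] that unfolding refine_by_def by blast
  show "u2 = e \<or> (\<exists>x3. (u2, x3, v1, v2) \<in> children C) \<or>
     (\<exists>x3 w1 w2. (u2, x3, w1, w2) \<in> refine_by T C - children C \<and> w1 \<le> v1 \<and> v2 \<le> w2)"
  proof (cases "u2 = x2")
    case False
    then have "u2 = (x1 + x2) / 2" using ch by auto
    then have "child c (u2, x2, v1, v2)" using ch e by auto
    then show ?thesis using c(1) unfolding children_def by blast
  next
    case True
    consider "x2 = e" | x3 where "(x2, x3, y1, y2) \<in> C" | x3 where "(x2, x3, y1, y2) \<in> T - C"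
      | x3 w1 w2 where "(x2, x3, w1, w2) \<in> T - A" "w1 \<le> y1" "y2 \<le> w2"
      using a cA(1) disjoint_cellsD(1)[OF w] unfolding adj_def by blast
    then show ?thesis
    proof cases
      case (2 x3)
      then have "child (x2, x3, y1, y2) (u2, (x2 + x3) / 2, v1, v2)" using ch True by auto
      then show ?thesis using 2 unfolding children_def by blast
    next
      case (3 x3) then show ?thesis using kept[OF 3] b True by blast
    next
      case (4 x3 w1 w2)
      then have "(x2, x3, w1, w2) \<in> T - C" using C by blast
      from kept[OF this] show ?thesis using 4 b True by (meson order_trans)
    qed (use True in simp)
  qed
qed

definition adj4 :: "quad set \<Rightarrow> quad set \<Rightarrow> real \<Rightarrow> real \<Rightarrow> real \<Rightarrow> real \<Rightarrow> bool"
  where "adj4 T A a1 a2 b1 b2 \<longleftrightarrow> adj T A a2 \<and> adj (reflect_quad -` T) (reflect_quad -` A) (- a1) \<and> adj (swap_quad -` T) (swap_quad -` A) b2 \<and>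
    adj (reflect_quad -` swap_quad -` T) (reflect_quad -` swap_quad -` A) (- b1)"

lemma adj4_step:
  assumes w: "disjoint_cells T A" and a: "adj4 T A a1 a2 b1 b2" and C: "C \<subseteq> A"
  shows "adj4 (refine_by T C) (children C) a1 a2 b1 b2"
proof -
  have C': "reflect_quad -` C \<subseteq> reflect_quad -` A" "swap_quad -` C \<subseteq> swap_quad -` A" "reflect_quad -` swap_quad -` C \<subseteq> reflect_quad -` swap_quad -` A" using C by auto
  show ?thesis
    using adj_step[OF w _ C] adj_step[OF disjoint_cells_rf[OF w] _ C'(1)] adj_step[OF disjoint_cells_sw[OF w] _ C'(2)]
      adj_step[OF disjoint_cells_rf[OF disjoint_cells_sw[OF w]] _ C'(3)] a
    unfolding adj4_def refine_by_rf refine_by_sw children_rf children_sw by blast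
qed

lemma frame_child:
  assumes "(x1, x2, y1, y2) \<in> C" "x1 < x2" "y1 < y2" "x1 \<le> x" "x \<le> x2" "y1 \<le> y" "y \<le> y2"
    "x = x1 \<or> x = x2 \<or> x = (x1 + x2) / 2 \<or> y = y1 \<or> y = y2 \<or> y = (y1 + y2) / 2"
  shows "frame (refine_by T C) x y"
proof -
  define xm where "xm = (x1 + x2) / 2"
  define ym where "ym = (y1 + y2) / 2"
  have m: "x1 < xm" "xm < x2" "y1 < ym" "ym < y2" unfolding xm_def ym_def using assms(2,3) by auto
  have ch: "child (x1, x2, y1, y2) (u1, u2, v1, v2) \<Longrightarrow> (u1, u2, v1, v2) \<in> refine_by T C" for u1 u2 v1 v2
    using assms(1) unfolding refine_by_def children_def by blast
  have c4: "(x1, xm, y1, ym) \<in> refine_by T C" "(xm, x2, y1, ym) \<in> refine_by T C" "(x1, xm, ym, y2) \<in> refine_by T C" "(xm, x2, ym, y2) \<in> refine_by T C"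
    by (auto intro!: ch simp: xm_def ym_def)
  have s: "x = x1 \<or> x = x2 \<or> x = xm \<or> y = y1 \<or> y = y2 \<or> y = ym" using assms(8) unfolding xm_def ym_def .
  obtain u1 u2 v1 v2 where q: "(u1, u2, v1, v2) \<in> refine_by T C" "u1 \<le> x" "x \<le> u2" "v1 \<le> y" "y \<le> v2"
    "{u1, u2} \<subseteq> {x1, xm, x2}" "{v1, v2} \<subseteq> {y1, ym, y2}" "u1 < u2" "v1 < v2"
    "x1 \<le> u1" "u2 \<le> x2" "y1 \<le> v1" "v2 \<le> y2" "xm \<le> u1 \<or> u2 \<le> xm" "ym \<le> v1 \<or> v2 \<le> ym"
    using c4 m assms(4-7) by (cases "x \<le> xm"; cases "y \<le> ym") auto
  have "\<not> (u1 < x \<and> x < u2 \<and> v1 < y \<and> y < v2)" using s q m by auto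
  then show ?thesis unfolding frame_def using q(1-5) by blast
qed

lemma frame_mono_step:
  assumes w: "disjoint_cells T A" and C: "C \<subseteq> A" and f: "frame T x y" shows "frame (refine_by T C) x y"
proof -
  obtain x1 x2 y1 y2 where q: "(x1, x2, y1, y2) \<in> T" "x1 \<le> x" "x \<le> x2" "y1 \<le> y" "y \<le> y2"
    "\<not> (x1 < x \<and> x < x2 \<and> y1 < y \<and> y < y2)" using f unfolding frame_def by blast
  show ?thesis
  proof (cases "(x1, x2, y1, y2) \<in> C")
    case True
    then show ?thesis using frame_child[OF True, of x y T] disjoint_cellsD(2)[OF w q(1)] q by auto
  next
    case False
    then have "(x1, x2, y1, y2) \<in> refine_by T C" using q(1) unfolding refine_by_def by blast
    then show ?thesis unfolding frame_def using q by blast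
  qed
qed

lemma frame_step_cases:
  assumes w: "disjoint_cells T A" and C: "C \<subseteq> A" and f: "frame (refine_by T C) x y"
  shows "frame T x y \<or> (\<exists>x1 x2 y1 y2. (x1, x2, y1, y2) \<in> C \<and> x1 \<le> x \<and> x \<le> x2 \<and> y1 \<le> y \<and> y \<le> y2 \<and>
    (x = (x1 + x2) / 2 \<or> y = (y1 + y2) / 2))"
proof -
  obtain u1 u2 v1 v2 where q: "(u1, u2, v1, v2) \<in> refine_by T C" "u1 \<le> x" "x \<le> u2" "v1 \<le> y" "y \<le> v2"
    "\<not> (u1 < x \<and> x < u2 \<and> v1 < y \<and> y < v2)" using f unfolding frame_def by blast
  show ?thesis
  proof (cases "(u1, u2, v1, v2) \<in> children C")
    case False
    then have "(u1, u2, v1, v2) \<in> T" using q(1) unfolding refine_by_def by blast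
    then show ?thesis using q unfolding frame_def by blast
  next
    case True
    then obtain c where c: "c \<in> C" "child c (u1, u2, v1, v2)" unfolding children_def by blast
    obtain x1 x2 y1 y2 where e: "c = (x1, x2, y1, y2)" by (metis surj_pair)
    note ch = c(2)[unfolded e]
    have cA: "(x1, x2, y1, y2) \<in> T" "(x1, x2, y1, y2) \<in> C" using c(1) C disjoint_cellsD(1)[OF w] e by auto
    have lt: "x1 < x2" "y1 < y2" using disjoint_cellsD(2)[OF w cA(1)] by auto
    have b: "x1 \<le> x" "x \<le> x2" "y1 \<le> y" "y \<le> y2" using child_bounds[OF ch lt] q by auto
    have "x = u1 \<or> x = u2 \<or> y = v1 \<or> y = v2" using q by auto
    then have "(x = x1 \<or> x = x2 \<or> y = y1 \<or> y = y2) \<or> (x = (x1 + x2) / 2 \<or> y = (y1 + y2) / 2)"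
      using ch by auto
    then show ?thesis
    proof
      assume "x = x1 \<or> x = x2 \<or> y = y1 \<or> y = y2"
      then have "\<not> (x1 < x \<and> x < x2 \<and> y1 < y \<and> y < y2)" by auto
      then show ?thesis using cA(1) b unfolding frame_def by blast
    qed (use cA(2) b in blast)
  qed
qed

text \<open>Cells that are not active are never touched again, and skeletons only grow.\<close>

lemma persistence:
  assumes "refines\<^sup>*\<^sup>* (T, A) (Q, B)" "disjoint_cells T A"
  shows "T - A \<subseteq> Q \<and> (\<forall>x y. frame T x y \<longrightarrow> frame Q x y)"
  using assms
proof (induction "(T, A)" arbitrary: T A rule: converse_rtranclp_induct)
  case base then show ?case by blast
next
  case (step P)
  obtain C where C: "C \<subseteq> A" "P = (refine_by T C, children C)" using step.hyps(1) unfolding refines_def by auto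
  have "refine_by T C - children C \<subseteq> Q \<and> (\<forall>x y. frame (refine_by T C) x y \<longrightarrow> frame Q x y)"
    by (rule step.hyps(3)[OF C(2) disjoint_cells_step[OF step.prems C(1)]])
  moreover have "T - A \<subseteq> refine_by T C - children C"
    using kept_not_child[OF step.prems C(1)] C(1) unfolding refine_by_def by blast
  ultimately show ?case using frame_mono_step[OF step.prems C(1)] by blast
qed

lemma kept_in_final:
  assumes "refines\<^sup>*\<^sup>* (refine_by T C, children C) (Q, B)" "disjoint_cells T A" "C \<subseteq> A" shows "T - C \<subseteq> Q"
proof -
  have "refine_by T C - children C \<subseteq> Q" using persistence[OF assms(1) disjoint_cells_step[OF assms(2,3)]] by blast
  then show ?thesis using kept_not_child[OF assms(2,3)] unfolding refine_by_def by blast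
qed


section \<open>Functions that are quadratic along segments and their zeros\<close>

lemma segmentwise_swap: "segmentwise K u \<Longrightarrow> segmentwise (\<lambda>x y. K y x) (\<lambda>x y. u y x)"
  unfolding segmentwise_def by blast

lemma segment_zero:
  assumes "segmentwise K u" "\<And>x. s \<le> x \<Longrightarrow> x \<le> t \<Longrightarrow> K x y" "u p y = 0" "u q y = 0" "u r y = 0"
    "p < q" "q < r" "s \<le> p" "r \<le> t" "s \<le> x" "x \<le> t"
  shows "u x y = 0"
proof -
  have "s < t" using assms(6-9) by linarith
  then have "quad_on {s..t} (\<lambda>x. u x y)" using assms(1,2) unfolding segmentwise_def by blast
  then show ?thesis by (rule quad_on_three_zeros[of _ _ p q r]) (use assms in auto)
qed

definition zero_on :: "quad set \<Rightarrow> (real \<Rightarrow> real \<Rightarrow> real) \<Rightarrow> bool"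
  where "zero_on T u \<longleftrightarrow> (\<forall>x y. frame T x y \<longrightarrow> u x y = 0)"

lemma box_frame:
  assumes "(x1, x2, y1, y2) \<in> T" "x1 < x2" "y1 < y2" 
  shows "y1 \<le> y \<Longrightarrow> y \<le> y2 \<Longrightarrow> frame T x1 y \<and> frame T x2 y" "x1 \<le> x \<Longrightarrow> x \<le> x2 \<Longrightarrow> frame T x y1 \<and> frame T x y2"
  using assms unfolding frame_def by (metis less_irrefl less_imp_le order_refl)+


text \<open>The midlines of a subdivided cell. A quadratic with three zeros on a segment vanishes there. If the
horizontal midline, possibly prolonged, carries three zeros, then the centre is a zero, and with the
two ends of the vertical midline this gives three zeros on that one too.\<close>

lemma cross_zero:
  assumes sw: "segmentwise K u" and lt: "x1 < x2" "y1 < y2"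
    and row: "\<And>x. s \<le> x \<Longrightarrow> x \<le> t \<Longrightarrow> K x ((y1 + y2) / 2)" "s \<le> x1" "x2 \<le> t"
    and col: "\<And>y. y1 \<le> y \<Longrightarrow> y \<le> y2 \<Longrightarrow> K ((x1 + x2) / 2) y"
    and z: "u p ((y1 + y2) / 2) = 0" "u q ((y1 + y2) / 2) = 0" "u r ((y1 + y2) / 2) = 0" "p < q" "q < r" "s \<le> p" "r \<le> t"
    and zc: "u ((x1 + x2) / 2) y1 = 0" "u ((x1 + x2) / 2) y2 = 0"
  shows "(\<forall>x. x1 \<le> x \<and> x \<le> x2 \<longrightarrow> u x ((y1 + y2) / 2) = 0) \<and> (\<forall>y. y1 \<le> y \<and> y \<le> y2 \<longrightarrow> u ((x1 + x2) / 2) y = 0)"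
proof -
  have h: "u x ((y1 + y2) / 2) = 0" if "s \<le> x" "x \<le> t" for x
    by (rule segment_zero[OF sw row(1) z that])
  have c: "u ((x1 + x2) / 2) ((y1 + y2) / 2) = 0" by (rule h) (use row(2,3) lt in auto)
  have "u ((x1 + x2) / 2) y = 0" if "y1 \<le> y" "y \<le> y2" for y
    by (rule segment_zero[OF segmentwise_swap[OF sw], of y1 y2 _ y1 "(y1 + y2) / 2" y2]) (use col zc c lt that in auto)
  then show ?thesis using h row(2,3) by auto
qed

definition cross_vanishes :: "(real \<Rightarrow> real \<Rightarrow> real) \<Rightarrow> real \<Rightarrow> real \<Rightarrow> real \<Rightarrow> real \<Rightarrow> bool"
  where "cross_vanishes u x1 x2 y1 y2 \<longleftrightarrow> (\<forall>x. x1 \<le> x \<and> x \<le> x2 \<longrightarrow> u x ((y1 + y2) / 2) = 0) \<and>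
    (\<forall>y. y1 \<le> y \<and> y \<le> y2 \<longrightarrow> u ((x1 + x2) / 2) y = 0)"

lemma zero_step:
  assumes "disjoint_cells T A" "C \<subseteq> A" "zero_on T u" "\<And>x1 x2 y1 y2. (x1, x2, y1, y2) \<in> C \<Longrightarrow> cross_vanishes u x1 x2 y1 y2"
  shows "zero_on (refine_by T C) u"
  unfolding zero_on_def
proof (intro allI impI)
  fix x y assume "frame (refine_by T C) x y"
  from frame_step_cases[OF assms(1,2) this] show "u x y = 0"
    using assms(3,4) unfolding zero_on_def cross_vanishes_def by blast
qed

context rect_partition
begin

lemma cell_blocks_east: "(x, x3, v1, v2) \<in> Q \<Longrightarrow> v1 < y \<Longrightarrow> y < v2 \<Longrightarrow> \<not> east K x y"
proof
  assume q: "(x, x3, v1, v2) \<in> Q" "v1 < y" "y < v2" and "east K x y"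
  then obtain e where e: "e > 0" "\<forall>t. x \<le> t \<and> t \<le> x + e \<longrightarrow> K t y" unfolding east_def by blast
  define t where "t = min (x + e) ((x + x3) / 2)"
  have "x < x3" using cell[OF q(1)] by auto
  then have "x < t" "t < x3" "t \<le> x + e" unfolding t_def using e(1) by (auto simp: min_def)
  then show False using inside_not_K[OF q(1), of t y] q e(2) by auto
qed

lemma side:
  assumes a: "adj T A a2" and A: "A \<subseteq> T" and k: "T - C \<subseteq> Q" and C: "C \<subseteq> A" and c: "(x1, x2, y1, y2) \<in> C"
  shows "(\<exists>x3. (x2, x3, y1, y2) \<in> C) \<or> (\<forall>y. y1 < y \<and> y < y2 \<longrightarrow> \<not> east K x2 y)"
proof -
  have "(x1, x2, y1, y2) \<in> A" using c C by blast
  then consider "x2 = a2" | x3 where "(x2, x3, y1, y2) \<in> C" | x3 where "(x2, x3, y1, y2) \<in> A - C"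
      | x3 w1 w2 where "(x2, x3, w1, w2) \<in> T - A" "w1 \<le> y1" "y2 \<le> w2" using a unfolding adj_def by blast
  then show ?thesis
  proof cases
    case 1 then show ?thesis using dir_region(1) by fastforce
  next
    case 2 then show ?thesis by blast
  next
    case 3
    then have "(x2, x3, y1, y2) \<in> Q" using k A by blast
    then show ?thesis using cell_blocks_east by blast
  next
    case 4
    then have "(x2, x3, w1, w2) \<in> Q" using k C by blast
    then show ?thesis using cell_blocks_east 4 by (meson le_less_trans less_le_trans)
  qed
qed

text \<open>What the adjacency invariant means in the final partition. A neighbour that is not subdivided along
with the cell is a cell of the final partition, and the skeleton does not enter its interior.\<close>

lemma sides:
  assumes a: "adj4 T A a1 a2 b1 b2" and A: "A \<subseteq> T" and k: "T - C \<subseteq> Q" and C: "C \<subseteq> A" and c: "(x1, x2, y1, y2) \<in> C"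
  shows "(\<exists>x3. (x2, x3, y1, y2) \<in> C) \<or> (\<forall>y. y1 < y \<and> y < y2 \<longrightarrow> \<not> east K x2 y)"
    "(\<exists>x3. (x3, x1, y1, y2) \<in> C) \<or> (\<forall>y. y1 < y \<and> y < y2 \<longrightarrow> \<not> west K x1 y)"
    "(\<exists>y3. (x1, x2, y2, y3) \<in> C) \<or> (\<forall>x. x1 < x \<and> x < x2 \<longrightarrow> \<not> north K x y2)"
    "(\<exists>y3. (x1, x2, y3, y1) \<in> C) \<or> (\<forall>x. x1 < x \<and> x < x2 \<longrightarrow> \<not> south K x y1)"
proof -
  show "(\<exists>x3. (x2, x3, y1, y2) \<in> C) \<or> (\<forall>y. y1 < y \<and> y < y2 \<longrightarrow> \<not> east K x2 y)"
    using side[OF _ A k C c] a unfolding adj4_def by blast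
  have s1: "reflect_quad -` A \<subseteq> reflect_quad -` T" "reflect_quad -` T - reflect_quad -` C \<subseteq> reflect_quad -` Q" "reflect_quad -` C \<subseteq> reflect_quad -` A" "(-x2, -x1, y1, y2) \<in> reflect_quad -` C"
    using A k C c by auto
  have "(\<exists>x3. (-x1, x3, y1, y2) \<in> reflect_quad -` C) \<or> (\<forall>y. y1 < y \<and> y < y2 \<longrightarrow> \<not> east (frame (reflect_quad -` Q)) (-x1) y)"
    using rect_partition.side[OF reflected _ s1] a unfolding adj4_def by blast
  then show "(\<exists>x3. (x3, x1, y1, y2) \<in> C) \<or> (\<forall>y. y1 < y \<and> y < y2 \<longrightarrow> \<not> west K x1 y)"
    by (auto simp: frame_rf)
  have s2: "swap_quad -` A \<subseteq> swap_quad -` T" "swap_quad -` T - swap_quad -` C \<subseteq> swap_quad -` Q" "swap_quad -` C \<subseteq> swap_quad -` A" "(y1, y2, x1, x2) \<in> swap_quad -` C"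
    using A k C c by auto
  have "(\<exists>y3. (y2, y3, x1, x2) \<in> swap_quad -` C) \<or> (\<forall>x. x1 < x \<and> x < x2 \<longrightarrow> \<not> east (frame (swap_quad -` Q)) y2 x)"
    using rect_partition.side[OF swapped _ s2] a unfolding adj4_def by blast
  then show "(\<exists>y3. (x1, x2, y2, y3) \<in> C) \<or> (\<forall>x. x1 < x \<and> x < x2 \<longrightarrow> \<not> north K x y2)"
    by (auto simp: frame_sw)
  have s3: "reflect_quad -` swap_quad -` A \<subseteq> reflect_quad -` swap_quad -` T" "reflect_quad -` swap_quad -` T - reflect_quad -` swap_quad -` C \<subseteq> reflect_quad -` swap_quad -` Q" "reflect_quad -` swap_quad -` C \<subseteq> reflect_quad -` swap_quad -` A"
    "(-y2, -y1, x1, x2) \<in> reflect_quad -` swap_quad -` C"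
    using A k C c by auto
  have "(\<exists>y3. (-y1, y3, x1, x2) \<in> reflect_quad -` swap_quad -` C) \<or> (\<forall>x. x1 < x \<and> x < x2 \<longrightarrow> \<not> east (frame (reflect_quad -` swap_quad -` Q)) (-y1) x)"
    using rect_partition.side[OF rect_partition.reflected[OF swapped] _ s3] a unfolding adj4_def by blast
  then have "(\<exists>y3. (- y1, y3, x1, x2) \<in> reflect_quad -` swap_quad -` C) \<or> (\<forall>x. x1 < x \<and> x < x2 \<longrightarrow> \<not> west (frame (swap_quad -` Q)) y1 x)"
    unfolding frame_rf by simp
  then show "(\<exists>y3. (x1, x2, y3, y1) \<in> C) \<or> (\<forall>x. x1 < x \<and> x < x2 \<longrightarrow> \<not> south K x y1)"
    by (auto simp: frame_sw)
qed


text \<open>An edge that reached beyond the side of the box would cross it in a vertex.\<close>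

lemma edge_stops_east:
  assumes K: "\<And>y. y1 \<le> y \<Longrightarrow> y \<le> y2 \<Longrightarrow> K x2 y" and e: "hedge Q x x' y" and "x < x2" "y1 < y" "y < y2"
  shows "x' \<le> x2"
proof (rule ccontr)
  assume "\<not> x' \<le> x2"
  then have "west K x2 y" "\<not> corner Q x2 y" using e assms(3) edge_dirs(2)[of x x' y x2] unfolding hedge_def by auto
  moreover have "north K x2 y" unfolding north_def by (rule exI[of _ "y2 - y"]) (use K assms(4,5) in auto)
  ultimately show False using west_north_corner by blast
qed

lemma edge_stops_west:
  assumes K: "\<And>y. y1 \<le> y \<Longrightarrow> y \<le> y2 \<Longrightarrow> K x1 y" and e: "hedge Q x' x y" and "x1 < x" "y1 < y" "y < y2"
  shows "x1 \<le> x'"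
  using rect_partition.edge_stops_east[OF reflected, of y1 y2 "-x1" "-x" "-x'" y] assms
  by (simp add: frame_rf hedge_rf)

end

section \<open>Isolated subdivided cells\<close>

context rect_mesh
begin

lemma hor_edge_cases:
  assumes "p \<noteq> q" "closed_segment p q \<in> horizontal_edges S"
  shows "\<exists>x x' y. p = (x, y) \<and> q = (x', y) \<and> (x < x' \<and> hedge Q x x' y \<or> x' < x \<and> hedge Q x' x y)"
proof -
  obtain s t y where e: "closed_segment p q = hseg s t y" "hedge Q s t y"
    using assms(2) unfolding horizontal_edges_eq hedges_def by blast
  have "s < t" using e(2) unfolding hedge_def by blast
  then have "closed_segment p q = closed_segment (s, y) (t, y)" using e(1) by (simp add: seg_hseg)
  then have "p = (s, y) \<and> q = (t, y) \<or> p = (t, y) \<and> q = (s, y)" by (simp add: doubleton_eq_iff)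
  then show ?thesis using e(2) \<open>s < t\<close> by blast
qed

lemma ver_edge_cases:
  assumes "p \<noteq> q" "closed_segment p q \<in> vertical_edges S"
  shows "\<exists>x y y'. p = (x, y) \<and> q = (x, y') \<and> (y < y' \<and> hedge (swap_quad -` Q) y y' x \<or> y' < y \<and> hedge (swap_quad -` Q) y' y x)"
proof -
  obtain s t x where e: "closed_segment p q = prod.swap ` hseg s t x" "hedge (swap_quad -` Q) s t x"
    using assms(2) unfolding vertical_edges_eq hedges_def by blast
  have "s < t" using e(2) unfolding hedge_def by blast
  then have "closed_segment p q = closed_segment (x, s) (x, t)" using e(1) by (simp add: seg_vseg)
  then have "p = (x, s) \<and> q = (x, t) \<or> p = (x, t) \<and> q = (x, s)" by (simp add: doubleton_eq_iff)
  then show ?thesis using e(2) \<open>s < t\<close> by blast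
qed

text \<open>A poly-line that starts inside a box without outward skeleton on its sides stays inside it. It can
arrive at a side only along an edge perpendicular to it, at a vertex that is not a crossing. There
it may not turn, and it cannot go straight on, so it has to go back.\<close>

lemma path_confined:
  assumes lt: "x1 < x2" "y1 < y2"
    and Kv: "\<And>y. y1 \<le> y \<Longrightarrow> y \<le> y2 \<Longrightarrow> K x1 y \<and> K x2 y" and Kh: "\<And>x. x1 \<le> x \<Longrightarrow> x \<le> x2 \<Longrightarrow> K x y1 \<and> K x y2"
    and bE: "\<And>y. y1 < y \<Longrightarrow> y < y2 \<Longrightarrow> \<not> east K x2 y" and bW: "\<And>y. y1 < y \<Longrightarrow> y < y2 \<Longrightarrow> \<not> west K x1 y"
    and bN: "\<And>x. x1 < x \<Longrightarrow> x < x2 \<Longrightarrow> \<not> north K x y2" and bS: "\<And>x. x1 < x \<Longrightarrow> x < x2 \<Longrightarrow> \<not> south K x y1"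
    and path: "polyline S ps" "turns_at_crossings S ps"
    and start: "x1 < fst (hd ps) \<and> fst (hd ps) < x2 \<and> y1 < snd (hd ps) \<and> snd (hd ps) < y2"
    and stop: "last ps \<in> crosses Q"
  shows "x1 < fst (last ps) \<and> fst (last ps) < x2 \<and> y1 < snd (last ps) \<and> snd (last ps) < y2"
proof -
  define ins where "ins p \<longleftrightarrow> x1 < fst p \<and> fst p < x2 \<and> y1 < snd p \<and> snd p < y2" for p :: "real \<times> real"
  define onH where "onH p \<longleftrightarrow> (fst p = x1 \<or> fst p = x2) \<and> y1 < snd p \<and> snd p < y2" for p :: "real \<times> real"
  define onV where "onV p \<longleftrightarrow> (snd p = y1 \<or> snd p = y2) \<and> x1 < fst p \<and> fst p < x2" for p :: "real \<times> real"
  \<comment> \<open>a horizontal edge from inside, or from a vertical side of the box, leads to a point of the same kind\<close>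
  have hnext: "ins q \<or> onH q" if p: "ins p \<or> onH p" and e: "p \<noteq> q" "closed_segment p q \<in> horizontal_edges S" for p q
  proof -
    obtain x x' y where xy: "p = (x, y)" "q = (x', y)" and h: "x < x' \<and> hedge Q x x' y \<or> x' < x \<and> hedge Q x' x y"
      using hor_edge_cases[OF e] by blast
    have b: "x1 \<le> x" "x \<le> x2" "y1 < y" "y < y2" using p lt unfolding xy ins_def onH_def by auto
    from h show ?thesis
    proof
      assume h: "x < x' \<and> hedge Q x x' y"
      have "x \<noteq> x2" using hedge_dirs[of x x' y] h bE[OF b(3,4)] by blast
      then have "x' \<le> x2" using edge_stops_east[of y1 y2 x2 x x' y] Kv h b by auto
      then show ?thesis using h b unfolding xy ins_def onH_def by auto
    next
      assume h: "x' < x \<and> hedge Q x' x y"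
      have "x \<noteq> x1" using hedge_dirs[of x' x y] h bW[OF b(3,4)] by blast
      then have "x1 \<le> x'" using edge_stops_west[of y1 y2 x1 x' x y] Kv h b by auto
      then show ?thesis using h b unfolding xy ins_def onH_def by auto
    qed
  qed
  have vnext: "ins q \<or> onV q" if p: "ins p \<or> onV p" and e: "p \<noteq> q" "closed_segment p q \<in> vertical_edges S" for p q
  proof -
    obtain x y y' where xy: "p = (x, y)" "q = (x, y')" and h: "y < y' \<and> hedge (swap_quad -` Q) y y' x \<or> y' < y \<and> hedge (swap_quad -` Q) y' y x"
      using ver_edge_cases[OF e] by blast
    have b: "y1 \<le> y" "y \<le> y2" "x1 < x" "x < x2" using p lt unfolding xy ins_def onV_def by auto
    from h show ?thesis
    proof
      assume h: "y < y' \<and> hedge (swap_quad -` Q) y y' x"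
      have "north K x y" using sw.hedge_dirs[of y y' x] h by (simp add: frame_sw)
      then have "y \<noteq> y2" using bN[OF b(3,4)] by blast
      then have "y' \<le> y2" using sw.edge_stops_east[of x1 x2 y2 y y' x] Kh h b by (auto simp: frame_sw)
      then show ?thesis using h b unfolding xy ins_def onV_def by auto
    next
      assume h: "y' < y \<and> hedge (swap_quad -` Q) y' y x"
      have "south K x y" using sw.hedge_dirs[of y' y x] h by (simp add: frame_sw)
      then have "y \<noteq> y1" using bS[OF b(3,4)] by blast
      then have "y1 \<le> y'" using sw.edge_stops_west[of x1 x2 y1 y' y x] Kh h b by (auto simp: frame_sw)
      then show ?thesis using h b unfolding xy ins_def onV_def by auto
    qed
  qed
  have nH: "p \<notin> crosses Q" if "onH p" for p
    using that bE bW unfolding onH_def crosses_def by (cases p) auto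
  have nV: "p \<notin> crosses Q" if "onV p" for p
    using that bN bS unfolding onV_def crosses_def by (cases p) auto
  have ne: "ps \<noteq> []" using path(1) unfolding polyline_def by blast
  have inv: "ins (ps ! i) \<or> (\<exists>k. i = Suc k \<and> onH (ps ! i) \<and> closed_segment (ps ! k) (ps ! i) \<in> horizontal_edges S) \<or>
      (\<exists>k. i = Suc k \<and> onV (ps ! i) \<and> closed_segment (ps ! k) (ps ! i) \<in> vertical_edges S)" if "i < length ps" for i
    using that
  proof (induction i)
    case 0 then show ?case using start ne unfolding ins_def by (simp add: hd_conv_nth)
  next
    case (Suc i)
    let ?p = "ps ! i" and ?q = "ps ! Suc i"
    have pq: "?p \<noteq> ?q" "closed_segment ?p ?q \<in> edges S" using path(1) Suc.prems unfolding polyline_def by auto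
    have IH: "ins ?p \<or> (\<exists>k. i = Suc k \<and> onH ?p \<and> closed_segment (ps ! k) ?p \<in> horizontal_edges S) \<or>
      (\<exists>k. i = Suc k \<and> onV ?p \<and> closed_segment (ps ! k) ?p \<in> vertical_edges S)" using Suc by simp
    \<comment> \<open>a change of direction takes place at a crossing\<close>
    have turn: "?p \<in> crosses Q" if "i = Suc k"
      "closed_segment (ps ! k) ?p \<in> horizontal_edges S \<and> closed_segment ?p ?q \<in> vertical_edges S \<or>
       closed_segment (ps ! k) ?p \<in> vertical_edges S \<and> closed_segment ?p ?q \<in> horizontal_edges S" for k
      using path(2) Suc.prems that unfolding turns_at_crossings_def Let_def crossing_eq by blast
    show ?case
    proof (cases "closed_segment ?p ?q \<in> horizontal_edges S")
      case True
      then have "ins ?p \<or> onH ?p" using IH turn nV by blast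
      from hnext[OF this pq(1) True] show ?thesis using True by blast
    next
      case False
      then have v: "closed_segment ?p ?q \<in> vertical_edges S" using pq(2) unfolding edges_def by blast
      then have "ins ?p \<or> onV ?p" using IH turn nH by blast
      from vnext[OF this pq(1) v] show ?thesis using v by blast
    qed
  qed
  have "last ps = ps ! (length ps - 1)" "length ps - 1 < length ps" using ne by (simp_all add: last_conv_nth)
  then have "ins (last ps)" using inv[of "length ps - 1"] stop nH nV by metis
  then show ?thesis unfolding ins_def .
qed

lemma center_crosses:
  assumes "(x1, x2, y1, y2) \<in> C" "x1 < x2" "y1 < y2" "\<And>x y. frame (refine_by T C) x y \<Longrightarrow> K x y"
  shows "((x1 + x2) / 2, (y1 + y2) / 2) \<in> crosses Q"
proof -
  have row: "\<forall>x. x1 \<le> x \<and> x \<le> x2 \<longrightarrow> K x ((y1 + y2) / 2)"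
    using frame_child[OF assms(1-3), of _ "(y1 + y2) / 2"] assms(3,4) by auto
  have col: "\<forall>y. y1 \<le> y \<and> y \<le> y2 \<longrightarrow> frame (swap_quad -` Q) y ((x1 + x2) / 2)"
    using frame_child[OF assms(1-3), of "(x1 + x2) / 2"] assms(2,4) by (auto simp: frame_sw)
  show ?thesis unfolding crosses_def
    using edge_dirs[OF assms(2) row, of "(x1 + x2) / 2"] sw.edge_dirs[OF assms(3) col, of "(y1 + y2) / 2"] assms(2,3)
    by (simp add: frame_sw)
qed

text \<open>The condition under which connectedness of the mesh excludes that one of these cells is subdivided
in isolation.\<close>

definition has_outer :: "quad set \<Rightarrow> bool"
  where "has_outer A \<longleftrightarrow> (\<forall>x1 x2 y1 y2. (x1, x2, y1, y2) \<in> A \<longrightarrow>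
    (\<exists>w\<in>crosses Q. \<not> (x1 < fst w \<and> fst w < x2 \<and> y1 < snd w \<and> snd w < y2)))"

text \<open>The centre of a subdivided cell is a crossing, and a corner of each of its quarters.\<close>

lemma has_outer_children:
  assumes "disjoint_cells T A" "C \<subseteq> A" "\<And>x y. frame (refine_by T C) x y \<Longrightarrow> K x y" shows "has_outer (children C)"
  unfolding has_outer_def
proof (intro allI impI)
  fix u1 u2 v1 v2 assume "(u1, u2, v1, v2) \<in> children C"
  then obtain c where c: "c \<in> C" "child c (u1, u2, v1, v2)" unfolding children_def by blast
  obtain x1 x2 y1 y2 where e: "c = (x1, x2, y1, y2)" by (metis surj_pair)
  have "(x1, x2, y1, y2) \<in> T" using c(1) assms(2) disjoint_cellsD(1)[OF assms(1)] e by auto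
  then have lt: "x1 < x2" "y1 < y2" using disjoint_cellsD(2)[OF assms(1)] by auto
  have "((x1 + x2) / 2, (y1 + y2) / 2) \<in> crosses Q" using center_crosses[OF _ lt assms(3)] c(1) e by blast
  moreover have "\<not> (u1 < (x1 + x2) / 2 \<and> (x1 + x2) / 2 < u2)" using c(2) e by auto
  ultimately show "\<exists>w\<in>crosses Q. \<not> (u1 < fst w \<and> fst w < u2 \<and> v1 < snd w \<and> snd w < v2)"
    by (intro bexI) auto
qed

text \<open>Suppose that the function vanishes on the skeleton of the current level. If a neighbour of the cell
is subdivided too, the common midline of the two cells has three zeros on the old skeleton. If there
is no such neighbour, the centre of the cell is a crossing that no admissible poly-line connects to
a crossing outside the cell, against the hypothesis that the mesh is connected.\<close>

lemma cross_vanishes_step: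
  assumes conn: "crossing_vertex_connected S" and seg: "segmentwise K u"
    and w: "disjoint_cells T A" and a4: "adj4 T A a1 a2 b1 b2" and z: "zero_on T u" and out: "has_outer A"
    and C: "C \<subseteq> A" and kept: "T - C \<subseteq> Q" and fK: "\<And>x y. frame (refine_by T C) x y \<Longrightarrow> K x y"
    and c: "(x1, x2, y1, y2) \<in> C"
  shows "cross_vanishes u x1 x2 y1 y2"
proof -
  have CT: "C \<subseteq> T" using C disjoint_cellsD(1)[OF w] by blast
  have lt: "x1 < x2 \<and> y1 < y2" if "(x1, x2, y1, y2) \<in> C" for x1 x2 y1 y2 using disjoint_cellsD(2)[OF w] CT that by blast
  have row: "K x ((y1 + y2) / 2)" if "(x1, x2, y1, y2) \<in> C" "x1 \<le> x" "x \<le> x2" for x1 x2 y1 y2 x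
    using frame_child[OF that(1), of x "(y1 + y2) / 2" T] lt[OF that(1)] that fK by auto
  have col: "K ((x1 + x2) / 2) y" if "(x1, x2, y1, y2) \<in> C" "y1 \<le> y" "y \<le> y2" for x1 x2 y1 y2 y
    using frame_child[OF that(1), of "(x1 + x2) / 2" y T] lt[OF that(1)] that fK by auto
  have bz: "y1 \<le> y \<and> y \<le> y2 \<longrightarrow> u x1 y = 0 \<and> u x2 y = 0" "x1 \<le> x \<and> x \<le> x2 \<longrightarrow> u x y1 = 0 \<and> u x y2 = 0"
    if "(x1, x2, y1, y2) \<in> C" for x1 x2 y1 y2 x y
    using box_frame(1)[of x1 x2 y1 y2 T y] box_frame(2)[of x1 x2 y1 y2 T x] that lt[OF that] CT z unfolding zero_on_def by blast+
  note l = lt[OF c]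
  let ?xm = "(x1 + x2) / 2" and ?ym = "(y1 + y2) / 2"
  have m: "x1 < ?xm" "?xm < x2" "y1 < ?ym" "?ym < y2" using l by auto
  note z0 = bz[OF c]
  note sd = sides[OF a4 disjoint_cellsD(1)[OF w] kept C c]
  consider x3 where "(x2, x3, y1, y2) \<in> C" | x3 where "(x3, x1, y1, y2) \<in> C" | y3 where "(x1, x2, y2, y3) \<in> C"
    | y3 where "(x1, x2, y3, y1) \<in> C" 
    | "\<forall>y. y1 < y \<and> y < y2 \<longrightarrow> \<not> east K x2 y" "\<forall>y. y1 < y \<and> y < y2 \<longrightarrow> \<not> west K x1 y"
      "\<forall>x. x1 < x \<and> x < x2 \<longrightarrow> \<not> north K x y2" "\<forall>x. x1 < x \<and> x < x2 \<longrightarrow> \<not> south K x y1"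
    using sd by blast
  then show ?thesis
  proof cases
    case (1 x3)
    show ?thesis unfolding cross_vanishes_def
    proof (rule cross_zero[OF seg, of _ _ _ _ x1 x3 x1 x2 x3])
      show "K x ?ym" if "x1 \<le> x" "x \<le> x3" for x using row[OF c, of x] row[OF 1, of x] that by linarith
    qed (use l lt[OF 1] m z0 bz[OF 1] col[OF c] in auto)
  next
    case (2 x3)
    show ?thesis unfolding cross_vanishes_def
    proof (rule cross_zero[OF seg, of _ _ _ _ x3 x2 x3 x1 x2])
      show "K x ?ym" if "x3 \<le> x" "x \<le> x2" for x using row[OF c, of x] row[OF 2, of x] that by linarith
    qed (use l lt[OF 2] m z0 bz[OF 2] col[OF c] in auto)
  next
    case (3 y3)
    have "(\<forall>y. y1 \<le> y \<and> y \<le> y2 \<longrightarrow> u ?xm y = 0) \<and> (\<forall>x. x1 \<le> x \<and> x \<le> x2 \<longrightarrow> u x ?ym = 0)"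
    proof (rule cross_zero[OF segmentwise_swap[OF seg], of _ _ _ _ y1 y3 y1 y2 y3])
      show "K ?xm y" if "y1 \<le> y" "y \<le> y3" for y using col[OF c, of y] col[OF 3, of y] that by linarith
    qed (use l lt[OF 3] m z0 bz[OF 3] row[OF c] in auto)
    then show ?thesis unfolding cross_vanishes_def by blast
  next
    case (4 y3)
    have "(\<forall>y. y1 \<le> y \<and> y \<le> y2 \<longrightarrow> u ?xm y = 0) \<and> (\<forall>x. x1 \<le> x \<and> x \<le> x2 \<longrightarrow> u x ?ym = 0)"
    proof (rule cross_zero[OF segmentwise_swap[OF seg], of _ _ _ _ y3 y2 y3 y1 y2])
      show "K ?xm y" if "y3 \<le> y" "y \<le> y2" for y using col[OF c, of y] col[OF 4, of y] that by linarith
    qed (use l lt[OF 4] m z0 bz[OF 4] row[OF c] in auto)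
    then show ?thesis unfolding cross_vanishes_def by blast
  next
    case 5
    have ctr: "(?xm, ?ym) \<in> crosses Q" using center_crosses[OF c _ _ fK] l by blast
    obtain v where v: "v \<in> crosses Q" "\<not> (x1 < fst v \<and> fst v < x2 \<and> y1 < snd v \<and> snd v < y2)"
      using out c C unfolding has_outer_def by blast
    then have "(?xm, ?ym) \<noteq> v" using m by auto
    then obtain ps where ps: "polyline S ps" "hd ps = (?xm, ?ym)" "last ps = v" "turns_at_crossings S ps"
      using conn ctr v(1) unfolding crossing_vertex_connected_def crossing_eq by blast
    have bK: "K x y" if "x1 \<le> x" "x \<le> x2" "y1 \<le> y" "y \<le> y2" "x = x1 \<or> x = x2 \<or> y = y1 \<or> y = y2" for x y
      using frame_child[OF c, of x y T] l that fK by blast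
    have "x1 < fst (last ps) \<and> fst (last ps) < x2 \<and> y1 < snd (last ps) \<and> snd (last ps) < y2"
      by (rule path_confined[OF _ _ _ _ _ _ _ _ ps(1,4)]) (use l 5 bK m ps v(1) in auto)
    then show ?thesis using v(2) ps(3) by blast
  qed
qed

text \<open>By induction along the levels. The facts about kept cells and about the inclusion of the skeleton in
the final one refer to the remaining levels, hence the induction over the chain from its head.\<close>

theorem refine_zero:
  assumes conn: "crossing_vertex_connected S" and seg: "segmentwise K u"
    and chain: "refines\<^sup>*\<^sup>* (T, A) (Q, B)"
    and w: "disjoint_cells T A" and a4: "adj4 T A a1 a2 b1 b2" and z: "zero_on T u" and out: "has_outer A"
  shows "zero_on Q u"
  using chain w a4 z out
proof (induction "(T, A)" arbitrary: T A rule: converse_rtranclp_induct)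
  case base then show ?case by blast
next
  case (step P)
  obtain C where C: "C \<subseteq> A" "P = (refine_by T C, children C)" using step.hyps(1) unfolding refines_def by auto
  note ch = step.hyps(2)[unfolded C(2)]
  have w': "disjoint_cells (refine_by T C) (children C)" by (rule disjoint_cells_step[OF step.prems(1) C(1)])
  have fK: "frame (refine_by T C) x y \<Longrightarrow> K x y" for x y using persistence[OF ch w'] by blast
  have "zero_on (refine_by T C) u"
    by (rule zero_step[OF step.prems(1) C(1) step.prems(3)])
       (rule cross_vanishes_step[OF conn seg step.prems C(1) kept_in_final[OF ch step.prems(1) C(1)] fK])
  moreover have "has_outer (children C)" by (rule has_outer_children[OF step.prems(1) C(1) fK])
  ultimately show ?case using step.hyps(3)[OF C(2) w' adj4_step[OF step.prems(1,2) C(1)]] by blast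
qed

end


section \<open>Tensor-product grids\<close>

definition grid :: "(nat \<Rightarrow> real) \<Rightarrow> nat \<Rightarrow> (nat \<Rightarrow> real) \<Rightarrow> nat \<Rightarrow> quad set"
  where "grid x m y n = {(x i, x (Suc i), y j, y (Suc j)) | i j. i < m \<and> j < n}"

lemma grid_sw: "swap_quad -` grid x m y n = grid y n x m"
  unfolding grid_def by (auto; blast)

lemma smono_less: "strict_mono_on {..m} x \<Longrightarrow> i < j \<Longrightarrow> j \<le> m \<Longrightarrow> x i < (x j :: real)" for i j m :: nat
  by (rule strict_mono_onD) auto

lemma smono_le: "strict_mono_on {..m} x \<Longrightarrow> i \<le> j \<Longrightarrow> j \<le> m \<Longrightarrow> x i \<le> (x j :: real)" for i j m :: nat
  using smono_less[of m x i j] by (cases "i = j") auto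

lemma locate:
  fixes x :: "nat \<Rightarrow> real"
  assumes "x 0 \<le> t" "t \<le> x m" "0 < m" shows "\<exists>i<m. x i \<le> t \<and> t \<le> x (Suc i)"
  using assms(2,3)
proof (induction m)
  case (Suc m)
  show ?case
  proof (cases "t \<le> x m \<and> 0 < m")
    case True then show ?thesis using Suc.IH less_Suc_eq by blast
  next
    case False
    then have "x m \<le> t" using assms(1) by (cases "m = 0") auto
    then show ?thesis using Suc.prems by blast
  qed
qed simp

lemma grid_disjoint_cells:
  assumes x: "strict_mono_on {..m} x" and y: "strict_mono_on {..n} y" shows "disjoint_cells (grid x m y n) (grid x m y n)"
proof -
  have eq: "i = i'" if "i < m" "i' < m" "z i < z (Suc i')" "z i' < z (Suc i)" "strict_mono_on {..m} z" for i i' m and z :: "nat \<Rightarrow> real"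
    using smono_le[OF that(5), of "Suc i" i'] smono_le[OF that(5), of "Suc i'" i] that by (metis Suc_leI less_or_eq_imp_le linorder_neqE_nat not_less)
  show ?thesis unfolding disjoint_cells_def
  proof (intro conjI allI impI)
    fix x1 x2 y1 y2 assume "(x1, x2, y1, y2) \<in> grid x m y n"
    then show "x1 < x2" "y1 < y2" unfolding grid_def using smono_less[OF x] smono_less[OF y] by auto
  next
    fix x1 x2 y1 y2 u1 u2 v1 v2
    assume *: "(x1, x2, y1, y2) \<in> grid x m y n" "(u1, u2, v1, v2) \<in> grid x m y n" "x1 < u2" "u1 < x2" "y1 < v2" "v1 < y2"
    from *(1) obtain i j where 1: "x1 = x i" "x2 = x (Suc i)" "y1 = y j" "y2 = y (Suc j)" "i < m" "j < n" unfolding grid_def by auto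
    from *(2) obtain i' j' where 2: "u1 = x i'" "u2 = x (Suc i')" "v1 = y j'" "v2 = y (Suc j')" "i' < m" "j' < n" unfolding grid_def by auto
    have "i = i'" "j = j'" using eq[of i m i' x] eq[of j n j' y] * 1 2 x y by auto
    then show "x1 = u1" "x2 = u2" "y1 = v1" "y2 = v2" using 1 2 by auto
  qed simp
qed

lemma grid_adj4: "adj4 (grid x m y n) (grid x m y n) (x 0) (x m) (y 0) (y n)"
proof -
  have A: "adj (grid x m y n) (grid x m y n) (x m)" for x m y n
    unfolding adj_def
  proof (intro allI impI)
    fix x1 x2 y1 y2 assume "(x1, x2, y1, y2) \<in> grid x m y n"
    then obtain i j where 1: "x1 = x i" "x2 = x (Suc i)" "y1 = y j" "y2 = y (Suc j)" "i < m" "j < n" unfolding grid_def by auto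
    show "x2 = x m \<or> (\<exists>x3. (x2, x3, y1, y2) \<in> grid x m y n) \<or>
       (\<exists>x3 v1 v2. (x2, x3, v1, v2) \<in> grid x m y n - grid x m y n \<and> v1 \<le> y1 \<and> y2 \<le> v2)"
    proof (cases "Suc i = m")
      case False
      then have "(x (Suc i), x (Suc (Suc i)), y j, y (Suc j)) \<in> grid x m y n" unfolding grid_def using 1 by fastforce
      then show ?thesis using 1 by blast
    qed (use 1 in auto)
  qed
  have B: "adj (reflect_quad -` grid x m y n) (reflect_quad -` grid x m y n) (- x 0)" for x m y n
    unfolding adj_def
  proof (intro allI impI)
    fix x1 x2 y1 y2 assume "(x1, x2, y1, y2) \<in> reflect_quad -` grid x m y n"
    then obtain i j where 1: "- x2 = x i" "- x1 = x (Suc i)" "y1 = y j" "y2 = y (Suc j)" "i < m" "j < n" unfolding grid_def by auto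
    show "x2 = - x 0 \<or> (\<exists>x3. (x2, x3, y1, y2) \<in> reflect_quad -` grid x m y n) \<or>
       (\<exists>x3 v1 v2. (x2, x3, v1, v2) \<in> reflect_quad -` grid x m y n - reflect_quad -` grid x m y n \<and> v1 \<le> y1 \<and> y2 \<le> v2)"
    proof (cases i)
      case (Suc k)
      then have "(x k, x (Suc k), y j, y (Suc j)) \<in> grid x m y n" unfolding grid_def using 1 by fastforce
      then have "(x2, - x k, y1, y2) \<in> reflect_quad -` grid x m y n" using 1 Suc by simp
      then show ?thesis by blast
    next
      case 0
      then have "- x2 = x 0" using 1 by simp
      then have "x2 = - x 0" by linarith
      then show ?thesis by blast
    qed
  qed
  show ?thesis unfolding adj4_def grid_sw using A B by blast
qed

lemma grid_frame_row:
  assumes "strict_mono_on {..n} y" "0 < m" "0 < n" "j \<le> n" "x 0 \<le> t" "t \<le> x m" shows "frame (grid x m y n) t (y j)"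
proof -
  obtain i where i: "i < m" "x i \<le> t" "t \<le> x (Suc i)" using locate[OF assms(5,6,2)] by blast
  \<comment> \<open>the row of cells above the line, except for the topmost line\<close>
  define k where "k = (if j < n then j else n - 1)"
  have k: "k < n" "j = k \<or> j = Suc k" using assms(3,4) unfolding k_def by auto
  have "(x i, x (Suc i), y k, y (Suc k)) \<in> grid x m y n" unfolding grid_def using i k by blast
  moreover have "y k \<le> y j" "y j \<le> y (Suc k)" using smono_le[OF assms(1)] k by auto
  ultimately show ?thesis unfolding frame_def using i k(2) by (metis less_irrefl)
qed

lemma grid_frame_col:
  assumes "strict_mono_on {..m} x" "0 < m" "0 < n" "i \<le> m" "y 0 \<le> t" "t \<le> y n" shows "frame (grid x m y n) (x i) t"
  using grid_frame_row[OF assms(1,3,2,4,5,6)] unfolding grid_sw[of x m y n, symmetric] frame_sw .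

lemma grid_frame_cases:
  assumes "strict_mono_on {..m} x" "strict_mono_on {..n} y" "frame (grid x m y n) s t"
  shows "(\<exists>j\<le>n. t = y j \<and> x 0 \<le> s \<and> s \<le> x m) \<or> (\<exists>i\<le>m. s = x i \<and> y 0 \<le> t \<and> t \<le> y n)"
proof -
  obtain i j where ij: "i < m" "j < n" "x i \<le> s" "s \<le> x (Suc i)" "y j \<le> t" "t \<le> y (Suc j)"
    "\<not> (x i < s \<and> s < x (Suc i) \<and> y j < t \<and> t < y (Suc j))" using assms(3) unfolding frame_def grid_def by auto
  have b: "x 0 \<le> x i" "x (Suc i) \<le> x m" "y 0 \<le> y j" "y (Suc j) \<le> y n"
    using smono_le[OF assms(1), of 0 i] smono_le[OF assms(1), of "Suc i" m] smono_le[OF assms(2), of 0 j] smono_le[OF assms(2), of "Suc j" n] ij(1,2) by auto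
  have "s = x i \<or> s = x (Suc i) \<or> t = y j \<or> t = y (Suc j)" using ij by linarith
  moreover have "x 0 \<le> s" "s \<le> x m" "y 0 \<le> t" "t \<le> y n" using ij b by auto
  moreover have "i \<le> m" "Suc i \<le> m" "j \<le> n" "Suc j \<le> n" using ij(1,2) by auto
  ultimately show ?thesis by blast
qed

text \<open>Newton's form of the interpolating quadratic.\<close>

lemma interpolate3:
  fixes p q r :: real
  assumes "p \<noteq> q" "p \<noteq> r" "q \<noteq> r"
  shows "\<exists>c :: nat \<Rightarrow> real. \<forall>t\<in>{p, q, r}. (\<Sum>i\<le>2. c i * t ^ i) = f t"
proof -
  define d1 where "d1 = (f q - f p) / (q - p)"
  define d2 where "d2 = ((f r - f p) / (r - p) - d1) / (r - q)"
  let ?c = "\<lambda>i::nat. if i = 0 then f p - p * d1 + p * q * d2 else if i = 1 then d1 - (p + q) * d2 else d2"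
  have e: "(\<Sum>i\<le>2. ?c i * t ^ i) = f p + (t - p) * d1 + (t - p) * (t - q) * d2" for t
    by (simp add: sum3 power2_eq_square algebra_simps)
  have "(q - p) * d1 = f q - f p" unfolding d1_def using assms by simp
  moreover have "(r - q) * d2 = (f r - f p) / (r - p) - d1" unfolding d2_def using assms by simp
  then have "(r - p) * ((r - q) * d2) = (r - p) * ((f r - f p) / (r - p)) - (r - p) * d1" by (simp only: right_diff_distrib)
  moreover have "(r - p) * ((f r - f p) / (r - p)) = f r - f p" using assms(2) by simp
  ultimately have "\<forall>t\<in>{p, q, r}. (\<Sum>i\<le>2. ?c i * t ^ i) = f t" unfolding e by (auto simp: mult.assoc)
  then show ?thesis by (intro exI[of _ ?c])
qed

lemma interpolate33:
  fixes p q r p' q' r' :: real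
  assumes "p \<noteq> q" "p \<noteq> r" "q \<noteq> r" "p' \<noteq> q'" "p' \<noteq> r'" "q' \<noteq> r'"
  shows "\<exists>a. \<forall>x\<in>{p, q, r}. \<forall>y\<in>{p', q', r'}. biq a x y = u x y"
proof -
  have "\<forall>y. \<exists>c :: nat \<Rightarrow> real. \<forall>x\<in>{p, q, r}. (\<Sum>i\<le>2. c i * x ^ i) = u x y"
    by (intro allI interpolate3[OF assms(1-3)])
  then obtain c :: "real \<Rightarrow> nat \<Rightarrow> real" where c: "\<And>x y. x \<in> {p, q, r} \<Longrightarrow> (\<Sum>i\<le>2. c y i * x ^ i) = u x y" by metis
  have "\<forall>i. \<exists>d :: nat \<Rightarrow> real. \<forall>y\<in>{p', q', r'}. (\<Sum>j\<le>2. d j * y ^ j) = c y i"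
    by (intro allI interpolate3[OF assms(4-6)])
  then obtain d :: "nat \<Rightarrow> nat \<Rightarrow> real" where d: "\<And>i y. y \<in> {p', q', r'} \<Longrightarrow> (\<Sum>j\<le>2. d i j * y ^ j) = c y i" by metis
  have "biq (\<lambda>(i, j). d i j) x y = u x y" if "x \<in> {p, q, r}" "y \<in> {p', q', r'}" for x y
    unfolding biq_row using d[OF that(2)] c[OF that(1), of y] by simp
  then show ?thesis by blast
qed

lemma segmentwise_diff_biq:
  assumes "segmentwise K u" shows "segmentwise K (\<lambda>x y. u x y - biq a x y)"
  unfolding segmentwise_def
proof (intro conjI allI impI)
  fix y s t :: real assume "s < t" "\<forall>x. s \<le> x \<and> x \<le> t \<longrightarrow> K x y"
  then have "quad_on {s..t} (\<lambda>x. u x y)" using assms unfolding segmentwise_def by blast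
  then show "quad_on {s..t} (\<lambda>x. u x y - biq a x y)" unfolding biq_row by (rule quad_on_diff[OF _ quad_on_poly])
next
  fix x s t :: real assume "s < t" "\<forall>y. s \<le> y \<and> y \<le> t \<longrightarrow> K x y"
  then have "quad_on {s..t} (\<lambda>y. u x y)" using assms unfolding segmentwise_def by blast
  then show "quad_on {s..t} (\<lambda>y. u x y - biq a x y)" unfolding biq_col by (rule quad_on_diff[OF _ quad_on_poly])
qed

text \<open>The biquadratic polynomial that agrees with \<open>u\<close> at the nine points of three vertical and three
horizontal lines agrees with \<open>u\<close> along these lines, because each of them carries three of the points.
Each other line of the grid meets them in three points and follows. The third line in each direction
is what excludes a grid with a single row or column of cells.\<close>

lemma grid_biquadratic:
  assumes seg: "segmentwise K u" and x: "strict_mono_on {..m} x" and y: "strict_mono_on {..n} y"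
    and mn: "2 \<le> m" "2 \<le> n" and fK: "\<And>s t. frame (grid x m y n) s t \<Longrightarrow> K s t"
  shows "\<exists>a. zero_on (grid x m y n) (\<lambda>s t. u s t - biq a s t)"
proof -
  have xl: "x 0 < x 1" "x 1 < x m" and yl: "y 0 < y 1" "y 1 < y n"
    using smono_less[OF x, of 0 1] smono_less[OF x, of 1 m] smono_less[OF y, of 0 1] smono_less[OF y, of 1 n] mn by auto
  obtain a where a: "\<forall>s\<in>{x 0, x 1, x m}. \<forall>t\<in>{y 0, y 1, y n}. biq a s t = u s t"
    using interpolate33[of "x 0" "x 1" "x m" "y 0" "y 1" "y n" u] xl yl by auto
  let ?w = "\<lambda>s t. u s t - biq a s t"
  have sw: "segmentwise K ?w" by (rule segmentwise_diff_biq[OF seg])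
  have rK: "K s (y j)" if "j \<le> n" "x 0 \<le> s" "s \<le> x m" for s j using grid_frame_row[OF y, of m j x s] fK mn that by auto
  have cK: "K (x i) t" if "i \<le> m" "y 0 \<le> t" "t \<le> y n" for t i using grid_frame_col[OF x, of n i y t] fK mn that by auto
  have r0: "?w s (y j) = 0" if "j \<in> {0, 1, n}" "x 0 \<le> s" "s \<le> x m" for s j
    by (rule segment_zero[OF sw, of "x 0" "x m" _ "x 0" "x 1" "x m"]) (use rK that xl a mn in auto)
  have c: "?w (x i) t = 0" if "i \<le> m" "y 0 \<le> t" "t \<le> y n" for t i
  proof -
    have b: "x 0 \<le> x i" "x i \<le> x m" using smono_le[OF x, of 0 i] smono_le[OF x, of i m] that by auto
    show ?thesis
      by (rule segment_zero[OF segmentwise_swap[OF sw], of "y 0" "y n" _ "y 0" "y 1" "y n"])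
         (use cK that yl r0[of 0 "x i"] r0[of 1 "x i"] r0[of n "x i"] b in auto)
  qed
  have r: "?w s (y j) = 0" if "j \<le> n" "x 0 \<le> s" "s \<le> x m" for s j
  proof -
    have b: "y 0 \<le> y j" "y j \<le> y n" using smono_le[OF y, of 0 j] smono_le[OF y, of j n] that by auto
    show ?thesis
      by (rule segment_zero[OF sw, of "x 0" "x m" _ "x 0" "x 1" "x m"])
         (use rK that xl c[of 0 "y j"] c[of 1 "y j"] c[of m "y j"] b mn in auto)
  qed
  have "zero_on (grid x m y n) ?w"
    unfolding zero_on_def using grid_frame_cases[OF x y] r c by blast
  then show ?thesis by (intro exI[of _ a])
qed


section \<open>Hierarchical meshes as chains of refinements\<close>

lemma quads_tensor:
  assumes "strict_mono_on {..m} x" "strict_mono_on {..n} y" shows "quads (tensor_cells x m y n) = grid x m y n"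
proof (intro equalityI subsetI)
  fix q assume "q \<in> quads (tensor_cells x m y n)"
  then obtain x1 x2 y1 y2 i j where q: "q = (x1, x2, y1, y2)" "x1 < x2" "y1 < y2" "i < m" "j < n"
    "cbox (x1, y1) (x2, y2) = cbox (x i, y j) (x (Suc i), y (Suc j))" unfolding quads_def tensor_cells_def by auto
  then show "q \<in> grid x m y n" using cbox_inj[OF q(2,3,6)] unfolding grid_def by auto
next
  fix q assume "q \<in> grid x m y n"
  then obtain i j where q: "q = (x i, x (Suc i), y j, y (Suc j))" "i < m" "j < n" unfolding grid_def by auto
  then show "q \<in> quads (tensor_cells x m y n)"
    using smono_less[OF assms(1), of i "Suc i"] smono_less[OF assms(2), of j "Suc j"]
    unfolding quads_def tensor_cells_def by auto
qed

lemma quads_subcells: "quads (\<Union>c\<in>C. subcells c) = children (quads C)"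
proof (intro equalityI subsetI)
  fix q assume "q \<in> quads (\<Union>c\<in>C. subcells c)"
  then obtain u1 u2 v1 v2 c where q: "q = (u1, u2, v1, v2)" "u1 < u2" "v1 < v2" "c \<in> C" "cbox (u1, v1) (u2, v2) \<in> subcells c"
    unfolding quads_def by auto
  then obtain x1 x2 y1 y2 where x: "x1 < x2" "y1 < y2" "c = cbox (x1, y1) (x2, y2)"
    "cbox (u1, v1) (u2, v2) \<in> {cbox (x1, y1) ((x1 + x2) / 2, (y1 + y2) / 2), cbox ((x1 + x2) / 2, y1) (x2, (y1 + y2) / 2),
                     cbox (x1, (y1 + y2) / 2) ((x1 + x2) / 2, y2), cbox ((x1 + x2) / 2, (y1 + y2) / 2) (x2, y2)}"
    unfolding subcells_def Let_def by blast
  have "child (x1, x2, y1, y2) (u1, u2, v1, v2)" using x(4) cbox_inj[OF q(2,3)] by auto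
  moreover have "(x1, x2, y1, y2) \<in> quads C" unfolding quads_def using x q(4) by auto
  ultimately show "q \<in> children (quads C)" unfolding children_def q(1) by blast
next
  fix q assume "q \<in> children (quads C)"
  then obtain c where c: "c \<in> quads C" "child c q" unfolding children_def by blast
  obtain x1 x2 y1 y2 u1 u2 v1 v2 where e: "c = (x1, x2, y1, y2)" "q = (u1, u2, v1, v2)" by (metis surj_pair)
  have x: "x1 < x2" "y1 < y2" "cbox (x1, y1) (x2, y2) \<in> C" using c(1) e unfolding quads_def by auto
  have "cbox (u1, v1) (u2, v2) \<in> subcells (cbox (x1, y1) (x2, y2))"
  proof -
    have "cbox (u1, v1) (u2, v2) \<in> {cbox (x1, y1) ((x1 + x2) / 2, (y1 + y2) / 2), cbox ((x1 + x2) / 2, y1) (x2, (y1 + y2) / 2),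
                     cbox (x1, (y1 + y2) / 2) ((x1 + x2) / 2, y2), cbox ((x1 + x2) / 2, (y1 + y2) / 2) (x2, y2)}"
      using c(2) unfolding e child.simps by (elim conjE disjE) (simp_all only: insert_iff simp_thms)
    then show ?thesis unfolding subcells_def Let_def using x(1,2) by blast
  qed
  moreover have "u1 < u2" "v1 < v2" using child_bounds[of x1 x2 y1 y2 u1 u2 v1 v2] c(2) x e by simp_all
  ultimately show "q \<in> quads (\<Union>c\<in>C. subcells c)" using x(3) unfolding quads_def e(2) by blast
qed

lemma quads_Un: "quads (A \<union> B) = quads A \<union> quads B" and quads_Diff: "quads (A - B) = quads A - quads B"
  unfolding quads_def by auto

lemma level_mesh_chain:
  assumes "level_mesh k T A"
  shows "\<exists>x m y n. 0 < m \<and> 0 < n \<and> strict_mono_on {..m} x \<and> strict_mono_on {..n} y \<and>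
    refines\<^sup>*\<^sup>* (grid x m y n, grid x m y n) (quads T, quads A)"
  using assms
proof (induction rule: level_mesh.induct)
  case (tensor T)
  then obtain x y m n where *: "0 < m" "0 < n" "strict_mono_on {..m} x" "strict_mono_on {..n} y" "T = tensor_cells x m y n"
    unfolding tensor_product_mesh_def by blast
  show ?case
    by (rule exI[of _ x], rule exI[of _ m], rule exI[of _ y], rule exI[of _ n]) (use * quads_tensor in auto)
next
  case (refine k T A C A')
  then obtain x m y n where *: "0 < m" "0 < n" "strict_mono_on {..m} x" "strict_mono_on {..n} y"
    "refines\<^sup>*\<^sup>* (grid x m y n, grid x m y n) (quads T, quads A)" by blast
  have "quads C \<subseteq> quads A" using refine(2) unfolding quads_def by auto
  then have "refines (quads T, quads A) (quads ((T - C) \<union> A'), quads A')"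
    unfolding refines_def refine(3) quads_Un quads_Diff quads_subcells refine_by_def by auto
  then show ?case using * by (meson rtranclp.rtrancl_into_rtrancl)
qed

section \<open>Rigidity of hierarchical meshes\<close>

context rect_partition
begin

lemma cell_blocks_west: "(x0, x, v1, v2) \<in> Q \<Longrightarrow> v1 < y \<Longrightarrow> y < v2 \<Longrightarrow> \<not> west K x y"
  using rect_partition.cell_blocks_east[OF reflected, of "-x" "-x0" v1 v2 y] by (simp add: frame_rf)

text \<open>A cell that spans the whole width of the rectangle is bordered below or above by a run from side to
side, unless it is the whole rectangle. That run has no crossing, because the skeleton does not
enter the cell.\<close>

lemma full_row_blocks:
  assumes "(a1, a2, c1, c2) \<in> Q" "\<And>y. (y, a1, a2) \<in> ihruns \<Longrightarrow> \<exists>x. (x, y) \<in> crosses Q" "crosses Q \<noteq> {}"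
  shows False
proof -
  note c = cell[OF assms(1)]
  have s: "(c1, c2, a1, a2) \<in> swap_quad -` Q" using assms(1) by simp
  have run: "(y, a1, a2) \<in> ihruns" if "y \<noteq> b1" "y \<noteq> b2" "\<And>x. a1 \<le> x \<Longrightarrow> x \<le> a2 \<Longrightarrow> K x y" for y
    unfolding ihruns_def hruns_def using that wide dir_region(1)[of a2 y] dir_region(2)[of a1 y] by auto
  consider "b1 < c1" | "c2 < b2" | "c1 = b1" "c2 = b2" using c by linarith
  then show False
  proof cases
    case 1
    then obtain x where x: "(x, c1) \<in> crosses Q" using assms(2)[OF run[of c1]] edge_K(3)[OF assms(1)] c by auto
    then have "a1 < x" "x < a2" using crosses_interior by blast+
    from rect_partition.cell_blocks_east[OF swapped s this] show False using x unfolding crosses_def by (simp add: frame_sw)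
  next
    case 2
    then obtain x where x: "(x, c2) \<in> crosses Q" using assms(2)[OF run[of c2]] edge_K(4)[OF assms(1)] c by auto
    then have "a1 < x" "x < a2" using crosses_interior by blast+
    from rect_partition.cell_blocks_west[OF swapped s this] show False using x unfolding crosses_def by (simp add: frame_sw)
  next
    case 3
    obtain x y where x: "(x, y) \<in> crosses Q" using assms(3) by auto
    then have "K x y" unfolding crosses_def using dir_region(1) by blast
    then show False using inside_not_K[OF assms(1), of x y] crosses_interior[OF x] 3 by blast
  qed
qed

text \<open>The point \<open>(s, t)\<close> lies on the horizontal prolongation of an edge beyond its end \<open>(x', t)\<close> on the
rim.\<close>

definition hpro :: "real \<Rightarrow> real \<Rightarrow> bool"
  where "hpro s t \<longleftrightarrow> (\<exists>x x'. (x', t) \<in> rim \<and> (hedge Q x x' t \<and> x' \<le> s \<or> hedge Q x' x t \<and> s \<le> x'))"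

text \<open>Let the rectangle be surrounded by two further vertical lines on each side, at \<open>e0\<close>, \<open>e1\<close> and
\<open>f1\<close>, \<open>f0\<close>. A prolongation that leaves the rectangle on the left side meets the zeros on the lines at
\<open>a1\<close>, \<open>e1\<close> and \<open>e0\<close>, and a quadratic with three zeros vanishes. Prolongations of edges on the rim run
along lines on which the function is zero anyway.\<close>

lemma pro_zero:
  assumes seg: "segmentwise K' w" and pro: "\<And>s t. e0 \<le> s \<Longrightarrow> s \<le> f0 \<Longrightarrow> b1 \<le> t \<Longrightarrow> t \<le> b2 \<Longrightarrow> hpro s t \<Longrightarrow> K' s t"
    and zc: "\<And>x t. x \<in> {e0, e1, a1, a2, f1, f0} \<Longrightarrow> b1 \<le> t \<Longrightarrow> t \<le> b2 \<Longrightarrow> w x t = 0"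
    and zr: "\<And>s t. t = b1 \<or> t = b2 \<Longrightarrow> e0 \<le> s \<Longrightarrow> s \<le> f0 \<Longrightarrow> w s t = 0"
    and lt: "e0 < e1" "e1 < a1" "a2 < f1" "f1 < f0"
    and h: "hpro s t" "e0 \<le> s" "s \<le> f0"
  shows "w s t = 0"
proof -
  obtain x x' where r: "(x', t) \<in> rim" and x: "hedge Q x x' t \<and> x' \<le> s \<or> hedge Q x' x t \<and> s \<le> x'"
    using h(1) unfolding hpro_def by blast
  have t: "b1 \<le> t" "t \<le> b2" "a1 \<le> x'" "x' \<le> a2" using r unfolding rim_def by auto
  show ?thesis
  proof (cases "t = b1 \<or> t = b2")
    case True then show ?thesis using zr h by blast
  next
    case False
    then have "x' = a1 \<or> x' = a2" using r unfolding rim_def by auto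
    from x show ?thesis
    proof
      assume e: "hedge Q x x' t \<and> x' \<le> s"
      then have "a1 \<le> x" "x < x'" using K_region[of x t] unfolding hedge_def by auto
      then have x': "x' = a2" using \<open>x' = a1 \<or> x' = a2\<close> by auto
      have "hpro z t" if "a2 \<le> z" for z using r e that x' unfolding hpro_def by blast
      then have "K' z t" if "a2 \<le> z" "z \<le> f0" for z using pro[of z t] t that lt wide by auto
      then show ?thesis
        by (rule segment_zero[OF seg, of a2 f0 t a2 f1 f0]) (use e x' lt h zc t in auto)
    next
      assume e: "hedge Q x' x t \<and> s \<le> x'"
      then have "x \<le> a2" "x' < x" using K_region[of x t] unfolding hedge_def by auto
      then have x': "x' = a1" using \<open>x' = a1 \<or> x' = a2\<close> by auto
      have "hpro z t" if "z \<le> a1" for z using r e that x' unfolding hpro_def by blast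
      then have "K' z t" if "e0 \<le> z" "z \<le> a1" for z using pro[of z t] t that lt wide by auto
      then show ?thesis
        by (rule segment_zero[OF seg, of e0 a1 t e0 e1 a1]) (use e x' lt h zc t in auto)
    qed
  qed
qed

text \<open>A segment from side to side forms one segment with its prolongation to the left, and three zeros lie
on that prolongation.\<close>

lemma pro_row_zero:
  assumes seg: "segmentwise K' w" and pro: "\<And>s t. e0 \<le> s \<Longrightarrow> s \<le> f0 \<Longrightarrow> b1 \<le> t \<Longrightarrow> t \<le> b2 \<Longrightarrow> hpro s t \<Longrightarrow> K' s t"
    and zc: "\<And>x t. x \<in> {e0, e1, a1, a2, f1, f0} \<Longrightarrow> b1 \<le> t \<Longrightarrow> t \<le> b2 \<Longrightarrow> w x t = 0"
    and lt: "e0 < e1" "e1 < a1" "a2 < f1" "f1 < f0"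
    and KK: "\<And>s t. K s t \<Longrightarrow> K' s t"
    and row: "\<And>s. a1 \<le> s \<Longrightarrow> s \<le> a2 \<Longrightarrow> K s t" and t: "b1 < t" "t < b2" and s: "a1 \<le> s" "s \<le> a2"
  shows "w s t = 0"
proof -
  have "east K a1 t" "\<not> west K a1 t" using edge_dirs(1)[OF wide, of t a1] row wide dir_region(2)[of a1 t] by auto
  then have "corner Q a1 t" using run_end_corner by blast
  then obtain z where z: "hedge Q a1 z t" using hedge_east \<open>east K a1 t\<close> by blast
  have "hpro x t" if "x \<le> a1" for x
    unfolding hpro_def by (rule exI[of _ z], rule exI[of _ a1]) (use z that t wide in \<open>auto simp: rim_def\<close>)
  then have "K' x t" if "e0 \<le> x" "x \<le> a1" for x using pro[of x t] that t lt wide by auto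
  then have "K' x t" if "e0 \<le> x" "x \<le> a2" for x using KK[OF row[of x]] that by (cases "x \<le> a1") auto
  then show ?thesis
    by (rule segment_zero[OF seg, of e0 a2 t e0 e1 a1]) (use lt wide s zc t in auto)
qed

end

context rect_mesh
begin

lemma horizontal_run_l_edge: "(y, s, t) \<in> ihruns \<Longrightarrow> hseg s t y \<in> interior_l_edges S"
  unfolding interior_l_edges_def horizontal_l_edges_eq by force

lemma vertical_run_l_edge: "(x, s, t) \<in> ivruns \<Longrightarrow> prod.swap ` hseg s t x \<in> interior_l_edges S"
  unfolding interior_l_edges_def vertical_l_edges_eq by force

lemma crosses_sw: "crosses (swap_quad -` Q) = prod.swap ` crosses Q"
  unfolding crosses_def by (auto simp: frame_sw)

lemma no_full_strip:
  assumes "l_edges_crossed S" "crosses Q \<noteq> {}"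
  shows "(a1, a2, c1, c2) \<notin> Q" "(c1, c2, b1, b2) \<notin> Q"
proof -
  show "(a1, a2, c1, c2) \<notin> Q"
  proof
    assume q: "(a1, a2, c1, c2) \<in> Q"
    show False
    proof (rule full_row_blocks[OF q _ assms(2)])
      fix y assume "(y, a1, a2) \<in> ihruns"
      from horizontal_run_l_edge[OF this] have "hseg a1 a2 y \<inter> crosses Q \<noteq> {}"
        using assms(1) unfolding l_edges_crossed_def crossing_eq by blast
      then show "\<exists>x. (x, y) \<in> crosses Q" unfolding hseg_def by auto
    qed
  qed
  show "(c1, c2, b1, b2) \<notin> Q"
  proof
    assume "(c1, c2, b1, b2) \<in> Q"
    then have q: "(b1, b2, c1, c2) \<in> swap_quad -` Q" by simp
    show False
    proof (rule sw.full_row_blocks[OF q])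
      show "crosses (swap_quad -` Q) \<noteq> {}" using assms(2) unfolding crosses_sw by simp
      fix x assume "(x, b1, b2) \<in> sw.ihruns"
      then have "prod.swap ` hseg b1 b2 x \<in> interior_l_edges S" unfolding sw_ihruns by (rule vertical_run_l_edge)
      then have "prod.swap ` hseg b1 b2 x \<inter> crosses Q \<noteq> {}"
        using assms(1) unfolding l_edges_crossed_def crossing_eq by blast
      then show "\<exists>y. (y, x) \<in> crosses (swap_quad -` Q)" unfolding crosses_sw hseg_def by auto
    qed
  qed
qed

end

definition bounded_by :: "quad set \<Rightarrow> real \<Rightarrow> real \<Rightarrow> real \<Rightarrow> real \<Rightarrow> bool"
  where "bounded_by T a1 a2 b1 b2 \<longleftrightarrow> (\<forall>x1 x2 y1 y2. (x1, x2, y1, y2) \<in> T \<longrightarrow> a1 \<le> x1 \<and> x2 \<le> a2 \<and> b1 \<le> y1 \<and> y2 \<le> b2)"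

lemma bounded_by_step:
  assumes w: "disjoint_cells T A" and C: "C \<subseteq> A" and i: "bounded_by T a1 a2 b1 b2" shows "bounded_by (refine_by T C) a1 a2 b1 b2"
  unfolding bounded_by_def
proof (intro allI impI)
  fix u1 u2 v1 v2 assume q: "(u1, u2, v1, v2) \<in> refine_by T C"
  show "a1 \<le> u1 \<and> u2 \<le> a2 \<and> b1 \<le> v1 \<and> v2 \<le> b2"
  proof (cases "(u1, u2, v1, v2) \<in> children C")
    case False
    then have "(u1, u2, v1, v2) \<in> T" using q unfolding refine_by_def by blast
    then show ?thesis using i unfolding bounded_by_def by blast
  next
    case True
    then obtain c where c: "c \<in> C" "child c (u1, u2, v1, v2)" unfolding children_def by blast
    obtain x1 x2 y1 y2 where e: "c = (x1, x2, y1, y2)" by (metis surj_pair)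
    have T: "(x1, x2, y1, y2) \<in> T" using c(1) C disjoint_cellsD(1)[OF w] e by auto
    then have "x1 \<le> u1 \<and> u1 < u2 \<and> u2 \<le> x2 \<and> y1 \<le> v1 \<and> v1 < v2 \<and> v2 \<le> y2"
      using child_bounds disjoint_cellsD(2)[OF w T] c(2) e by blast
    moreover have "a1 \<le> x1 \<and> x2 \<le> a2 \<and> b1 \<le> y1 \<and> y2 \<le> b2" using i T unfolding bounded_by_def by blast
    ultimately show ?thesis by auto
  qed
qed

lemma bounded_by_chain:
  assumes "refines\<^sup>*\<^sup>* (T, A) (Q, B)" "disjoint_cells T A" "bounded_by T a1 a2 b1 b2"
  shows "bounded_by Q a1 a2 b1 b2"
  using assms
proof (induction "(T, A)" arbitrary: T A rule: converse_rtranclp_induct)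
  case base then show ?case by blast
next
  case (step P)
  obtain C where C: "C \<subseteq> A" "P = (refine_by T C, children C)" using step.hyps(1) unfolding refines_def by auto
  show ?case
    by (rule step.hyps(3)[OF C(2) disjoint_cells_step[OF step.prems(1) C(1)] bounded_by_step[OF step.prems(1) C(1) step.prems(2)]])
qed

locale grid_chain = rect_mesh S a1 a2 b1 b2 for S a1 a2 b1 b2 +
  fixes x y :: "nat \<Rightarrow> real" and m n :: nat and B :: "quad set"
  assumes m: "0 < m" and n: "0 < n" and mx: "strict_mono_on {..m} x" and my: "strict_mono_on {..n} y"
    and chain: "refines\<^sup>*\<^sup>* (grid x m y n, grid x m y n) (Q, B)"
begin

lemmas grid_ok = grid_disjoint_cells[OF mx my]

lemma frame_grid_K: "frame (grid x m y n) s t \<Longrightarrow> K s t"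
  using persistence[OF chain grid_ok] by blast

lemma bounded_by_grid: "bounded_by (grid x m y n) (x 0) (x m) (y 0) (y n)"
  unfolding bounded_by_def
proof (intro allI impI)
  fix x1 x2 y1 y2 assume "(x1, x2, y1, y2) \<in> grid x m y n"
  then obtain i j where "x1 = x i" "x2 = x (Suc i)" "y1 = y j" "y2 = y (Suc j)" "i < m" "j < n" unfolding grid_def by auto
  then show "x 0 \<le> x1 \<and> x2 \<le> x m \<and> y 0 \<le> y1 \<and> y2 \<le> y n"
    using smono_le[OF mx, of 0 i] smono_le[OF mx, of "Suc i" m] smono_le[OF my, of 0 j] smono_le[OF my, of "Suc j" n] by auto
qed

lemma bounds: "x 0 = a1" "x m = a2" "y 0 = b1" "y n = b2"
proof -
  note W = bounded_by_chain[OF chain grid_ok bounded_by_grid]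
  have X: "x 0 \<le> z \<and> z \<le> x m" if "z \<in> xcoords Q" for z
    using that W cell unfolding xcoords_def bounded_by_def by force
  have Y: "y 0 \<le> z \<and> z \<le> y n" if "z \<in> xcoords (swap_quad -` Q)" for z
    using that W cell unfolding xcoords_def bounded_by_def by force
  have "x 0 \<le> x m" "y 0 \<le> y n" using smono_le[OF mx, of 0 m] smono_le[OF my, of 0 n] by auto
  then have "K (x 0) (y 0)" "K (x m) (y n)"
    using frame_grid_K[OF grid_frame_row[OF my m n, of 0 x "x 0"]] frame_grid_K[OF grid_frame_row[OF my m n, of n x "x m"]] by auto
  then have "a1 \<le> x 0" "b1 \<le> y 0" "x m \<le> a2" "y n \<le> b2" using K_region by blast+
  then show "x 0 = a1" "x m = a2" "y 0 = b1" "y n = b2"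
    using X[OF a1_xcoords] X[OF a2_xcoords] Y[OF sw.a1_xcoords] Y[OF sw.a2_xcoords] by auto
qed

lemma grid_adj: "adj4 (grid x m y n) (grid x m y n) a1 a2 b1 b2"
  using grid_adj4[of x m y n] unfolding bounds .

text \<open>With at least two rows and two columns the grid of level zero has a crossing, and it is a grid point,
hence not inside a cell of the grid.\<close>

lemma has_outer_grid:
  assumes "2 \<le> m" "2 \<le> n" shows "has_outer (grid x m y n)"
proof -
  have xl: "x 0 < x 1" "x 1 < x m" and yl: "y 0 < y 1" "y 1 < y n"
    using smono_less[OF mx, of 0 1] smono_less[OF mx, of 1 m] smono_less[OF my, of 0 1] smono_less[OF my, of 1 n] assms by auto
  have row: "\<forall>s. x 0 \<le> s \<and> s \<le> x m \<longrightarrow> K s (y 1)" using frame_grid_K[OF grid_frame_row[OF my m n, of 1]] n by auto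
  have col: "\<forall>t. y 0 \<le> t \<and> t \<le> y n \<longrightarrow> frame (swap_quad -` Q) t (x 1)" using frame_grid_K[OF grid_frame_col[OF mx m n, of 1]] m by (auto simp: frame_sw)
  have "x 0 < x m" "y 0 < y n" using xl yl by auto
  then have "(x 1, y 1) \<in> crosses Q"
    using edge_dirs[OF _ row, of "x 1"] sw.edge_dirs[OF _ col, of "y 1"] xl yl unfolding crosses_def by (simp add: frame_sw)
  moreover have "\<not> (x1 < x 1 \<and> x 1 < x2)" if q: "(x1, x2, y1, y2) \<in> grid x m y n" for x1 x2 y1 y2
  proof -
    obtain i where i: "x1 = x i" "x2 = x (Suc i)" "i < m" using q unfolding grid_def by auto
    then show ?thesis using smono_le[OF mx, of 1 i] by (cases i) auto
  qed
  ultimately show ?thesis unfolding has_outer_def by (metis fst_conv)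
qed

lemma rigid_of_grid:
  assumes mn: "2 \<le> m" "2 \<le> n" and conn: "crossing_vertex_connected S" shows "rigid K"
  unfolding rigid_def
proof (intro allI impI)
  fix u assume seg: "segmentwise K u"
  obtain a where a: "zero_on (grid x m y n) (\<lambda>s t. u s t - biq a s t)"
    using grid_biquadratic[OF seg mx my mn frame_grid_K] by blast
  have "zero_on Q (\<lambda>s t. u s t - biq a s t)"
    by (rule refine_zero[OF conn segmentwise_diff_biq[OF seg] chain grid_ok grid_adj a has_outer_grid[OF mn]])
  then show "\<exists>a. \<forall>x y. K x y \<longrightarrow> u x y = biq a x y" unfolding zero_on_def by (intro exI[of _ a]) simp
qed

lemma thin_grid_full: 
  "m = 1 \<Longrightarrow> (x1, x2, y1, y2) \<in> grid x m y n \<Longrightarrow> x1 = a1 \<and> x2 = a2"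
  "n = 1 \<Longrightarrow> (x1, x2, y1, y2) \<in> grid x m y n \<Longrightarrow> y1 = b1 \<and> y2 = b2"
  using bounds unfolding grid_def by auto

end

text \<open>The grid points and the midpoints of the intervals between them, in order.\<close>

definition halve :: "(nat \<Rightarrow> real) \<Rightarrow> nat \<Rightarrow> real"
  where "halve x k = (x (k div 2) + x ((k + 1) div 2)) / 2"

lemma halve_simps: "halve x (2 * i) = x i" "halve x (Suc (2 * i)) = (x i + x (Suc i)) / 2" "halve x (Suc (Suc (2 * i))) = x (Suc i)"
  unfolding halve_def by simp_all

lemma strict_mono_on_Suc:
  fixes z :: "nat \<Rightarrow> real"
  assumes "\<And>k. k < N \<Longrightarrow> z k < z (Suc k)" shows "strict_mono_on {..N} z"
proof (rule strict_mono_onI)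
  fix r s assume "r \<in> {..N}" "s \<in> {..N}" "r < s"
  then show "z r < z s"
  proof (induction s)
    case (Suc s)
    show ?case
    proof (cases "r = s")
      case True then show ?thesis using assms Suc.prems by auto
    next
      case False
      then have "z r < z s" using Suc by auto
      also have "z s < z (Suc s)" using assms Suc.prems by auto
      finally show ?thesis .
    qed
  qed simp
qed

lemma parity_cases: "k < 2 * m \<Longrightarrow> (\<exists>i<m. k = 2 * i) \<or> (\<exists>i<m. k = Suc (2 * i))" for k m :: nat
  by presburger

lemma halve_mono: "strict_mono_on {..m} x \<Longrightarrow> strict_mono_on {..2 * m} (halve x)"
proof (rule strict_mono_on_Suc)
  fix k assume x: "strict_mono_on {..m} x" and "k < 2 * m"
  from parity_cases[OF this(2)] show "halve x k < halve x (Suc k)"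
  proof (elim disjE exE conjE)
    fix i assume "i < m" "k = 2 * i"
    then show ?thesis using smono_less[OF x, of i "Suc i"] by (simp add: halve_simps)
  next
    fix i assume "i < m" "k = Suc (2 * i)"
    then show ?thesis using smono_less[OF x, of i "Suc i"] by (simp add: halve_simps)
  qed
qed

lemma children_grid: "children (grid x m y n) = grid (halve x) (2 * m) (halve y) (2 * n)"
proof (intro equalityI subsetI)
  fix q assume "q \<in> children (grid x m y n)"
  then obtain i j where ij: "i < m" "j < n" "child (x i, x (Suc i), y j, y (Suc j)) q" unfolding children_def grid_def by auto
  obtain u1 u2 v1 v2 where q: "q = (u1, u2, v1, v2)" by (metis surj_pair)
  have "\<exists>k<2 * m. u1 = halve x k \<and> u2 = halve x (Suc k)"
    using ij(1,3) unfolding q child.simps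
    by (elim conjE disjE) (rule exI[of _ "2 * i"], simp add: halve_simps, rule exI[of _ "2 * i"], simp add: halve_simps,
      rule exI[of _ "Suc (2 * i)"], simp add: halve_simps, rule exI[of _ "Suc (2 * i)"], simp add: halve_simps)
  moreover have "\<exists>l<2 * n. v1 = halve y l \<and> v2 = halve y (Suc l)"
    using ij(2,3) unfolding q child.simps
    by (elim conjE disjE) (rule exI[of _ "2 * j"], simp add: halve_simps, rule exI[of _ "Suc (2 * j)"], simp add: halve_simps,
      rule exI[of _ "2 * j"], simp add: halve_simps, rule exI[of _ "Suc (2 * j)"], simp add: halve_simps)
  ultimately show "q \<in> grid (halve x) (2 * m) (halve y) (2 * n)" unfolding grid_def q by blast
next
  fix q assume "q \<in> grid (halve x) (2 * m) (halve y) (2 * n)"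
  then obtain k l where kl: "q = (halve x k, halve x (Suc k), halve y l, halve y (Suc l))" "k < 2 * m" "l < 2 * n" unfolding grid_def by auto
  obtain i where i: "i < m" "k = 2 * i \<or> k = Suc (2 * i)" using parity_cases[OF kl(2)] by blast
  obtain j where j: "j < n" "l = 2 * j \<or> l = Suc (2 * j)" using parity_cases[OF kl(3)] by blast
  have "child (x i, x (Suc i), y j, y (Suc j)) q" using i(2) j(2) unfolding kl(1) by (auto simp: halve_simps)
  then show "q \<in> children (grid x m y n)" unfolding children_def grid_def using i(1) j(1) by blast
qed

context grid_chain
begin

text \<open>If the grid of level zero has a single row or column, none of its cells survives in the final mesh:
such a cell would span the rectangle in one direction, and the line next to it would be an l-edge
without crossing. So all cells are subdivided in the first step, and the result is again a
tensor-product grid, now with at least two rows and columns.\<close>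

lemma rigid_hierarchical:
  assumes conn: "crossing_vertex_connected S" and lc: "l_edges_crossed S" and ne: "crosses Q \<noteq> {}"
  shows "rigid K"
proof (cases "2 \<le> m \<and> 2 \<le> n")
  case True then show ?thesis using rigid_of_grid conn by blast
next
  case False
  then have thin: "m = 1 \<or> n = 1" using m n by auto
  have full: "q \<notin> Q" if "q \<in> grid x m y n" for q
    using that thin thin_grid_full no_full_strip[OF lc ne] by (cases q) metis
  have c0: "(x 0, x 1, y 0, y 1) \<in> grid x m y n" unfolding grid_def using m n by force
  from chain show ?thesis
  proof (cases rule: converse_rtranclpE)
    case base
    then show ?thesis using full[OF c0] c0 by auto
  next
    case (step P)
    then obtain C where C: "C \<subseteq> grid x m y n" "P = (refine_by (grid x m y n) C, children C)" unfolding refines_def by auto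
    have "grid x m y n - C \<subseteq> Q" by (rule kept_in_final[OF _ grid_ok C(1)]) (use step C in simp)
    then have "C = grid x m y n" using full C(1) by blast
    then have P: "P = (grid (halve x) (2 * m) (halve y) (2 * n), grid (halve x) (2 * m) (halve y) (2 * n))"
      using C(2) by (simp add: refine_by_def children_grid)
    interpret h: grid_chain S a1 a2 b1 b2 "halve x" "halve y" "2 * m" "2 * n" B
      by unfold_locales (use m n halve_mono[OF mx] halve_mono[OF my] step P in auto)
    show ?thesis by (rule h.rigid_of_grid) (use m n conn in auto)
  qed
qed

end

section \<open>Rigidity of extensions\<close>

lemma segmentwise_mono: "segmentwise K' u \<Longrightarrow> (\<And>x y. K x y \<Longrightarrow> K' x y) \<Longrightarrow> segmentwise K u"
  unfolding segmentwise_def by blast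

lemma on_ray:
  fixes x x' y sx sy :: real
  assumes "(x', y) \<in> closed_segment (x, y) (sx, sy)" "x \<noteq> x'"
  shows "sy = y \<and> (x < x' \<and> x' \<le> sx \<or> x' < x \<and> sx \<le> x')"
proof -
  obtain u where u: "0 \<le> u" "u \<le> 1" "x' = (1 - u) * x + u * sx" "y = (1 - u) * y + u * sy"
    using assms(1) unfolding closed_segment_def by auto
  have d: "x' - x = u * (sx - x)" "u * (sy - y) = 0" "sx - x' = (1 - u) * (sx - x)" using u(3,4) by algebra+
  then have pos: "u > 0" using assms(2) u(1) by (cases "u = 0") auto
  have "sy = y" using d(2) pos by simp
  moreover have "x < x' \<and> x' \<le> sx \<or> x' < x \<and> sx \<le> x'"
  proof (cases "x < sx")
    case True
    then have "0 < u * (sx - x)" "0 \<le> (1 - u) * (sx - x)" using pos u(2) by simp_all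
    then show ?thesis unfolding d(1,3)[symmetric] by auto
  next
    case False
    have "sx \<noteq> x" using d(1) assms(2) by auto
    then have "sx - x < 0" using False by simp
    then have "u * (sx - x) < 0" "(1 - u) * (sx - x) \<le> 0" using pos u(2) by (simp_all add: mult_pos_neg mult_nonneg_nonpos)
    then show ?thesis unfolding d(1,3)[symmetric] by auto
  qed
  ultimately show ?thesis by blast
qed

context rect_mesh
begin

lemma sw_hpro_edge: "sw.hpro t s \<longleftrightarrow> (\<exists>y y'. (s, y') \<in> rim \<and> (hedge (swap_quad -` Q) y y' s \<and> y' \<le> t \<or> hedge (swap_quad -` Q) y' y s \<and> t \<le> y'))"
  unfolding sw.hpro_def sw_rim by simp

lemma hpro_prolongation:
  assumes "hpro s t" "(s, t) \<in> R" shows "(s, t) \<in> prolongations S R"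
proof -
  obtain x x' where r: "(x', t) \<in> rim" and x: "hedge Q x x' t \<and> x' \<le> s \<or> hedge Q x' x t \<and> s \<le> x'"
    using assms(1) unfolding hpro_def by blast
  have V: "corner Q x t" "corner Q x' t" "x \<noteq> x'" using x unfolding hedge_def by auto
  have "closed_segment (x, t) (x', t) \<in> horizontal_edges S"
  proof -
    have "closed_segment (x, t) (x', t) = hseg (min x x') (max x x') t"
      using seg_hseg[of x x' t] seg_hseg[of x' x t] closed_segment_commute[of "(x, t)" "(x', t)"] by (cases "x \<le> x'") auto
    moreover have "hedge Q (min x x') (max x x') t" using x unfolding hedge_def by (auto simp: min_def max_def)
    ultimately show ?thesis unfolding horizontal_edges_eq hedges_def by blast
  qed
  moreover have "(x', t) \<in> closed_segment (x, t) (s, t)"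
    unfolding seg_h closed_segment_eq_real_ivl using x unfolding hedge_def by auto
  ultimately show ?thesis
    unfolding prolongations_def edges_def frontier_eq using assms(2) V r
    by (intro CollectI conjI exI[of _ "(x, t)"] exI[of _ "(x', t)"]) (auto simp: vertices_iff)
qed

lemma vpro_prolongation:
  assumes "sw.hpro t s" "(s, t) \<in> R" shows "(s, t) \<in> prolongations S R"
proof -
  obtain y y' where r: "(s, y') \<in> rim" and y: "hedge (swap_quad -` Q) y y' s \<and> y' \<le> t \<or> hedge (swap_quad -` Q) y' y s \<and> t \<le> y'"
    using assms(1) unfolding sw_hpro_edge by blast
  have V: "corner Q s y" "corner Q s y'" "y \<noteq> y'" using y unfolding hedge_def by (auto simp: corner_sw)
  have "closed_segment (s, y) (s, y') \<in> vertical_edges S"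
  proof -
    have "closed_segment (s, y) (s, y') = prod.swap ` hseg (min y y') (max y y') s"
      using seg_vseg[of y y' s] seg_vseg[of y' y s] closed_segment_commute[of "(s, y)" "(s, y')"] by (cases "y \<le> y'") auto
    moreover have "hedge (swap_quad -` Q) (min y y') (max y y') s" using y unfolding hedge_def by (auto simp: min_def max_def)
    ultimately show ?thesis unfolding vertical_edges_eq hedges_def by blast
  qed
  moreover have "(s, y') \<in> closed_segment (s, y) (s, t)"
    unfolding seg_v closed_segment_eq_real_ivl using y unfolding hedge_def by auto
  ultimately show ?thesis
    unfolding prolongations_def edges_def frontier_eq using assms(2) V r
    by (intro CollectI conjI exI[of _ "(s, y)"] exI[of _ "(s, y')"]) (auto simp: vertices_iff)
qed

lemma prolongation_cases:
  assumes "(s, t) \<in> prolongations S R" shows "(s, t) \<in> R \<and> (hpro s t \<or> sw.hpro t s)"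
proof -
  obtain p q where R: "(s, t) \<in> R" and pq: "p \<noteq> q" "closed_segment p q \<in> edges S" "q \<in> rim" "q \<in> closed_segment p (s, t)"
    using assms unfolding prolongations_def frontier_eq by blast
  from pq(2) have "closed_segment p q \<in> horizontal_edges S \<or> closed_segment p q \<in> vertical_edges S" unfolding edges_def by blast
  then show ?thesis
  proof
    assume "closed_segment p q \<in> horizontal_edges S"
    then obtain x x' y where e: "p = (x, y)" "q = (x', y)" "x < x' \<and> hedge Q x x' y \<or> x' < x \<and> hedge Q x' x y"
      using hor_edge_cases[OF pq(1)] by blast
    have "t = y \<and> (x < x' \<and> x' \<le> s \<or> x' < x \<and> s \<le> x')" by (rule on_ray) (use pq(1,4) e in auto)
    then have "hpro s t" unfolding hpro_def using e pq(3) by (metis less_asym)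
    then show ?thesis using R by blast
  next
    assume "closed_segment p q \<in> vertical_edges S"
    then obtain x y y' where e: "p = (x, y)" "q = (x, y')" "y < y' \<and> hedge (swap_quad -` Q) y y' x \<or> y' < y \<and> hedge (swap_quad -` Q) y' y x"
      using ver_edge_cases[OF pq(1)] by blast
    have "prod.swap q \<in> prod.swap ` closed_segment p (s, t)" using pq(4) by blast
    also have "prod.swap ` closed_segment p (s, t) = closed_segment (prod.swap p) (t, s)"
      by (subst closed_segment_linear_image[symmetric]) (auto intro!: linearI)
    finally have "s = x \<and> (y < y' \<and> y' \<le> t \<or> y' < y \<and> t \<le> y')" by (intro on_ray) (use pq(1) e in auto)
    then have "sw.hpro t s" unfolding sw_hpro_edge using e pq(3) by (metis less_asym)
    then show ?thesis using R by blast
  qed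
qed

end

context grid_chain
begin


text \<open>Segments from side to side are zeros by hypothesis. This settles the first step of the refinement
also if the grid of level zero has a single row or column, where there may be no crossing outside
the cell that is subdivided: then one midline of that cell runs from side to side. Afterwards the
centres of the subdivided cells serve as outer crossings for their quarters.\<close>

lemma zero_from_boundary:
  assumes conn: "crossing_vertex_connected S" and seg: "segmentwise K w"
    and z: "zero_on (grid x m y n) w"
    and rows: "\<And>s t. \<lbrakk>b1 < t; t < b2; \<And>s. a1 \<le> s \<Longrightarrow> s \<le> a2 \<Longrightarrow> K s t; a1 \<le> s; s \<le> a2\<rbrakk> \<Longrightarrow> w s t = 0"
    and cols: "\<And>s t. \<lbrakk>a1 < s; s < a2; \<And>t. b1 \<le> t \<Longrightarrow> t \<le> b2 \<Longrightarrow> K s t; b1 \<le> t; t \<le> b2\<rbrakk> \<Longrightarrow> w s t = 0"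
  shows "zero_on Q w"
proof (cases "2 \<le> m \<and> 2 \<le> n")
  case True
  show ?thesis by (rule refine_zero[OF conn seg chain grid_ok grid_adj z has_outer_grid]) (use True in auto)
next
  case False
  then have thin: "m = 1 \<or> n = 1" using m n by auto
  from chain show ?thesis
  proof (cases rule: converse_rtranclpE)
    case base then show ?thesis using z by simp
  next
    case (step P)
    then obtain C where C: "C \<subseteq> grid x m y n" "P = (refine_by (grid x m y n) C, children C)" unfolding refines_def by auto
    note ch = step(2)[unfolded C(2)]
    have w': "disjoint_cells (refine_by (grid x m y n) C) (children C)" by (rule disjoint_cells_step[OF grid_ok C(1)])
    have rK: "frame (refine_by (grid x m y n) C) s t \<Longrightarrow> K s t" for s t using persistence[OF ch w'] by blast
    have "cross_vanishes w x1 x2 y1 y2" if c: "(x1, x2, y1, y2) \<in> C" for x1 x2 y1 y2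
    proof -
      have cg: "(x1, x2, y1, y2) \<in> grid x m y n" using c C(1) by blast
      have lt: "x1 < x2" "y1 < y2" using disjoint_cellsD(2)[OF grid_ok cg] by auto
      have wi: "a1 \<le> x1" "x2 \<le> a2" "b1 \<le> y1" "y2 \<le> b2" using bounded_by_grid cg bounds unfolding bounded_by_def by auto
      let ?xm = "(x1 + x2) / 2" and ?ym = "(y1 + y2) / 2"
      have row: "K s ?ym" if "x1 \<le> s" "s \<le> x2" for s
        using frame_child[OF c lt, of s ?ym "grid x m y n"] lt that rK by auto
      have col: "K ?xm t" if "y1 \<le> t" "t \<le> y2" for t
        using frame_child[OF c lt, of ?xm t "grid x m y n"] lt that rK by auto
      have bz: "w x1 t = 0 \<and> w x2 t = 0" if "y1 \<le> t" "t \<le> y2" for t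
        using box_frame(1)[OF cg lt that] z unfolding zero_on_def by blast
      have bz': "w s y1 = 0 \<and> w s y2 = 0" if "x1 \<le> s" "s \<le> x2" for s
        using box_frame(2)[OF cg lt that] z unfolding zero_on_def by blast
      from thin show ?thesis
      proof
        assume "m = 1"
        then have e: "x1 = a1" "x2 = a2" using thin_grid_full(1) cg by blast+
        have r: "w s ?ym = 0" if "x1 \<le> s" "s \<le> x2" for s
          by (rule rows) (use row that e wi lt in auto)
        show ?thesis unfolding cross_vanishes_def
          by (rule cross_zero[OF seg lt row _ _ col, of x1 x2 x1 ?xm x2]) (use r lt bz' in auto)
      next
        assume "n = 1"
        then have e: "y1 = b1" "y2 = b2" using thin_grid_full(2) cg by blast+
        have r: "w ?xm t = 0" if "y1 \<le> t" "t \<le> y2" for t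
          by (rule cols) (use col that e wi lt in auto)
        have "(\<forall>t. y1 \<le> t \<and> t \<le> y2 \<longrightarrow> w ?xm t = 0) \<and> (\<forall>s. x1 \<le> s \<and> s \<le> x2 \<longrightarrow> w s ?ym = 0)"
          by (rule cross_zero[OF segmentwise_swap[OF seg] lt(2,1) col _ _ row, of y1 y2 y1 ?ym y2]) (use r lt bz in auto)
        then show ?thesis unfolding cross_vanishes_def by blast
      qed
    qed
    then have "zero_on (refine_by (grid x m y n) C) w" by (rule zero_step[OF grid_ok C(1) z])
    then show ?thesis
      by (rule refine_zero[OF conn seg ch w' adj4_step[OF grid_ok grid_adj C(1)] _ has_outer_children[OF grid_ok C(1) rK]])
  qed
qed

end

lemma skeleton_tensor_cells:
  "(s, t) \<in> skeleton (tensor_cells x m y n) \<longleftrightarrow> frame (grid x m y n) s t"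
proof -
  have "(s, t) \<in> skeleton (tensor_cells x m y n) \<longleftrightarrow>
      (\<exists>i j. i < m \<and> j < n \<and> (s, t) \<in> frontier (cbox (x i, y j) (x (Suc i), y (Suc j))))"
    unfolding skeleton_def tensor_cells_def by blast
  also have "\<dots> \<longleftrightarrow> frame (grid x m y n) s t"
    unfolding mem_frontier_pair frame_def grid_def by (simp only: mem_Collect_eq prod.inject) blast
  finally show ?thesis .
qed

text \<open>The surrounding lines form a grid with more than two rows and columns, so they determine the biquadratic
polynomial. After subtracting it the function vanishes on them, hence on all prolongations and on
all segments of the inner mesh from side to side, in particular on its grid of level zero, and then
on the whole inner mesh.\<close>

lemma extension_rigid:
  assumes S: "rect_mesh S (X 0) (X 5) (Y 0) (Y 5)" and X: "strict_mono_on {..5} X" and Y: "strict_mono_on {..5} Y"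
    and T: "grid_chain T (X 2) (X 3) (Y 2) (Y 3) x y m n B" and conn: "crossing_vertex_connected T"
    and sk: "skeleton S = skeleton (tensor_cells X 5 Y 5) \<union> skeleton T \<union> prolongations T (cbox (X 0, Y 0) (X 5, Y 5))"
  shows "rigid (frame (quads S))"
  unfolding rigid_def
proof (intro allI impI)
  interpret S: rect_mesh S "X 0" "X 5" "Y 0" "Y 5" by (rule S)
  interpret T: grid_chain T "X 2" "X 3" "Y 2" "Y 3" x y m n B by (rule T)
  have Xl: "X 0 < X 1" "X 1 < X 2" "X 2 < X 3" "X 3 < X 4" "X 4 < X 5"
    using smono_less[OF X, of 0 1] smono_less[OF X, of 1 2] smono_less[OF X, of 2 3] smono_less[OF X, of 3 4] smono_less[OF X, of 4 5] by auto
  have Yl: "Y 0 < Y 1" "Y 1 < Y 2" "Y 2 < Y 3" "Y 3 < Y 4" "Y 4 < Y 5"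
    using smono_less[OF Y, of 0 1] smono_less[OF Y, of 1 2] smono_less[OF Y, of 2 3] smono_less[OF Y, of 3 4] smono_less[OF Y, of 4 5] by auto
  let ?R = "cbox (X 0, Y 0) (X 5, Y 5)"
  have iff: "S.K s t \<longleftrightarrow> frame (grid X 5 Y 5) s t \<or> T.K s t \<or> (s, t) \<in> prolongations T ?R" for s t
    using sk unfolding S.skeleton_iff[symmetric] T.skeleton_iff[symmetric] skeleton_tensor_cells[symmetric] by blast
  fix u assume seg: "segmentwise S.K u"
  obtain a where a: "zero_on (grid X 5 Y 5) (\<lambda>s t. u s t - biq a s t)"
    using grid_biquadratic[OF seg X Y] iff by force
  define w where "w s t = u s t - biq a s t" for s t
  have sw: "segmentwise S.K w" unfolding w_def by (rule segmentwise_diff_biq[OF seg])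
  have swT: "segmentwise T.K w" by (rule segmentwise_mono[OF sw]) (simp add: iff)
  have wrow: "w s (Y j) = 0" if "j \<le> 5" "X 0 \<le> s" "s \<le> X 5" for s j
    using a grid_frame_row[OF Y, of 5 j X s] that unfolding zero_on_def w_def by simp
  have wcol: "w (X i) t = 0" if "i \<le> 5" "Y 0 \<le> t" "t \<le> Y 5" for t i
    using a grid_frame_col[OF X, of 5 i Y t] that unfolding zero_on_def w_def by simp
  have hK: "S.K s t" if "X 0 \<le> s" "s \<le> X 5" "Y 2 \<le> t" "t \<le> Y 3" "T.hpro s t" for s t
    using T.hpro_prolongation[OF that(5), of ?R] that Yl iff by auto
  have vK: "S.K s t" if "Y 0 \<le> t" "t \<le> Y 5" "X 2 \<le> s" "s \<le> X 3" "T.sw.hpro t s" for s t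
    using T.vpro_prolongation[OF that(5), of ?R] that Xl iff by auto
  have zc: "w z t = 0" if "z \<in> {X 0, X 1, X 2, X 3, X 4, X 5}" "Y 2 \<le> t" "t \<le> Y 3" for z t
    using that wcol[of _ t] Yl by auto
  have zr: "w s t = 0" if "t \<in> {Y 0, Y 1, Y 2, Y 3, Y 4, Y 5}" "X 2 \<le> s" "s \<le> X 3" for s t
    using that wrow[of _ s] Xl by auto
  have hz: "w s t = 0" if "T.hpro s t" "X 0 \<le> s" "s \<le> X 5" for s t
    by (rule T.pro_zero[OF sw hK zc _ Xl(1,2,4,5) that]) (use wrow Xl in auto)
  have vz: "w s t = 0" if "T.sw.hpro t s" "Y 0 \<le> t" "t \<le> Y 5" for s t
    by (rule T.sw.pro_zero[OF segmentwise_swap[OF sw] vK zr _ Yl(1,2,4,5) that]) (use wcol Yl in auto)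
  have rows: "w s t = 0" if "Y 2 < t" "t < Y 3" "\<And>s. X 2 \<le> s \<Longrightarrow> s \<le> X 3 \<Longrightarrow> T.K s t" "X 2 \<le> s" "s \<le> X 3" for s t
    by (rule T.pro_row_zero[OF sw hK zc Xl(1,2,4,5) _ that(3,1,2,4,5)]) (simp_all add: iff)
  have cols: "w s t = 0" if "X 2 < s" "s < X 3" "\<And>t. Y 2 \<le> t \<Longrightarrow> t \<le> Y 3 \<Longrightarrow> T.K s t" "Y 2 \<le> t" "t \<le> Y 3" for s t
    by (rule T.sw.pro_row_zero[OF segmentwise_swap[OF sw] vK zr Yl(1,2,4,5) _ _ that(1,2,4,5)]) (use that(3) in \<open>auto simp: iff frame_sw\<close>)
  have "zero_on (grid x m y n) w"
    unfolding zero_on_def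
  proof (intro allI impI)
    fix s t assume "frame (grid x m y n) s t"
    from grid_frame_cases[OF T.mx T.my this] show "w s t = 0"
    proof (elim disjE exE conjE)
      fix j assume j: "j \<le> n" "t = y j" "x 0 \<le> s" "s \<le> x m"
      have s: "X 2 \<le> s" "s \<le> X 3" and t: "Y 2 \<le> t" "t \<le> Y 3"
        using j T.bounds smono_le[OF T.my, of 0 j] smono_le[OF T.my, of j n] by auto
      consider "t = Y 2" | "t = Y 3" | "Y 2 < t" "t < Y 3" using t by linarith
      then show ?thesis
      proof cases
        case 3
        have "T.K z t" if "X 2 \<le> z" "z \<le> X 3" for z
          using T.frame_grid_K[OF grid_frame_row[OF T.my T.m T.n j(1), of x z]] that T.bounds j(2) by simp
        then show ?thesis using rows[OF 3] s by blast
      qed (use s Xl wrow[of 2 s] wrow[of 3 s] in auto)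
    next
      fix i assume i: "i \<le> m" "s = x i" "y 0 \<le> t" "t \<le> y n"
      have t: "Y 2 \<le> t" "t \<le> Y 3" and s: "X 2 \<le> s" "s \<le> X 3"
        using i T.bounds smono_le[OF T.mx, of 0 i] smono_le[OF T.mx, of i m] by auto
      consider "s = X 2" | "s = X 3" | "X 2 < s" "s < X 3" using s by linarith
      then show ?thesis
      proof cases
        case 3
        have "T.K s z" if "Y 2 \<le> z" "z \<le> Y 3" for z
          using T.frame_grid_K[OF grid_frame_col[OF T.mx T.m T.n i(1), of y z]] that T.bounds i(2) by simp
        then show ?thesis using cols[OF 3] t by blast
      qed (use t Yl wcol[of 2 t] wcol[of 3 t] in auto)
    qed
  qed
  then have zT: "zero_on (quads T) w" by (rule T.zero_from_boundary[OF conn swT _ rows cols])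
  have "w s t = 0" if "S.K s t" for s t
    using that[unfolded iff]
  proof (elim disjE)
    assume "frame (grid X 5 Y 5) s t" then show ?thesis using a unfolding zero_on_def w_def by blast
  next
    assume "T.K s t" then show ?thesis using zT unfolding zero_on_def by blast
  next
    assume "(s, t) \<in> prolongations T ?R"
    from T.prolongation_cases[OF this] show ?thesis using hz vz by auto
  qed
  then show "\<exists>a. \<forall>s t. S.K s t \<longrightarrow> u s t = biq a s t" unfolding w_def by (intro exI[of _ a]) auto
qed

lemma hierarchical_grid_chain:
  assumes "hierarchical_t_mesh T" "rect_mesh T a1 a2 b1 b2"
  shows "\<exists>x y m n B. grid_chain T a1 a2 b1 b2 x y m n B"
proof -
  obtain k A where "level_mesh k T A" using assms(1) unfolding hierarchical_t_mesh_def by blast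
  from level_mesh_chain[OF this] obtain x m y n where
    *: "0 < m" "0 < n" "strict_mono_on {..m} x" "strict_mono_on {..n} y" "refines\<^sup>*\<^sup>* (grid x m y n, grid x m y n) (quads T, quads A)"
    by blast
  have "grid_chain T a1 a2 b1 b2 x y m n (quads A)"
    unfolding grid_chain_def grid_chain_axioms_def using assms(2) * by blast
  then show ?thesis by blast
qed

lemma regular_rect_mesh:
  assumes "regular_t_mesh T" shows "\<exists>a1 a2 b1 b2. rect_mesh T a1 a2 b1 b2"
proof -
  obtain a b where ab: "t_mesh T" "T \<noteq> {}" "region T = cbox a b" using assms unfolding regular_t_mesh_def by blast
  obtain a1 b1 a2 b2 where "a = (a1, b1)" "b = (a2, b2)" by (metis surj_pair)
  then show ?thesis using rect_meshI[of T a1 b1 a2 b2] ab by blast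
qed

theorem theorem5p10:
  fixes S :: mesh
  assumes "hierarchical_t_mesh S \<and> crossing_vertex_connected S \<and> l_edges_crossed S \<or>
           (\<exists>T. hierarchical_t_mesh T \<and> crossing_vertex_connected T \<and> extension_of S T)"
    and "0 < card (crossing_vertices S)"
  shows "(\<exists>B. finite B \<and> span B = spline_space_bar S) \<and>
         int (dim (spline_space_bar S)) =
           int (card (crossing_vertices S)) - int (card (interior_l_edges S)) + 1"
proof -
  have ne: "crossing_vertices S \<noteq> {}" using assms(2) by auto
  have "\<exists>a1 a2 b1 b2. rect_mesh S a1 a2 b1 b2 \<and> rigid (frame (quads S))"
    using assms(1)
  proof
    assume S: "hierarchical_t_mesh S \<and> crossing_vertex_connected S \<and> l_edges_crossed S"
    then have "regular_t_mesh S" unfolding crossing_vertex_connected_def by blast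
    then obtain a1 a2 b1 b2 where r: "rect_mesh S a1 a2 b1 b2" using regular_rect_mesh by blast
    then obtain x y m n B where g: "grid_chain S a1 a2 b1 b2 x y m n B" using hierarchical_grid_chain S by blast
    have "crosses (quads S) \<noteq> {}" using ne rect_mesh.crossing_eq[OF r] by simp
    then have "rigid (frame (quads S))" using grid_chain.rigid_hierarchical[OF g] S by blast
    then show ?thesis using r by blast
  next
    assume "\<exists>T. hierarchical_t_mesh T \<and> crossing_vertex_connected T \<and> extension_of S T"
    then obtain T X Y where T: "hierarchical_t_mesh T" "crossing_vertex_connected T"
      and X: "strict_mono_on {..5} X" and Y: "strict_mono_on {..5} Y"
      and rT: "region T = cbox (X 2, Y 2) (X 3, Y 3)" and S: "t_mesh S" "region S = cbox (X 0, Y 0) (X 5, Y 5)"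
      and sk: "skeleton S = skeleton (tensor_cells X 5 Y 5) \<union> skeleton T \<union> prolongations T (cbox (X 0, Y 0) (X 5, Y 5))"
      unfolding extension_of_def by blast
    have lt: "X 0 < X 5" "Y 0 < Y 5" "X 2 < X 3" "Y 2 < Y 3" using smono_less[OF X, of 0 5] smono_less[OF Y, of 0 5] 
      smono_less[OF X, of 2 3] smono_less[OF Y, of 2 3] by auto
    have rS: "rect_mesh S (X 0) (X 5) (Y 0) (Y 5)" by unfold_locales (use S lt in auto)
    have "t_mesh T" using T(2) unfolding crossing_vertex_connected_def regular_t_mesh_def by blast
    then have "rect_mesh T (X 2) (X 3) (Y 2) (Y 3)" by unfold_locales (use rT lt in auto)
    then obtain x y m n B where g: "grid_chain T (X 2) (X 3) (Y 2) (Y 3) x y m n B" using hierarchical_grid_chain T(1) by blast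
    show ?thesis using rS extension_rigid[OF rS X Y g T(2) sk] by blast
  qed
  then obtain a1 a2 b1 b2 where r: "rect_mesh S a1 a2 b1 b2" "rigid (frame (quads S))" by blast
  have "crosses (quads S) \<noteq> {}" using ne rect_mesh.crossing_eq[OF r(1)] by simp
  then show ?thesis using rect_mesh.dimension[OF r] by blast
qed

end
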